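(* Let $1\leq p<2$. Let $\Lambda$ be a multiplier on $\mathcal{S}_{p}(\mathcal{X})$ with symbol $\kappa(z)$ satisfying $\kappa(z)\neq 0$ for all $z\in S_{p}$. Suppose that an infinite sequence $\{T_{k}\}_{k\in\mathbb{Z}_+}$ of $L^{p}$-tempered distributions on $\mathcal{X}$ satisfies the following conditions: (i) $\Lambda T_{k}=A\,T_{k+1}$ for some $A\in\mathbb{C}\setminus\{0\}$ and for all $k\in\mathbb{Z}_+$. (ii) For a fixed semi-norm $\nu_{p,m}(\cdot)$ of $\mathcal{S}_{p}(\mathcal{X})$ (with $m\in\mathbb{Z}_+$ independent of $k$) and a constant $M>0$, $|\langle T_{k},\phi\rangle|\leq M\nu_{p,m}(\phi)$ for all $k\in\mathbb{Z}_+$ and all $\phi\in\mathcal{S}_{p}(\mathcal{X})$. Then the following assertions hold: (a) If $|A|=\min\{|\kappa(z)|:z\in S_{p}\}$ and if the range $\kappa(S_p)$ intersects $\{w\in\mathbb{C}:|w|=|A|\}$ at finitely many distinct points $A_{1},\ldots,A_{j}$, then $T_{0}$ can be uniquely written as $T_{0}=T_{0,1}+T_{0,2}+\cdots+T_{0,j}$ for some $L^{p}$-tempered distributions $T_{0,i}$ on $\mathcal{X}$ satisfying $\Lambda T_{0,i}=A_{i}T_{0,i}$ for all $i=1,\ldots,j$. (b) If $|A|<\min\{|\kappa(z)|:z\in S_{p}\}$, then $T_{0}=0$.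
   Context: Let $q\geq 2$ be an integer and let $\mathcal{X}$ be the homogeneous tree of degree $q+1$ (the connected graph without cycles in which every vertex has $q+1$ neighbours), identified with its set of vertices, with graph distance $d$, counting measure, a fixed reference vertex $o$, and $|x|=d(o,x)$. A function on $\mathcal{X}$ is radial if its value at $x$ depends only on $|x|$; for radial $k$ we write $k(n)$ for its value at vertices with $|x|=n$. For $k$ radial, $f\ast k(x)=\sum_{y\in\mathcal{X}}f(y)k(d(x,y))$. $\mathbb{Z}_+$ is the set of nonnegative integers. For $p\in(1,\infty)$ put $\delta_p=\frac1p-\frac12$; $\delta_1=\frac12$. For $1\le p<2$, $S_p=\{z\in\mathbb{C}:|\Im z|\le|\delta_p|\}$. Boundary and spherical functions: $\Omega$ is the set of infinite geodesic rays $\omega=\{\omega_0,\omega_1,\dots\}$ starting at $\omega_0=o$; for $x\in\mathcal{X}$, $c(x,\omega)$ is the last vertex of the geodesic path from $o$ to $x$ that lies on $\omega$. $\nu$ is the Borel probability measure on $\Omega$ giving mass $(q+1)^{-1}q^{-n+1}$ to each set $\{\omega:|c(x,\omega)|=|x|\}$ with $|x|=n\ge1$ (these sets, for $x\in\mathcal X$, form a basis of the topology). The Poisson kernel is $p(x,\omega)=q^{2|c(x,\omega)|-|x|}$, and the elementary spherical function is $\phi_z(x)=\int_\Omega p^{1/2+iz}(x,\omega)\,d\nu(\omega)$, $z\in\mathbb{C}$ (a radial function). For a radial function $k$, its spherical Fourier transform is $\widehat{k}(z)=\sum_{x\in\mathcal{X}}k(x)\phi_z(x)$. For $1\le p<2$,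 $\mathcal{S}_p(\mathcal{X})$ is the Fréchet space of functions $\phi$ on $\mathcal{X}$ with $\nu_{p,m}(\phi)=\sup_{x\in\mathcal{X}}(1+|x|)^m q^{|x|/p}|\phi(x)|<\infty$ for all $m\in\mathbb{Z}_+$, topologized by these seminorms. An $L^p$-tempered distribution is a continuous linear functional $T:\mathcal{S}_p(\mathcal{X})\to\mathbb{C}$, with action written $\langle T,\phi\rangle$. A multiplier on $\mathcal{S}_p(\mathcal{X})$ with symbol $\kappa$ is an operator $\Lambda\phi=\phi\ast k$ from $\mathcal{S}_p(\mathcal{X})$ to itself, where $k$ is a radial function such that for every $m\in\mathbb{Z}_+$ there is $C_m>0$ with $\nu_{p,m}(\phi\ast k)\le C_m\nu_{p,m}(\phi)$ for all $\phi\in\mathcal{S}_p(\mathcal{X})$; its symbol is $\kappa(z)=\widehat{k}(z)$, $z\in S_p$ (such $k$ lies in $\mathcal S_p(\mathcal X)$, so the series converges on $S_p$). It acts on $L^p$-tempered distributions by $\langle\Lambda T,\phi\rangle=\langle T,\Lambda\phi\rangle$. *)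

theory Defs
  imports "HOL-Probability.Probability"
begin

text \<open>
  A simple graph is given by a symmetric, irreflexive adjacency relation \<open>E\<close> whose vertex set is
  the whole type \<open>'v\<close>.  The fixed reference vertex is written \<open>r\<close> (the letter \<open>o\<close> being
  function composition in HOL).
\<close>

definition walk :: "('v \<Rightarrow> 'v \<Rightarrow> bool) \<Rightarrow> 'v \<Rightarrow> 'v \<Rightarrow> 'v list \<Rightarrow> bool" where
  "walk E x y xs \<longleftrightarrow> xs \<noteq> [] \<and> hd xs = x \<and> last xs = y \<and> successively E xs"

definition is_cycle :: "('v \<Rightarrow> 'v \<Rightarrow> bool) \<Rightarrow> 'v list \<Rightarrow> bool" where
  "is_cycle E xs \<longleftrightarrow> 3 \<le> length xs \<and> distinct xs \<and> successively E xs \<and> E (last xs) (hd xs)"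

definition homogeneous_tree :: "nat \<Rightarrow> ('v \<Rightarrow> 'v \<Rightarrow> bool) \<Rightarrow> bool" where
  "homogeneous_tree q E \<longleftrightarrow>
     (\<forall>x y. E x y \<longrightarrow> E y x) \<and> (\<forall>x. \<not> E x x) \<and>
     (\<forall>x y. \<exists>xs. walk E x y xs) \<and>
     (\<nexists>xs. is_cycle E xs) \<and>
     (\<forall>x. card {y. E x y} = q + 1)"

definition gdist :: "('v \<Rightarrow> 'v \<Rightarrow> bool) \<Rightarrow> 'v \<Rightarrow> 'v \<Rightarrow> nat" where
  "gdist E x y = (LEAST n. \<exists>xs. walk E x y xs \<and> length xs = n + 1)"

definition geodesic_path :: "('v \<Rightarrow> 'v \<Rightarrow> bool) \<Rightarrow> 'v \<Rightarrow> 'v \<Rightarrow> 'v list" where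
  "geodesic_path E x y = (THE xs. walk E x y xs \<and> length xs = gdist E x y + 1)"


definition radial :: "('v \<Rightarrow> 'v \<Rightarrow> bool) \<Rightarrow> 'v \<Rightarrow> ('v \<Rightarrow> complex) \<Rightarrow> bool" where
  "radial E r k \<longleftrightarrow> (\<forall>x y. gdist E r x = gdist E r y \<longrightarrow> k x = k y)"

definition radial_value :: "('v \<Rightarrow> 'v \<Rightarrow> bool) \<Rightarrow> 'v \<Rightarrow> ('v \<Rightarrow> complex) \<Rightarrow> nat \<Rightarrow> complex" where
  "radial_value E r k n = (THE c. \<forall>x. gdist E r x = n \<longrightarrow> k x = c)"

definition conv :: "('v \<Rightarrow> 'v \<Rightarrow> bool) \<Rightarrow> 'v \<Rightarrow> ('v \<Rightarrow> complex) \<Rightarrow> ('v \<Rightarrow> complex) \<Rightarrow> 'v \<Rightarrow> complex" where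
  "conv E r f k x = (\<Sum>\<^sub>\<infinity>y. f y * radial_value E r k (gdist E x y))"


definition boundary :: "('v \<Rightarrow> 'v \<Rightarrow> bool) \<Rightarrow> 'v \<Rightarrow> (nat \<Rightarrow> 'v) set" where
  "boundary E r = {\<omega>. \<omega> 0 = r \<and> (\<forall>m n. m \<le> n \<longrightarrow> gdist E (\<omega> m) (\<omega> n) = n - m)}"

definition confluent :: "('v \<Rightarrow> 'v \<Rightarrow> bool) \<Rightarrow> 'v \<Rightarrow> 'v \<Rightarrow> (nat \<Rightarrow> 'v) \<Rightarrow> 'v" where
  "confluent E r x \<omega> = last (filter (\<lambda>v. v \<in> range \<omega>) (geodesic_path E r x))"

definition boundary_cyl :: "('v \<Rightarrow> 'v \<Rightarrow> bool) \<Rightarrow> 'v \<Rightarrow> 'v \<Rightarrow> (nat \<Rightarrow> 'v) set" where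
  "boundary_cyl E r x = {\<omega> \<in> boundary E r. gdist E r (confluent E r x \<omega>) = gdist E r x}"

definition boundary_topology :: "('v \<Rightarrow> 'v \<Rightarrow> bool) \<Rightarrow> 'v \<Rightarrow> (nat \<Rightarrow> 'v) topology" where
  "boundary_topology E r = topology_generated_by (range (boundary_cyl E r))"

text \<open>
  The following conditions determine \<open>\<nu>\<close> uniquely: the cylinder sets, together with the empty set,
  are closed under intersection and generate the Borel sets.
\<close>

definition boundary_measure ::
  "nat \<Rightarrow> ('v \<Rightarrow> 'v \<Rightarrow> bool) \<Rightarrow> 'v \<Rightarrow> (nat \<Rightarrow> 'v) measure \<Rightarrow> bool" where
  "boundary_measure q E r \<nu> \<longleftrightarrow>
     prob_space \<nu> \<and> space \<nu> = boundary E r \<and>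
     sets \<nu> = sigma_sets (boundary E r) {U. openin (boundary_topology E r) U} \<and>
     (\<forall>x. 1 \<le> gdist E r x \<longrightarrow>
        measure \<nu> (boundary_cyl E r x) = 1 / (real q + 1) * real q powi (1 - int (gdist E r x)))"

definition poisson_kernel ::
  "nat \<Rightarrow> ('v \<Rightarrow> 'v \<Rightarrow> bool) \<Rightarrow> 'v \<Rightarrow> 'v \<Rightarrow> (nat \<Rightarrow> 'v) \<Rightarrow> real" where
  "poisson_kernel q E r x \<omega> =
     real q powi (2 * int (gdist E r (confluent E r x \<omega>)) - int (gdist E r x))"

definition spherical_function ::
  "nat \<Rightarrow> ('v \<Rightarrow> 'v \<Rightarrow> bool) \<Rightarrow> 'v \<Rightarrow> (nat \<Rightarrow> 'v) measure \<Rightarrow> complex \<Rightarrow> 'v \<Rightarrow> complex" where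
  "spherical_function q E r \<nu> z x =
     (\<integral>\<omega>. complex_of_real (poisson_kernel q E r x \<omega>) powr (1 / 2 + \<i> * z) \<partial>\<nu>)"

definition spherical_transform ::
  "nat \<Rightarrow> ('v \<Rightarrow> 'v \<Rightarrow> bool) \<Rightarrow> 'v \<Rightarrow> (nat \<Rightarrow> 'v) measure \<Rightarrow> ('v \<Rightarrow> complex) \<Rightarrow> complex \<Rightarrow> complex" where
  "spherical_transform q E r \<nu> k z = (\<Sum>\<^sub>\<infinity>x. k x * spherical_function q E r \<nu> z x)"

definition strip :: "real \<Rightarrow> complex set" where
  "strip p = {z. \<bar>Im z\<bar> \<le> \<bar>1 / p - 1 / 2\<bar>}"


definition weighted_abs ::
  "nat \<Rightarrow> ('v \<Rightarrow> 'v \<Rightarrow> bool) \<Rightarrow> 'v \<Rightarrow> real \<Rightarrow> nat \<Rightarrow> ('v \<Rightarrow> complex) \<Rightarrow> 'v \<Rightarrow> real" where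
  "weighted_abs q E r p m \<phi> x =
     (1 + real (gdist E r x)) ^ m * real q powr (real (gdist E r x) / p) * cmod (\<phi> x)"

text \<open>The supremum is taken in \<open>real\<close>, so it is meaningful only on functions for which it is finite,
  in particular on the space \<open>schwartz\<close> below.\<close>

definition schwartz_seminorm ::
  "nat \<Rightarrow> ('v \<Rightarrow> 'v \<Rightarrow> bool) \<Rightarrow> 'v \<Rightarrow> real \<Rightarrow> nat \<Rightarrow> ('v \<Rightarrow> complex) \<Rightarrow> real" where
  "schwartz_seminorm q E r p m \<phi> = (SUP x. weighted_abs q E r p m \<phi> x)"

definition schwartz ::
  "nat \<Rightarrow> ('v \<Rightarrow> 'v \<Rightarrow> bool) \<Rightarrow> 'v \<Rightarrow> real \<Rightarrow> ('v \<Rightarrow> complex) set" where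
  "schwartz q E r p = {\<phi>. \<forall>m. bdd_above (range (weighted_abs q E r p m \<phi>))}"

definition schwartz_topology ::
  "nat \<Rightarrow> ('v \<Rightarrow> 'v \<Rightarrow> bool) \<Rightarrow> 'v \<Rightarrow> real \<Rightarrow> ('v \<Rightarrow> complex) topology" where
  "schwartz_topology q E r p = topology_generated_by
     {{\<psi> \<in> schwartz q E r p. schwartz_seminorm q E r p m (\<lambda>x. \<psi> x - \<phi> x) < \<epsilon>} | m \<phi> \<epsilon>.
        \<phi> \<in> schwartz q E r p \<and> 0 < \<epsilon>}"

text \<open>
  Distributions are represented by total functions of which only the values on \<open>schwartz q E r p\<close>
  matter; two of them are the same distribution iff they agree there.  The topological space
  \<open>schwartz_topology q E r p\<close> has underlying set \<open>schwartz q E r p\<close>.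
\<close>

definition tempered_distribution ::
  "nat \<Rightarrow> ('v \<Rightarrow> 'v \<Rightarrow> bool) \<Rightarrow> 'v \<Rightarrow> real \<Rightarrow> (('v \<Rightarrow> complex) \<Rightarrow> complex) \<Rightarrow> bool" where
  "tempered_distribution q E r p T \<longleftrightarrow>
     (\<forall>\<phi>\<in>schwartz q E r p. \<forall>\<psi>\<in>schwartz q E r p. T (\<lambda>x. \<phi> x + \<psi> x) = T \<phi> + T \<psi>) \<and>
     (\<forall>c. \<forall>\<phi>\<in>schwartz q E r p. T (\<lambda>x. c * \<phi> x) = c * T \<phi>) \<and>
     continuous_map (schwartz_topology q E r p) euclidean T"

text \<open>
  No summability condition is needed for \<open>conv\<close>: for the indicator \<open>\<phi>\<close> of \<open>{r}\<close> the first condition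
  gives \<open>k \<in> schwartz q E r p\<close>, and then all sums involved converge absolutely.
\<close>

definition is_multiplier ::
  "nat \<Rightarrow> ('v \<Rightarrow> 'v \<Rightarrow> bool) \<Rightarrow> 'v \<Rightarrow> (nat \<Rightarrow> 'v) measure \<Rightarrow> real \<Rightarrow>
   (('v \<Rightarrow> complex) \<Rightarrow> 'v \<Rightarrow> complex) \<Rightarrow> (complex \<Rightarrow> complex) \<Rightarrow> bool" where
  "is_multiplier q E r \<nu> p \<Lambda> \<kappa> \<longleftrightarrow>
     (\<exists>k. radial E r k \<and>
        (\<forall>\<phi>\<in>schwartz q E r p. conv E r \<phi> k \<in> schwartz q E r p) \<and>
        (\<forall>m. \<exists>C>0. \<forall>\<phi>\<in>schwartz q E r p.
           schwartz_seminorm q E r p m (conv E r \<phi> k) \<le> C * schwartz_seminorm q E r p m \<phi>) \<and>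
        (\<forall>\<phi>\<in>schwartz q E r p. \<Lambda> \<phi> = conv E r \<phi> k) \<and>
        (\<forall>z\<in>strip p. \<kappa> z = spherical_transform q E r \<nu> k z))"

definition dist_action ::
  "(('v \<Rightarrow> complex) \<Rightarrow> 'v \<Rightarrow> complex) \<Rightarrow> (('v \<Rightarrow> complex) \<Rightarrow> complex) \<Rightarrow> ('v \<Rightarrow> complex) \<Rightarrow> complex" where
  "dist_action \<Lambda> T \<phi> = T (\<Lambda> \<phi>)"

definition eigen_decomposition ::
  "nat \<Rightarrow> ('v \<Rightarrow> 'v \<Rightarrow> bool) \<Rightarrow> 'v \<Rightarrow> real \<Rightarrow> (('v \<Rightarrow> complex) \<Rightarrow> 'v \<Rightarrow> complex) \<Rightarrow> nat \<Rightarrow>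
   (nat \<Rightarrow> complex) \<Rightarrow> (('v \<Rightarrow> complex) \<Rightarrow> complex) \<Rightarrow> (nat \<Rightarrow> ('v \<Rightarrow> complex) \<Rightarrow> complex) \<Rightarrow> bool" where
  "eigen_decomposition q E r p \<Lambda> j a T\<^sub>0 S \<longleftrightarrow>
     (\<forall>i\<in>{1..j}. tempered_distribution q E r p (S i) \<and>
        (\<forall>\<phi>\<in>schwartz q E r p. dist_action \<Lambda> (S i) \<phi> = a i * S i \<phi>)) \<and>
     (\<forall>\<phi>\<in>schwartz q E r p. T\<^sub>0 \<phi> = (\<Sum>i=1..j. S i \<phi>))"

end

theory Submission
  imports Defs "HOL-Complex_Analysis.Complex_Analysis"
begin

text \<open>
  Write \<open>d\<close> for the distance, \<open>S\<^sub>n\<close> for the sum over the sphere of radius \<open>n\<close>, and \<open>u = q\<^sup>i\<^sup>z\<close>. The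
  operators \<open>S\<^sub>n\<close> are polynomials in the neighbour sum \<open>S\<^sub>1\<close>, and \<open>S\<^sub>1\<close> multiplies the spherical function
  \<open>\<phi>\<^sub>z\<close> by \<open>q\<^sup>1\<^sup>/\<^sup>2 (u + 1 / u)\<close>. In the basis \<open>V\<^sub>n\<close> (\<open>cheb n\<close>) of Chebyshev polynomials in \<open>q\<^sup>-\<^sup>1\<^sup>/\<^sup>2 S\<^sub>1\<close>, which
  act on \<open>\<phi>\<^sub>z\<close> by \<open>u\<^sup>n + u\<^sup>-\<^sup>n\<close>, the multiplier is a series \<open>\<Sum> a\<^sub>n V\<^sub>n\<close> and its symbol is the Laurent series
  \<open>\<Sum> a\<^sub>n (u\<^sup>n + u\<^sup>-\<^sup>n)\<close>. The strip corresponds to the annulus \<open>1 / R \<le> \<bar>u\<bar> \<le> R\<close>, where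
  \<open>R = q\<^sup>1\<^sup>/\<^sup>p\<^sup>-\<^sup>1\<^sup>/\<^sup>2\<close>, and \<open>\<nu>\<^bsub>p,m\<^esub>(V\<^sub>n \<phi>)\<close> grows like \<open>R\<^sup>n\<close> up to a power of \<open>n\<close>
  (\<open>weighted_bound_cheb\<close>). As \<open>k\<close> is a Schwartz function, \<open>a\<^sub>n\<close> decays faster than \<open>n\<^sup>-\<^sup>N R\<^sup>-\<^sup>n\<close> for all
  \<open>N\<close> (\<open>abel_nrapid\<close>), and everything converges.

  Put \<open>U = \<Lambda> / A\<close> and let \<open>h = \<kappa> / A\<close> be its symbol. If \<open>w\<close> has distance at least \<open>\<epsilon>\<close> from the
  range of \<open>h\<close>, the Laurent coefficients of \<open>1 / (w - h)\<close> on the annulus are again rapidly decreasing, with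
  bounds polynomial in \<open>1 / \<epsilon>\<close> (\<open>laurent_coeff_resolvent_power\<close>): integration by parts trades powers of the
  index for powers of the resolvent. So \<open>w - U\<close> is invertible on the Schwartz space, and the seminorms of
  its inverse are bounded by powers of \<open>1 / \<epsilon>\<close> (\<open>resolvent\<close>, \<open>resolvent_seminorm\<close>).

  Assume that \<open>\<bar>A\<bar>\<close> does not exceed the least modulus of \<open>\<kappa>\<close>, so that \<open>\<bar>h\<bar> \<ge> 1\<close>, with equality of moduli
  only for values in the finite set \<open>Z = {A\<^sub>i / A}\<close>. For a Schwartz function \<open>\<phi>\<close> the numbers
  \<open>t\<^sub>n = \<langle>T\<^sub>n, \<phi>\<rangle> = \<langle>T\<^sub>0, U\<^sup>n \<phi>\<rangle>\<close> are bounded. Their generating function \<open>G(w) = \<Sum> t\<^sub>n w\<^sup>-\<^sup>n\<^sup>-\<^sup>1\<close>, \<open>\<bar>w\<bar> > 1\<close>,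
  continues through \<open>\<langle>T\<^sub>0, (w - U)\<^sup>-\<^sup>1 \<phi>\<rangle>\<close> to the complement of \<open>Z\<close>, and it is bounded by a power of
  \<open>1 / (1 - \<bar>w\<bar>)\<close> inside the disc. By this growth the points of \<open>Z\<close> are at worst poles (\<open>residue_eq_0_of_growth\<close>), and
  boundedness of the sequence makes these simple. Therefore \<open>t\<^sub>n = \<Sum> c\<^sub>\<alpha> \<alpha>\<^sup>n\<close> with \<open>\<alpha>\<close> ranging over \<open>Z\<close>
  (\<open>bounded_sequence_finite_spectrum\<close>, \<open>orbit_expansion\<close>).

  If the inequality is strict, \<open>Z\<close> is empty and \<open>T\<^sub>0 = 0\<close>. In general Lagrange interpolation expresses
  \<open>c\<^sub>\<alpha>\<close> as a fixed linear combination of finitely many \<open>t\<^sub>k\<close>, so it is the value at \<open>\<phi>\<close> of a tempered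
  distribution; it is an eigendistribution because passing from \<open>\<phi>\<close> to \<open>U \<phi>\<close> multiplies \<open>c\<^sub>\<alpha>\<close> by \<open>\<alpha>\<close>. Any
  decomposition of \<open>T\<^sub>0\<close> into eigendistributions has the same expansion, which gives uniqueness.
\<close>

section \<open>Distances in a tree\<close>

text \<open>Counting steps with relation powers turns walks of length \<open>m + n\<close> into compositions, which
  makes the distance easy to handle; lists are needed only to exhibit cycles.\<close>

lemma walk_iff_relpowp:
  "(\<exists>xs. walk E x y xs \<and> length xs = n + 1) \<longleftrightarrow> (E ^^ n) x y"
proof (induction n arbitrary: x)
  case 0
  show ?case
    by (auto simp: walk_def length_Suc_conv intro!: exI[of _ "[x]"])
next
  case (Suc n)
  have "(\<exists>xs. walk E x y xs \<and> length xs = Suc n + 1) \<longleftrightarrow>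
        (\<exists>z. E x z \<and> (\<exists>xs. walk E z y xs \<and> length xs = n + 1))"
  proof safe
    fix xs assume w: "walk E x y xs" "length xs = Suc n + 1"
    then obtain z zs where xs: "xs = x # z # zs"
      by (cases xs; cases "tl xs") (auto simp: walk_def)
    with w show "\<exists>z. E x z \<and> (\<exists>xs. walk E z y xs \<and> length xs = n + 1)"
      by (intro exI[of _ z] conjI exI[of _ "z # zs"]) (auto simp: walk_def)
  next
    fix z xs assume "E x z" "walk E z y xs" "length xs = n + 1"
    then show "\<exists>xs. walk E x y xs \<and> length xs = Suc n + 1"
      by (intro exI[of _ "x # xs"]) (auto simp: walk_def successively_Cons)
  qed
  also have "\<dots> \<longleftrightarrow> (E ^^ Suc n) x y"
    unfolding Suc.IH by (metis relpowp_Suc_I2 relpowp_Suc_E2)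
  finally show ?case .
qed

lemma gdist_eq_Least: "gdist E x y = (LEAST n. (E ^^ n) x y)"
  unfolding gdist_def walk_iff_relpowp ..

text \<open>Cutting loops out of a walk that avoids \<open>y\<close> leaves a path that avoids \<open>y\<close>.\<close>

lemma rtranclp_distinct_path:
  assumes "(\<lambda>a b. E a b \<and> a \<noteq> y \<and> b \<noteq> y)\<^sup>*\<^sup>* a b" "b \<noteq> y"
  shows "\<exists>xs. xs \<noteq> [] \<and> hd xs = a \<and> last xs = b \<and> successively E xs \<and> distinct xs \<and> y \<notin> set xs"
  using assms
proof (induction rule: converse_rtranclp_induct)
  case base
  then show ?case by (intro exI[of _ "[b]"]) auto
next
  case (step a c)
  then obtain xs where xs: "xs \<noteq> []" "hd xs = c" "last xs = b" "successively E xs" "distinct xs"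
    "y \<notin> set xs" by blast
  show ?case
  proof (cases "a \<in> set xs")
    case True
    then obtain ys zs where "xs = ys @ a # zs" by (meson split_list)
    with xs show ?thesis
      by (intro exI[of _ "a # zs"]) (auto simp: successively_append_iff)
  next
    case False
    with xs step.hyps show ?thesis
      by (intro exI[of _ "a # xs"]) (auto simp: successively_Cons)
  qed
qed

definition sphere_sum :: "('v \<Rightarrow> 'v \<Rightarrow> bool) \<Rightarrow> nat \<Rightarrow> ('v \<Rightarrow> 'a) \<Rightarrow> 'v \<Rightarrow> 'a::comm_monoid_add"
  where "sphere_sum E n f x = (\<Sum>y | gdist E x y = n. f y)"

text \<open>The neighbour of \<open>y\<close> on the way to the root \<open>r\<close>.\<close>

definition parent :: "('v \<Rightarrow> 'v \<Rightarrow> bool) \<Rightarrow> 'v \<Rightarrow> 'v \<Rightarrow> 'v" where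
  "parent E r y = (THE v. E y v \<and> gdist E r v < gdist E r y)"

locale tree =
  fixes q :: nat and E :: "'v \<Rightarrow> 'v \<Rightarrow> bool"
  assumes q2: "2 \<le> q" and homogeneous: "homogeneous_tree q E"
begin

abbreviation d where "d \<equiv> gdist E"

lemma adj_sym: "E x y \<Longrightarrow> E y x" and adj_irrefl: "\<not> E x x"
  and no_cycle: "\<not> is_cycle E xs" and card_nbrs: "card {y. E x y} = q + 1"
  using homogeneous by (auto simp: homogeneous_tree_def)

lemma finite_nbrs [simp]: "finite {y. E x y}"
  using card_nbrs[of x] by (metis Suc_eq_plus1 card.infinite nat.distinct(1))

lemma relpowp_gdist: "(E ^^ d x y) x y"
proof -
  obtain xs where xs: "walk E x y xs"
    using homogeneous unfolding homogeneous_tree_def by blast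
  then have "length xs = (length xs - 1) + 1"
    by (cases xs) (auto simp: walk_def)
  with xs have "(E ^^ (length xs - 1)) x y"
    using walk_iff_relpowp by metis
  then show ?thesis unfolding gdist_eq_Least by (rule LeastI)
qed

lemma gdist_le: "(E ^^ n) x y \<Longrightarrow> d x y \<le> n"
  unfolding gdist_eq_Least by (rule Least_le)

lemma gdist_refl [simp]: "d x x = 0"
  using gdist_le[of 0 x x] by simp

lemma gdist_eq_0 [simp]: "d x y = 0 \<longleftrightarrow> x = y"
  using relpowp_gdist[of x y] by auto

lemma gdist_triangle: "d x z \<le> d x y + d y z"
  by (rule gdist_le) (use relpowp_gdist in \<open>auto simp: relpowp_add\<close>)

lemma relpowp_adj_sym: "(E ^^ n) x y \<Longrightarrow> (E ^^ n) y x"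
proof (induction n arbitrary: y)
  case (Suc n)
  then obtain z where "(E ^^ n) x z" "E z y" by auto
  then show ?case using Suc.IH adj_sym by (meson relpowp_Suc_I2)
qed auto

lemma gdist_commute: "d x y = d y x"
  by (rule antisym; rule gdist_le, rule relpowp_adj_sym, rule relpowp_gdist)

lemma gdist_eq_1 [simp]: "d x y = Suc 0 \<longleftrightarrow> E x y"
proof
  assume "d x y = Suc 0" then show "E x y" using relpowp_gdist[of x y] by auto
next
  assume "E x y"
  then have "d x y \<le> 1" "x \<noteq> y" using gdist_le[of 1 x y] adj_irrefl by auto
  then show "d x y = Suc 0" using gdist_eq_0[of x y] by linarith
qed

lemma gdist_adj_le: "E y z \<Longrightarrow> d x z \<le> Suc (d x y)"
  using gdist_triangle[of x z y] gdist_eq_1[of y z] by linarith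

lemma gdist_Suc_obtain:
  assumes "d x y = Suc n" obtains v where "E y v" "d x v = n"
proof -
  have "(E ^^ Suc n) x y" using relpowp_gdist[of x y] assms by simp
  then obtain v where v: "(E ^^ n) x v" "E v y" by auto
  then have "d x v \<le> n" "d x v \<ge> n"
    using gdist_le gdist_adj_le[of v y x] assms by auto
  with v that[of v] adj_sym[of v y] show ?thesis by simp
qed

lemma path_to_root_avoiding:
  assumes "d x v \<le> d x y" "v \<noteq> y"
  shows "(\<lambda>a b. E a b \<and> a \<noteq> y \<and> b \<noteq> y)\<^sup>*\<^sup>* v x"
  using assms
proof (induction "d x v" arbitrary: v)
  case 0
  then show ?case by simp
next
  case (Suc n)
  then obtain v' where v': "E v v'" "d x v' = n" by (metis gdist_Suc_obtain)
  moreover from v' Suc have "v' \<noteq> y" "d x v' \<le> d x y" by auto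
  ultimately have "(\<lambda>a b. E a b \<and> a \<noteq> y \<and> b \<noteq> y)\<^sup>*\<^sup>* v' x" "v' \<noteq> y" using Suc.hyps(1) by auto
  then show ?case using v' Suc.prems by (auto intro!: converse_rtranclp_into_rtranclp[of _ v v'])
qed

text \<open>Two neighbours no farther from \<open>x\<close> than \<open>y\<close> are joined through \<open>x\<close> by a path that avoids
  \<open>y\<close>; were they different, \<open>y\<close> would close this path to a cycle.\<close>

lemma closer_nbr_unique:
  assumes "E y v" "E y w" "d x v \<le> d x y" "d x w \<le> d x y"
  shows "v = w"
proof (rule ccontr)
  assume "v \<noteq> w"
  let ?E = "\<lambda>a b. E a b \<and> a \<noteq> y \<and> b \<noteq> y"
  have ne: "v \<noteq> y" "w \<noteq> y" using assms adj_irrefl by auto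
  have "?E\<^sup>*\<^sup>* x w"
  proof (rule sympD[OF symp_rtranclp])
    show "symp ?E" by (rule sympI) (use adj_sym in blast)
  qed (rule path_to_root_avoiding[OF assms(4) ne(2)])
  then have "?E\<^sup>*\<^sup>* v w" using path_to_root_avoiding[OF assms(3) ne(1)] by auto
  then obtain xs where xs: "xs \<noteq> []" "hd xs = v" "last xs = w" "successively E xs" "distinct xs"
    "y \<notin> set xs"
    using rtranclp_distinct_path[of E y v w] ne by blast
  have "length xs \<ge> 2" using xs \<open>v \<noteq> w\<close> by (cases xs; cases "tl xs") auto
  then have "is_cycle E (y # xs)"
    using xs assms adj_sym[of y w] by (auto simp: is_cycle_def successively_Cons)
  then show False using no_cycle by blast
qed

lemma nbr_dist_cases:
  assumes "E y v" shows "d x v = Suc (d x y) \<or> (x \<noteq> y \<and> d x y = Suc (d x v))"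
proof (cases "d x v \<le> d x y")
  case True
  then have "x \<noteq> y" using assms adj_irrefl by (auto)
  then obtain n where n: "d x y = Suc n" using gdist_eq_0 not0_implies_Suc by blast
  then obtain w where w: "E y w" "d x w = n" by (metis gdist_Suc_obtain)
  then have "v = w" using closer_nbr_unique[OF assms w(1) True] n by auto
  then show ?thesis using n w \<open>x \<noteq> y\<close> by auto
next
  case False
  then show ?thesis using gdist_adj_le[OF assms, of x] by auto
qed

lemma parent_eqI: "E y v \<Longrightarrow> d x v < d x y \<Longrightarrow> parent E x y = v"
  unfolding parent_def by (rule the_equality) (auto intro: closer_nbr_unique[of y _ v x])

lemma parent:
  assumes "x \<noteq> y" shows "E y (parent E x y)" "d x y = Suc (d x (parent E x y))"
proof -
  obtain n where n: "d x y = Suc n" using assms gdist_eq_0 not0_implies_Suc by blast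
  then obtain w where w: "E y w" "d x w = n" by (metis gdist_Suc_obtain)
  with n have "parent E x y = w" by (intro parent_eqI) auto
  with n w show "E y (parent E x y)" "d x y = Suc (d x (parent E x y))" by auto
qed

lemma nbrs_inner:
  assumes "x \<noteq> y"
  shows "{v. E y v} = insert (parent E x y) {v. E y v \<and> d x v = Suc (d x y)}"
    "parent E x y \<notin> {v. E y v \<and> d x v = Suc (d x y)}"
proof -
  note par = parent[OF assms]
  have "v = parent E x y" if "E y v" "d x v \<noteq> Suc (d x y)" for v
  proof (rule closer_nbr_unique[OF that(1) par(1)])
    show "d x v \<le> d x y" using nbr_dist_cases[OF that(1), of x] that(2) by linarith
    show "d x (parent E x y) \<le> d x y" using par(2) by linarith
  qed
  then show "{v. E y v} = insert (parent E x y) {v. E y v \<and> d x v = Suc (d x y)}"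
    using par(1) by blast
  show "parent E x y \<notin> {v. E y v \<and> d x v = Suc (d x y)}"
    using par(2) by auto
qed

lemma card_children:
  assumes "x \<noteq> y" shows "card {v. E y v \<and> d x v = Suc (d x y)} = q"
proof -
  let ?C = "{v. E y v \<and> d x v = Suc (d x y)}"
  have "finite ?C" by (rule finite_subset[OF _ finite_nbrs[of y]]) auto
  then have "card {v. E y v} = Suc (card ?C)"
    using nbrs_inner[OF assms] by simp
  then show ?thesis using card_nbrs[of y] by simp
qed

lemma finite_sphere [simp]: "finite {y. d x y = n}"
proof (induction n)
  case (Suc n)
  have "{y. d x y = Suc n} \<subseteq> (\<Union>v\<in>{v. d x v = n}. {y. E v y})"
  proof
    fix y assume "y \<in> {y. d x y = Suc n}"
    then obtain v where "E y v" "d x v = n" using gdist_Suc_obtain[of x y n] by blast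
    then show "y \<in> (\<Union>v\<in>{v. d x v = n}. {y. E v y})" using adj_sym by blast
  qed
  then show ?case by (rule finite_subset) (use Suc in simp)
qed auto

text \<open>Every vertex other than \<open>x\<close> is the child of exactly one vertex, its parent, so a sphere is the
  disjoint union of the sets of children of the vertices of the preceding sphere.\<close>

lemma sum_children:
  fixes f :: "'v \<Rightarrow> 'b::comm_monoid_add"
  shows "(\<Sum>y | d x y = n. \<Sum>v | E y v \<and> d x v = Suc n. f v) = (\<Sum>v | d x v = Suc n. f v)"
proof -
  have "(\<Sum>y | d x y = n. \<Sum>v | E y v \<and> d x v = Suc n. f v)
      = (\<Sum>y | d x y = n. \<Sum>v | d x v = Suc n \<and> parent E x v = y. f v)"
  proof (intro sum.cong refl arg_cong2[of _ _ _ _ sum] Collect_cong iffI conjI)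
    fix y v assume y: "y \<in> {y. d x y = n}"
    show "d x v = Suc n" if "E y v \<and> d x v = Suc n" using that by simp
    show "parent E x v = y" if "E y v \<and> d x v = Suc n"
      by (rule parent_eqI) (use that y adj_sym[of y v] in simp_all)
    show "d x v = Suc n" if "d x v = Suc n \<and> parent E x v = y"
      using that by simp
    show "E y v" if "d x v = Suc n \<and> parent E x v = y"
    proof -
      from that have "x \<noteq> v" by auto
      then show ?thesis using that parent(1)[of x v] adj_sym[of v y] by simp
    qed
  qed
  also have "\<dots> = (\<Sum>y | d x y = n. \<Sum>v | v \<in> {v. d x v = Suc n} \<and> parent E x v = y. f v)" by simp
  also have "\<dots> = (\<Sum>v | d x v = Suc n. f v)"
  proof (rule sum.group)
    show "parent E x ` {v. d x v = Suc n} \<subseteq> {y. d x y = n}"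
    proof clarify
      fix v assume "d x v = Suc n"
      then have "x \<noteq> v" by auto
      from parent(2)[OF this] \<open>d x v = Suc n\<close> show "d x (parent E x v) = n" by simp
    qed
  qed auto
  finally show ?thesis .
qed

lemma card_sphere: "card {y. d x y = Suc n} = (q + 1) * q ^ n"
proof (induction n)
  case 0
  then show ?case using card_nbrs by simp
next
  case (Suc n)
  have "card {y. d x y = Suc (Suc n)} = (\<Sum>y | d x y = Suc n. card {v. E y v \<and> d x v = Suc (Suc n)})"
    using sum_children[of "\<lambda>_. 1::nat" x "Suc n"] by simp
  also have "\<dots> = (\<Sum>y | d x y = Suc n. q)"
  proof (rule sum.cong[OF refl], goal_cases)
    case (1 y)
    then have "x \<noteq> y" by auto
    with card_children[OF this] 1 show ?case by auto
  qed
  finally show ?case using Suc by (simp add: algebra_simps)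
qed

lemma card_sphere_le: "card {y. d x y = n} \<le> 2 * q ^ n"
proof (cases n)
  case (Suc m)
  then show ?thesis using q2 by (simp add: card_sphere)
qed auto

lemma sphere_nonempty: "\<exists>y. d x y = n"
proof (cases n)
  case (Suc m)
  then have "card {y. d x y = n} > 0" using q2 by (simp add: card_sphere)
  then show ?thesis by (auto simp: card_gt_0_iff)
qed (auto intro: exI[of _ x])

lemma sphere_sum_0 [simp]: "sphere_sum E 0 f x = f x"
  by (simp add: sphere_sum_def)

lemma sphere_sum_1: "sphere_sum E (Suc 0) f x = (\<Sum>y | E x y. f y)"
  by (simp add: sphere_sum_def)

lemma sphere_sum_lin:
  fixes f g :: "'v \<Rightarrow> complex"
  shows "sphere_sum E n (\<lambda>x. f x + g x) = (\<lambda>x. sphere_sum E n f x + sphere_sum E n g x)"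
    "sphere_sum E n (\<lambda>x. f x - g x) = (\<lambda>x. sphere_sum E n f x - sphere_sum E n g x)"
    "sphere_sum E n (\<lambda>x. c * f x) = (\<lambda>x. c * sphere_sum E n f x)"
  by (auto simp: sphere_sum_def sum.distrib sum_subtractf sum_distrib_left)

lemma sphere_sum_parents:
  fixes f :: "'v \<Rightarrow> complex"
  shows "(\<Sum>y | d x y = Suc (Suc n). f (parent E x y)) = of_nat q * (\<Sum>y | d x y = Suc n. f y)"
    "(\<Sum>y | d x y = Suc 0. f (parent E x y)) = of_nat (q + 1) * f x"
proof -
  have *: "(\<Sum>y | d x y = Suc m. f (parent E x y)) = 
     (\<Sum>y | d x y = m. of_nat (card {v. E y v \<and> d x v = Suc m}) * f y)" for m
  proof -
    have "(\<Sum>y | d x y = m. of_nat (card {v. E y v \<and> d x v = Suc m}) * f y)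
        = (\<Sum>y | d x y = m. \<Sum>v | E y v \<and> d x v = Suc m. f (parent E x v))"
    proof (rule sum.cong[OF refl], goal_cases)
      case (1 y)
      have "(\<Sum>v | E y v \<and> d x v = Suc m. f (parent E x v)) = (\<Sum>v | E y v \<and> d x v = Suc m. f y)"
      proof (rule sum.cong[OF refl], goal_cases)
        case (1 v)
        then have "parent E x v = y"
          using \<open>y \<in> _\<close> adj_sym[of y v] by (intro parent_eqI) auto
        then show ?case by simp
      qed
      then show ?case by simp
    qed
    also have "\<dots> = (\<Sum>y | d x y = Suc m. f (parent E x y))" by (rule sum_children)
    finally show ?thesis by simp
  qed
  show "(\<Sum>y | d x y = Suc (Suc n). f (parent E x y)) = of_nat q * (\<Sum>y | d x y = Suc n. f y)"
    unfolding * sum_distrib_left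
  proof (rule sum.cong[OF refl], goal_cases)
    case (1 y)
    then have "x \<noteq> y" by auto
    with card_children[OF this] 1 show ?case by simp
  qed
  have "{v. E x v \<and> d x v = Suc 0} = {v. E x v}" by auto
  then show "(\<Sum>y | d x y = Suc 0. f (parent E x y)) = of_nat (q + 1) * f x"
    unfolding * using card_nbrs[of x] by simp
qed

text \<open>The neighbours of a vertex on a sphere around \<open>x\<close> lie on the two adjacent spheres; each vertex of
  the outer sphere is met once, each vertex of the inner sphere once for every child.\<close>

lemma sphere_sum_nbr_sum:
  fixes f :: "'v \<Rightarrow> complex"
  shows "sphere_sum E (Suc n) (sphere_sum E 1 f) x
      = sphere_sum E (Suc (Suc n)) f x + (if n = 0 then of_nat (q + 1) else of_nat q) * sphere_sum E n f x"
proof -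
  have "sphere_sum E (Suc n) (sphere_sum E 1 f) x
      = (\<Sum>y | d x y = Suc n. f (parent E x y) + (\<Sum>v | E y v \<and> d x v = Suc (Suc n). f v))"
    unfolding sphere_sum_def[of E "Suc n"]
  proof (rule sum.cong[OF refl], goal_cases)
    case (1 y)
    then have ne: "x \<noteq> y" by auto
    have "sphere_sum E 1 f y = sum f (insert (parent E x y) {v. E y v \<and> d x v = Suc (d x y)})"
      by (simp add: sphere_sum_1 nbrs_inner(1)[OF ne, symmetric])
    also have "\<dots> = f (parent E x y) + (\<Sum>v | E y v \<and> d x v = Suc (d x y). f v)"
      by (rule sum.insert) (use nbrs_inner(2)[OF ne] finite_subset[OF _ finite_nbrs[of y]] in auto)
    finally show ?case using 1 by simp
  qed
  also have "\<dots> = (\<Sum>y | d x y = Suc n. f (parent E x y)) + sphere_sum E (Suc (Suc n)) f x"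
    by (simp add: sum.distrib sum_children sphere_sum_def)
  finally show ?thesis
    using sphere_sum_parents[of f x] by (cases n) (auto simp: sphere_sum_def add.commute)
qed

lemma
  fixes f :: "'v \<Rightarrow> complex"
  shows sphere_sum_step: "sphere_sum E (Suc (Suc (Suc n))) f
      = (\<lambda>x. sphere_sum E (Suc (Suc n)) (sphere_sum E 1 f) x - of_nat q * sphere_sum E (Suc n) f x)"
    and sphere_sum_2: "sphere_sum E (Suc (Suc 0)) f
      = (\<lambda>x. sphere_sum E 1 (sphere_sum E 1 f) x - of_nat (q + 1) * f x)"
  using sphere_sum_nbr_sum[of "Suc n" f] sphere_sum_nbr_sum[of 0 f] by auto

text \<open>A shortest path from \<open>x\<close> to \<open>y\<close> first climbs some number \<open>i\<close> of steps towards \<open>r\<close> and then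
  descends. Hence the sphere around \<open>x\<close> is covered by \<open>n + 1\<close> pieces of spheres around ancestors of
  \<open>x\<close>, on each of which the distance from \<open>r\<close> is constant.\<close>

lemma ancestor_decomposition:
  assumes "d x y = n"
  shows "\<exists>i\<le>n. d ((parent E r ^^ i) x) y = n - i \<and> i \<le> d r x \<and> d r y = d r x + n - 2 * i"
  using assms
proof (induction n arbitrary: x)
  case 0
  then show ?case by auto
next
  case (Suc n)
  have "d y x = Suc n" using Suc.prems by (simp add: gdist_commute)
  then obtain x' where x': "E x x'" "d x' y = n"
    by (metis gdist_Suc_obtain gdist_commute)
  obtain i where i: "i \<le> n" "d ((parent E r ^^ i) x') y = n - i" "i \<le> d r x'"
    "d r y = d r x' + n - 2 * i"
    using Suc.IH[OF x'(2)] by blast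
  from nbr_dist_cases[OF x'(1), of r] show ?case
  proof
    assume c: "r \<noteq> x \<and> d r x = Suc (d r x')"
    then have "parent E r x = x'" using x' by (intro parent_eqI) auto
    then have "(parent E r ^^ Suc i) x = (parent E r ^^ i) x'"
      by (simp add: funpow_swap1)
    then have "d ((parent E r ^^ Suc i) x) y = Suc n - Suc i" using i(2) by simp
    moreover have "d r y = d r x + Suc n - 2 * Suc i" using i(4) c by simp
    moreover have "Suc i \<le> Suc n" "Suc i \<le> d r x" using i c by auto
    ultimately show ?thesis by (intro exI[of _ "Suc i"] conjI)
  next
    assume c: "d r x' = Suc (d r x)"
    then have par: "parent E r x' = x" using x' adj_sym[of x x'] by (intro parent_eqI) auto
    have "i = 0"
    proof (rule ccontr)
      assume "i \<noteq> 0"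
      then obtain j where j: "i = Suc j" using not0_implies_Suc by blast
      then have e: "(parent E r ^^ i) x' = (parent E r ^^ j) x" using par by (simp add: funpow_swap1)
      have "d x ((parent E r ^^ l) x) \<le> l" if "l \<le> d r x" for l
      proof -
        have "d x ((parent E r ^^ l) x) \<le> l \<and> d r ((parent E r ^^ l) x) = d r x - l" using that
        proof (induction l)
          case (Suc l)
          define v where "v = (parent E r ^^ l) x"
          have v: "d x v \<le> l" "d r v = d r x - l" using Suc by (auto simp: v_def)
          then have "r \<noteq> v" using Suc.prems by auto
          from parent[OF this] v gdist_adj_le[of v "parent E r v" x] show ?case
            by (auto simp: v_def)
        qed auto
        then show ?thesis by blast
      qed
      from this[of j] have "d x ((parent E r ^^ j) x) \<le> j" using i(3) c j by auto
      then have "d x y \<le> j + (n - i)"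
        using gdist_triangle[of x y "(parent E r ^^ j) x"] i(2) e by auto
      then show False using Suc.prems i(1) j by auto
    qed
    then have "d r y = d r x + Suc n - 2 * 0" using i c by linarith
    moreover have "d ((parent E r ^^ 0) x) y = Suc n - 0" using Suc.prems by simp
    ultimately show ?thesis by (intro exI[of _ 0] conjI) auto
  qed
qed

end

section \<open>Chebyshev operators\<close>

context tree begin

abbreviation sq :: complex where "sq \<equiv> complex_of_real (sqrt (real q))"

lemma sq_nz [simp]: "sq \<noteq> 0" using q2 by simp

lemma sq_sq: "sq * sq = of_nat q"
  by (simp flip: of_real_mult)

text \<open>With \<open>X\<close> the normalised neighbour sum, \<open>cheb n\<close> is \<open>2 T\<^sub>n(X / 2)\<close> for the Chebyshev polynomial
  \<open>T\<^sub>n\<close>: if \<open>X\<close> acts as \<open>u + 1 / u\<close>, then \<open>cheb n\<close> acts as \<open>u ^ n + (1 / u) ^ n\<close>. In this basis the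
  convolution algebra of radial kernels becomes that of Laurent series invariant under inversion.\<close>

fun cheb :: "nat \<Rightarrow> ('v \<Rightarrow> complex) \<Rightarrow> 'v \<Rightarrow> complex" where
  "cheb 0 f = (\<lambda>x. 2 * f x)"
| "cheb (Suc 0) f = (\<lambda>x. sphere_sum E 1 f x / sq)"
| "cheb (Suc (Suc n)) f = (\<lambda>x. cheb (Suc n) (\<lambda>x. sphere_sum E 1 f x / sq) x - cheb n f x)"

abbreviation cheb_int :: "int \<Rightarrow> ('v \<Rightarrow> complex) \<Rightarrow> 'v \<Rightarrow> complex" where
  "cheb_int k \<equiv> cheb (nat \<bar>k\<bar>)"

lemma cheb_lin:
  "cheb n (\<lambda>x. f x + g x) = (\<lambda>x. cheb n f x + cheb n g x)"
  "cheb n (\<lambda>x. f x - g x) = (\<lambda>x. cheb n f x - cheb n g x)"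
  "cheb n (\<lambda>x. c * f x) = (\<lambda>x. c * cheb n f x)"
proof -
  have a: "cheb n (\<lambda>x. f x + g x) = (\<lambda>x. cheb n f x + cheb n g x)" for f g
    by (induction n f arbitrary: g rule: cheb.induct)
      (auto simp: sphere_sum_lin add_divide_distrib)
  have c: "cheb n (\<lambda>x. c * f x) = (\<lambda>x. c * cheb n f x)" for f c
  proof (induction n f rule: cheb.induct)
    case (3 n f)
    have "(\<lambda>x. sphere_sum E 1 (\<lambda>x. c * f x) x / sq) = (\<lambda>x. c * (sphere_sum E 1 f x / sq))"
      by (simp add: sphere_sum_lin)
    with 3 show ?case by (simp add: algebra_simps)
  qed (auto simp: sphere_sum_lin)
  show "cheb n (\<lambda>x. f x + g x) = (\<lambda>x. cheb n f x + cheb n g x)"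
    "cheb n (\<lambda>x. c * f x) = (\<lambda>x. c * cheb n f x)" using a c by auto
  show "cheb n (\<lambda>x. f x - g x) = (\<lambda>x. cheb n f x - cheb n g x)"
    using a[of f "\<lambda>x. (-1) * g x"] c[of "-1" g] by simp
qed

lemma cheb_1: "cheb 1 f = (\<lambda>x. sphere_sum E 1 f x / sq)" by simp

lemma cheb_Suc_Suc: "cheb (Suc (Suc n)) f = (\<lambda>x. cheb (Suc n) (cheb 1 f) x - cheb n f x)"
  by simp

lemma cheb_commute_1: "cheb 1 (cheb n f) = cheb n (cheb 1 f)"
proof (induction n arbitrary: f rule: induct_nat_012)
  case 0
  show ?case using cheb_lin(3)[of 1 2 f] by simp
next
  case 1
  show ?case by simp
next
  case (ge2 n)
  have "cheb 1 (cheb (Suc (Suc n)) f) = (\<lambda>x. cheb 1 (cheb (Suc n) (cheb 1 f)) x - cheb 1 (cheb n f) x)"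
    unfolding cheb_Suc_Suc cheb_lin ..
  also have "\<dots> = cheb (Suc (Suc n)) (cheb 1 f)"
    unfolding ge2 cheb_Suc_Suc ..
  finally show ?case .
qed

lemma cheb_1_int:
  "cheb 1 (cheb_int k f) = (\<lambda>x. cheb_int (k + 1) f x + cheb_int (k - 1) f x)"
proof -
  have *: "cheb 1 (cheb (Suc n) f) = (\<lambda>x. cheb (Suc (Suc n)) f x + cheb n f x)" for n
    unfolding cheb_commute_1 cheb_Suc_Suc by auto
  consider "k = 0" | n where "k = int (Suc n)" | n where "k = - int (Suc n)"
    by (metis int_cases not0_implies_Suc of_nat_0 add.inverse_neutral)
  then show ?thesis
  proof cases
    case 1 then show ?thesis using cheb_lin(3)[of 1 2 f] by simp
  next
    case (2 n)
    then have "nat \<bar>k\<bar> = Suc n" "nat \<bar>k + 1\<bar> = Suc (Suc n)" "nat \<bar>k - 1\<bar> = n" by auto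
    then show ?thesis using * by metis
  next
    case (3 n)
    then have "nat \<bar>k\<bar> = Suc n" "nat \<bar>k - 1\<bar> = Suc (Suc n)" "nat \<bar>k + 1\<bar> = n" by auto
    then show ?thesis using *[of n] by (simp add: add.commute del: cheb.simps)
  qed
qed

text \<open>The identity \<open>(u\<^sup>m + u\<^sup>-\<^sup>m)(u\<^sup>k + u\<^sup>-\<^sup>k) = (u\<^sup>k\<^sup>+\<^sup>m + u\<^sup>-\<^sup>k\<^sup>-\<^sup>m) + (u\<^sup>k\<^sup>-\<^sup>m + u\<^sup>m\<^sup>-\<^sup>k)\<close>; indexing by
  integers avoids a case distinction on the sign of \<open>k - m\<close>.\<close>

lemma cheb_mult:
  "cheb m (cheb_int k f) = (\<lambda>x. cheb_int (k + int m) f x + cheb_int (k - int m) f x)"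
proof (induction m arbitrary: f rule: induct_nat_012)
  case 0
  show ?case by simp
next
  case 1
  show ?case using cheb_1_int by simp
next
  case (ge2 n)
  have c: "cheb_int k (cheb 1 f) = cheb 1 (cheb_int k f)" by (rule cheb_commute_1[symmetric])
  have *: "cheb_int (k + l) (cheb 1 f) = (\<lambda>x. cheb_int (k + (l + 1)) f x + cheb_int (k + (l - 1)) f x)" for l
    using cheb_1_int[of "k + l" f] unfolding cheb_commute_1 by (simp only: algebra_simps)
  have "cheb (Suc (Suc n)) (cheb_int k f)
     = (\<lambda>x. cheb (Suc n) (cheb_int k (cheb 1 f)) x - cheb n (cheb_int k f) x)"
    unfolding cheb_Suc_Suc c ..
  also have "\<dots> = (\<lambda>x. cheb_int (k + int (Suc (Suc n))) f x + cheb_int (k - int (Suc (Suc n))) f x)"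
    unfolding ge2 using *[of "int (Suc n)"] *[of "- int (Suc n)"]
    by (simp add: algebra_simps del: cheb.simps)
  finally show ?case .
qed

text \<open>With \<open>W\<^sub>n = q\<^sup>n\<^sup>/\<^sup>2\<close>\<open>cheb n\<close>, the two sides of
  \<open>S\<^sub>n\<^sub>+\<^sub>3 - q S\<^sub>n\<^sub>+\<^sub>1 = W\<^sub>n\<^sub>+\<^sub>3 - W\<^sub>n\<^sub>+\<^sub>1\<close> satisfy the same two-term recurrence, so it is enough to compare them
  twice.\<close>

lemma sphere_sum_cheb:
  "sphere_sum E (Suc (Suc (Suc n))) f x = of_nat q * sphere_sum E (Suc n) f x
     + sq ^ Suc (Suc (Suc n)) * cheb (Suc (Suc (Suc n))) f x - sq ^ Suc n * cheb (Suc n) f x"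
proof (induction n arbitrary: f x rule: induct_nat_012)
  define X where "X = (sphere_sum E 1 :: ('v \<Rightarrow> complex) \<Rightarrow> 'v \<Rightarrow> complex)"
  define W where "W n f x = sq ^ n * cheb n f x" for n f x
  have W: "W 0 f x = 2 * f x" "W (Suc 0) f x = X f x"
    "W (Suc (Suc n)) f x = W (Suc n) (X f) x - of_nat q * W n f x" for n f x
  proof -
    have "sq * cheb (Suc n) (\<lambda>x. sphere_sum E 1 f x / sq) x = cheb (Suc n) (X f) x"
      using cheb_lin(3)[of "Suc n" "1 / sq" "X f"] sq_nz by (simp add: X_def)
    moreover have "W (Suc (Suc n)) f x
        = sq ^ n * (sq * (sq * cheb (Suc n) (\<lambda>x. sphere_sum E 1 f x / sq) x)) - sq * sq * W n f x"
      unfolding W_def cheb.simps by (simp add: algebra_simps)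
    ultimately show "W (Suc (Suc n)) f x = W (Suc n) (X f) x - of_nat q * W n f x"
      by (simp add: W_def sq_sq del: cheb.simps)
    show "W 0 f x = 2 * f x" "W (Suc 0) f x = X f x"
      using sq_nz by (simp_all add: W_def X_def del: of_real_eq_0_iff)
  qed
  have S: "sphere_sum E (Suc 0) f x = X f x"
    "sphere_sum E (Suc (Suc 0)) f x = X (X f) x - of_nat (q + 1) * f x"
    "sphere_sum E (Suc (Suc (Suc n))) f x = sphere_sum E (Suc (Suc n)) (X f) x - of_nat q * sphere_sum E (Suc n) f x"
    for n f x
    by (simp add: X_def, simp add: X_def sphere_sum_2, simp add: X_def sphere_sum_step)
  {
    case 0
    show ?case
      unfolding W_def[symmetric] S W by (simp add: algebra_simps)
  next
    case 1
    show ?case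
      unfolding W_def[symmetric] S W by (simp add: algebra_simps)
  next
    case (ge2 n)
    note IH = ge2[folded W_def]
    have e1: "W (Suc (Suc n)) (X f) x = W (Suc (Suc (Suc n))) f x + of_nat q * W (Suc n) f x"
      using W(3)[of "Suc n" f x] by (simp add: algebra_simps)
    have e2: "W (Suc (Suc (Suc n))) f x = sphere_sum E (Suc (Suc (Suc n))) f x
          - of_nat q * sphere_sum E (Suc n) f x + W (Suc n) f x"
      using IH(1)[of f x] by (simp add: algebra_simps)
    have e3: "sphere_sum E (Suc (Suc n)) (X f) x
          = sphere_sum E (Suc (Suc (Suc n))) f x + of_nat q * sphere_sum E (Suc n) f x"
      using S(3)[of n f x] by (simp add: algebra_simps)
    show ?case
      unfolding W_def[symmetric] S(3)[of "Suc (Suc n)"] W(3)[of "Suc (Suc (Suc n))"] IH(2)[of "X f"]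
        e1 e3 e2
      by (simp add: algebra_simps)
  }
qed

text \<open>The recurrence of the preceding lemma, read off coefficient by coefficient. The value \<open>1 / 2\<close>
  appears because \<open>cheb 0\<close> is twice the identity.\<close>

fun sphere_coeff :: "nat \<Rightarrow> nat \<Rightarrow> real" where
  "sphere_coeff 0 j = (if j = 0 then 1 / 2 else 0)"
| "sphere_coeff (Suc 0) j = (if j = 1 then sqrt q else 0)"
| "sphere_coeff (Suc (Suc 0)) j = (if j = 2 then q else if j = 0 then (q - 1) / 2 else 0)"
| "sphere_coeff (Suc (Suc (Suc n))) j = q * sphere_coeff (Suc n) j
     + (if j = n + 3 then sqrt q ^ (n + 3) else 0) - (if j = n + 1 then sqrt q ^ (n + 1) else 0)"

lemma sphere_coeff_eq_0: "n < j \<Longrightarrow> sphere_coeff n j = 0"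
  by (induction n j rule: sphere_coeff.induct) auto

lemma sphere_sum_expansion:
  "sphere_sum E n f x = (\<Sum>j\<le>n. of_real (sphere_coeff n j) * cheb j f x)"
proof (induction n rule: less_induct)
  case (less n)
  consider "n = 0" | "n = 1" | "n = Suc (Suc 0)" | m where "n = Suc (Suc (Suc m))"
    by (metis One_nat_def not0_implies_Suc)
  then show ?case
  proof cases
    case 1 then show ?thesis by simp
  next
    case 2 then show ?thesis using q2 by simp
  next
    case 3
    have "cheb 2 f x = cheb 1 (cheb 1 f) x - 2 * f x"
      using cheb_Suc_Suc[of 0 f] by (simp add: numeral_2_eq_2 del: cheb.simps(3))
    also have "cheb 1 (cheb 1 f) x = sphere_sum E 1 (sphere_sum E 1 f) x / of_nat q"
      using sphere_sum_lin(3)[of 1 "1 / sq" "sphere_sum E 1 f"]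
      by (simp add: sq_sq[symmetric])
    finally have "sphere_sum E 1 (sphere_sum E 1 f) x = of_nat q * cheb 2 f x + 2 * of_nat q * f x"
      using q2 by (simp add: field_simps)
    moreover have "complex_of_nat (q - Suc 0) = of_nat q - 1" using q2 by (simp add: of_nat_diff)
    moreover have "{..Suc (Suc 0)} = {0, 1, 2}" by auto
    ultimately show ?thesis using 3 q2
      by (simp add: sphere_sum_2 field_simps of_nat_diff)
  next
    case (4 m)
    have "(\<Sum>j\<le>n. of_real (sphere_coeff n j) * cheb j f x)
      = of_nat q * (\<Sum>j\<le>n. of_real (sphere_coeff (Suc m) j) * cheb j f x)
        + (\<Sum>j\<le>n. if j = m + 3 then sq ^ (m + 3) * cheb j f x else 0)
        - (\<Sum>j\<le>n. if j = m + 1 then sq ^ (m + 1) * cheb j f x else 0)"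
      unfolding sum_distrib_left sum.distrib[symmetric] sum_subtractf[symmetric] 4
      by (rule sum.cong[OF refl]) (simp add: algebra_simps of_real_power del: cheb.simps)
    also have "(\<Sum>j\<le>n. of_real (sphere_coeff (Suc m) j) * cheb j f x)
       = (\<Sum>j\<le>Suc m. of_real (sphere_coeff (Suc m) j) * cheb j f x)"
      by (rule sum.mono_neutral_right) (use 4 sphere_coeff_eq_0 in auto)
    also have "\<dots> = sphere_sum E (Suc m) f x" using less[of "Suc m"] 4 by simp
    finally show ?thesis using 4 sphere_sum_cheb[of m f x]
      by (simp add: numeral_3_eq_3 del: cheb.simps sphere_coeff.simps)
  qed
qed

end

section \<open>Rapidly decreasing coefficients and weighted bounds\<close>

lemma inverse_square_summable_int: "(\<lambda>l::int. 1 / (1 + real_of_int \<bar>l\<bar>) ^ 2) summable_on UNIV"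
proof -
  let ?f = "\<lambda>l::int. 1 / (1 + real_of_int \<bar>l\<bar>) ^ 2"
  have "summable (\<lambda>n. 1 / real (Suc n) ^ 2)"
    using inverse_squares_sums by (rule sums_summable[OF sums_cong[THEN iffD1, rotated]]) (simp add: inverse_eq_divide add.commute)
  then have "summable (\<lambda>n. norm (1 / (1 + real n) ^ 2))"
    by (simp add: add.commute)
  then have n: "(\<lambda>n. 1 / (1 + real n) ^ 2) summable_on UNIV"
    by (rule norm_summable_imp_summable_on)
  have "?f summable_on (int ` UNIV)" "?f summable_on ((\<lambda>n. - int n) ` UNIV)"
    by (subst summable_on_reindex; use n in \<open>simp add: o_def inj_on_def\<close>)+
  then have "?f summable_on (int ` UNIV \<union> (\<lambda>n. - int n) ` UNIV)"
    by (rule summable_on_union)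
  moreover have "int ` UNIV \<union> (\<lambda>n. - int n) ` UNIV = (UNIV :: int set)"
  proof (rule UNIV_eq_I[symmetric])
    fix l :: int
    show "l \<in> int ` UNIV \<union> (\<lambda>n. - int n) ` UNIV"
      by (cases l rule: int_cases2) auto
  qed
  ultimately show ?thesis by simp
qed

abbreviation weight :: "real \<Rightarrow> nat \<Rightarrow> int \<Rightarrow> real" where
  "weight R K l \<equiv> (1 + real_of_int \<bar>l\<bar>) ^ K * R ^ nat \<bar>l\<bar>"

definition rapid :: "real \<Rightarrow> (int \<Rightarrow> complex) \<Rightarrow> bool" where
  "rapid R c \<longleftrightarrow> (\<forall>K. \<exists>C. \<forall>l. weight R K l * cmod (c l) \<le> C)"

text \<open>The exponent \<open>2\<close> is the one that the bound for the Chebyshev operators below gives for \<open>m = 0\<close>.\<close>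

definition moderate :: "real \<Rightarrow> (int \<Rightarrow> complex) \<Rightarrow> bool" where
  "moderate R v \<longleftrightarrow> (\<exists>C. \<forall>l. cmod (v l) \<le> C * (weight R 2 l))"

lemma rapid_weight_summable:
  assumes "rapid R c" "R > 0"
  shows "(\<lambda>l. cmod (c l) * (weight R K l)) summable_on UNIV"
proof -
  obtain C where C: "\<And>l. (1 + real_of_int \<bar>l\<bar>) ^ (K + 2) * R ^ nat \<bar>l\<bar> * cmod (c l) \<le> C"
    using assms(1) unfolding rapid_def by meson
  have "(\<lambda>l::int. C * (1 / (1 + real_of_int \<bar>l\<bar>) ^ 2)) summable_on UNIV"
    by (intro summable_on_cmult_right inverse_square_summable_int)
  then show ?thesis
  proof (rule summable_on_comparison_test)
    fix l :: int
    have "(1 + real_of_int \<bar>l\<bar>) ^ 2 > 0" by (intro zero_less_power) auto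
    then show "cmod (c l) * (weight R K l) \<le> C * (1 / (1 + real_of_int \<bar>l\<bar>) ^ 2)"
      using C[of l] by (simp only: pos_le_divide_eq power_add times_divide_eq_right mult_1_right mult_ac)
    show "0 \<le> cmod (c l) * (weight R K l)"
      using assms(2) by auto
  qed
qed

lemma rapid_moderate_summable:
  assumes "rapid R c" "R > 0" "moderate R v"
  shows "Infinite_Sum.abs_summable_on (\<lambda>l. c l * v l) (UNIV)" "(\<lambda>l. c l * v l) summable_on UNIV"
proof -
  obtain C where C: "\<And>l. cmod (v l) \<le> C * (weight R 2 l)"
    using assms(3) unfolding moderate_def by blast
  show "Infinite_Sum.abs_summable_on (\<lambda>l. c l * v l) (UNIV)"
  proof (rule Infinite_Sum.abs_summable_on_comparison_test')
    show "(\<lambda>l. C * (cmod (c l) * (weight R 2 l))) summable_on UNIV"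
      by (intro summable_on_cmult_right rapid_weight_summable assms)
    show "norm (c l * v l) \<le> C * (cmod (c l) * (weight R 2 l))" for l
      using mult_left_mono[OF C[of l], of "cmod (c l)"] by (simp add: norm_mult mult_ac)
  qed
  then show "(\<lambda>l. c l * v l) summable_on UNIV" by (rule abs_summable_summable)
qed

text \<open>The weight is submultiplicative, so the double series is dominated by a product of two single ones.\<close>

lemma rapid_product_summable:
  assumes "rapid R c" "rapid R a" "R \<ge> 1" "moderate R v" "\<And>l m. \<bar>g l m\<bar> \<le> \<bar>l\<bar> + \<bar>m\<bar>"
  shows "Infinite_Sum.abs_summable_on (\<lambda>(l, m). c l * a m * v (g l m)) (UNIV \<times> UNIV)"
proof -
  let ?w = "\<lambda>l::int. weight R 2 l"
  obtain C where C: "\<And>l. cmod (v l) \<le> C * ?w l"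
    using assms(4) unfolding moderate_def by blast
  have "0 \<le> C" using C[of 0] by (auto intro: order_trans[OF norm_ge_zero])
  have w: "?w (g l m) \<le> ?w l * ?w m" for l m
  proof -
    have "1 + real_of_int \<bar>g l m\<bar> \<le> (1 + real_of_int \<bar>l\<bar>) * (1 + real_of_int \<bar>m\<bar>)"
      using assms(5)[of l m] by (auto simp: algebra_simps intro: order_trans[of _ "real_of_int (\<bar>l\<bar> + \<bar>m\<bar>)"])
    then have 1: "(1 + real_of_int \<bar>g l m\<bar>) ^ 2 \<le> ((1 + real_of_int \<bar>l\<bar>) * (1 + real_of_int \<bar>m\<bar>)) ^ 2"
      by (intro power_mono) auto
    have "nat \<bar>g l m\<bar> \<le> nat \<bar>l\<bar> + nat \<bar>m\<bar>" using assms(5)[of l m] by linarith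
    then have 2: "R ^ nat \<bar>g l m\<bar> \<le> R ^ (nat \<bar>l\<bar> + nat \<bar>m\<bar>)" using assms(3) by (intro power_increasing)
    have "?w (g l m) \<le> ((1 + real_of_int \<bar>l\<bar>) * (1 + real_of_int \<bar>m\<bar>)) ^ 2 * R ^ (nat \<bar>l\<bar> + nat \<bar>m\<bar>)"
      using 1 2 assms(3) by (intro mult_mono) auto
    then show ?thesis by (simp add: power_mult_distrib power_add mult_ac)
  qed
  have R0: "R > 0" using assms(3) by simp
  have "(\<lambda>(l, m). (cmod (c l) * ?w l) * (cmod (a m) * ?w m)) summable_on UNIV \<times> UNIV"
  proof (rule summable_on_SigmaI)
    show "((\<lambda>m. case (l, m) of (l, m) \<Rightarrow> (cmod (c l) * ?w l) * (cmod (a m) * ?w m)) has_sum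
        (cmod (c l) * ?w l) * (\<Sum>\<^sub>\<infinity>m. cmod (a m) * ?w m)) UNIV" for l
      unfolding prod.case by (intro has_sum_cmult_right has_sum_infsum rapid_weight_summable assms R0)
    show "(\<lambda>l. (cmod (c l) * ?w l) * (\<Sum>\<^sub>\<infinity>m. cmod (a m) * ?w m)) summable_on UNIV"
      by (intro summable_on_cmult_left rapid_weight_summable assms R0)
  qed (use R0 in auto)
  then have "(\<lambda>z. C * (\<lambda>(l, m). (cmod (c l) * ?w l) * (cmod (a m) * ?w m)) z) summable_on UNIV \<times> UNIV"
    by (rule summable_on_cmult_right)
  then show ?thesis
  proof (rule Infinite_Sum.abs_summable_on_comparison_test', safe)
    fix l m
    have "cmod (v (g l m)) \<le> C * (?w l * ?w m)"
      using C[of "g l m"] mult_left_mono[OF w[of l m] \<open>0 \<le> C\<close>] by linarith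
    then have "cmod (c l) * cmod (a m) * cmod (v (g l m)) \<le> cmod (c l) * cmod (a m) * (C * (?w l * ?w m))"
      by (intro mult_left_mono) auto
    then show "norm (c l * a m * v (g l m)) \<le> C * (cmod (c l) * ?w l * (cmod (a m) * ?w m))"
      by (simp add: norm_mult mult_ac)
  qed
qed

text \<open>Composing two Chebyshev series produces \<open>v (l + m) + v (l - m)\<close> by the product formula; collecting
  the terms with a given index of \<open>v\<close> convolves one coefficient sequence with the symmetrisation of the
  other.\<close>

lemma cheb_product_collect:
  assumes "rapid R c" "rapid R a" "R \<ge> 1" "moderate R v"
  shows "(\<Sum>\<^sub>\<infinity>l. c l * (\<Sum>\<^sub>\<infinity>m. a m * (v (l + m) + v (l - m))))
       = (\<Sum>\<^sub>\<infinity>k. (\<Sum>\<^sub>\<infinity>m. a m * (c (k - m) + c (k + m))) * v k)"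
proof -
  have s1: "(\<lambda>(l, m). c l * a m * v (l + m)) summable_on UNIV \<times> UNIV"
    and s2: "(\<lambda>(l, m). c l * a m * v (l - m)) summable_on UNIV \<times> UNIV"
    using abs_summable_summable[OF rapid_product_summable[OF assms(1-4), of "\<lambda>l m. l + m"]]
      abs_summable_summable[OF rapid_product_summable[OF assms(1-4), of "\<lambda>l m. l - m"]]
    by auto
  have s: "(\<lambda>(l, m). c l * a m * v (l + m) + c l * a m * v (l - m)) summable_on UNIV \<times> UNIV"
    using summable_on_add[OF s1 s2] by (simp add: case_prod_unfold)
  have b1: "bij (\<lambda>(k, m). (k - m, m) :: int \<times> int)" 
    by (rule o_bij[where g = "\<lambda>(k, m). (k + m, m)"]) auto
  have b2: "bij (\<lambda>(k, m). (k + m, m) :: int \<times> int)" 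
    by (rule o_bij[where g = "\<lambda>(k, m). (k - m, m)"]) auto
  have t1: "(\<lambda>(k, m). c (k - m) * a m * v k) summable_on UNIV \<times> UNIV"
    using s1 summable_on_reindex_bij_betw[OF b1, of "\<lambda>(l, m). c l * a m * v (l + m)"]
    by (simp add: case_prod_unfold)
  have t2: "(\<lambda>(k, m). c (k + m) * a m * v k) summable_on UNIV \<times> UNIV"
    using s2 summable_on_reindex_bij_betw[OF b2, of "\<lambda>(l, m). c l * a m * v (l - m)"]
    by (simp add: case_prod_unfold)
  have t: "(\<lambda>(k, m). c (k - m) * a m * v k + c (k + m) * a m * v k) summable_on UNIV \<times> UNIV"
    using summable_on_add[OF t1 t2] by (simp add: case_prod_unfold)
  have "(\<Sum>\<^sub>\<infinity>l. c l * (\<Sum>\<^sub>\<infinity>m. a m * (v (l + m) + v (l - m))))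
      = (\<Sum>\<^sub>\<infinity>l. \<Sum>\<^sub>\<infinity>m. c l * a m * v (l + m) + c l * a m * v (l - m))"
    by (simp add: infsum_cmult_right'[symmetric] algebra_simps)
  also have "\<dots> = infsum (\<lambda>(l, m). c l * a m * v (l + m) + c l * a m * v (l - m)) (UNIV \<times> UNIV)"
    using infsum_Sigma_banach[OF s] by simp
  also have "\<dots> = infsum (\<lambda>(l, m). c l * a m * v (l + m)) (UNIV \<times> UNIV)
                + infsum (\<lambda>(l, m). c l * a m * v (l - m)) (UNIV \<times> UNIV)"
    using infsum_add[OF s1 s2] by (simp add: case_prod_unfold)
  also have "\<dots> = infsum (\<lambda>(k, m). c (k - m) * a m * v k) (UNIV \<times> UNIV)
                + infsum (\<lambda>(k, m). c (k + m) * a m * v k) (UNIV \<times> UNIV)"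
    using infsum_reindex_bij_betw[OF b1, of "\<lambda>(l, m). c l * a m * v (l + m)"]
      infsum_reindex_bij_betw[OF b2, of "\<lambda>(l, m). c l * a m * v (l - m)"]
    by (simp add: case_prod_unfold)
  also have "\<dots> = infsum (\<lambda>(k, m). c (k - m) * a m * v k + c (k + m) * a m * v k) (UNIV \<times> UNIV)"
    using infsum_add[OF t1 t2] by (simp add: case_prod_unfold)
  also have "\<dots> = (\<Sum>\<^sub>\<infinity>k. \<Sum>\<^sub>\<infinity>m. c (k - m) * a m * v k + c (k + m) * a m * v k)"
    using infsum_Sigma_banach[OF t] by simp
  also have "\<dots> = (\<Sum>\<^sub>\<infinity>k. (\<Sum>\<^sub>\<infinity>m. a m * (c (k - m) + c (k + m))) * v k)"
    unfolding infsum_cmult_left'[symmetric] by (simp add: algebra_simps)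
  finally show ?thesis .
qed

lemma cheb_product_commute:
  assumes "rapid R c" "rapid R a" "R \<ge> 1" "moderate R v" "\<And>k. v (- k) = v k"
  shows "(\<Sum>\<^sub>\<infinity>l. c l * (\<Sum>\<^sub>\<infinity>m. a m * (v (l + m) + v (l - m))))
       = (\<Sum>\<^sub>\<infinity>m. a m * (\<Sum>\<^sub>\<infinity>l. c l * (v (m + l) + v (m - l))))"
proof -
  have s1: "(\<lambda>(l, m). c l * a m * v (l + m)) summable_on UNIV \<times> UNIV"
    and s2: "(\<lambda>(l, m). c l * a m * v (l - m)) summable_on UNIV \<times> UNIV"
    using abs_summable_summable[OF rapid_product_summable[OF assms(1-4), of "\<lambda>l m. l + m"]]
      abs_summable_summable[OF rapid_product_summable[OF assms(1-4), of "\<lambda>l m. l - m"]]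
    by auto
  have s: "(\<lambda>(l, m). c l * a m * (v (l + m) + v (l - m))) summable_on UNIV \<times> UNIV"
    using summable_on_add[OF s1 s2] by (simp add: case_prod_unfold algebra_simps)
  have ev: "v (m - l) = v (l - m)" for l m using assms(5)[of "l - m"] by simp
  have "(\<Sum>\<^sub>\<infinity>l. c l * (\<Sum>\<^sub>\<infinity>m. a m * (v (l + m) + v (l - m))))
      = (\<Sum>\<^sub>\<infinity>l. \<Sum>\<^sub>\<infinity>m. c l * a m * (v (l + m) + v (l - m)))"
    by (simp add: infsum_cmult_right'[symmetric] mult.assoc)
  also have "\<dots> = (\<Sum>\<^sub>\<infinity>m. \<Sum>\<^sub>\<infinity>l. c l * a m * (v (l + m) + v (l - m)))"
    by (rule infsum_swap_banach[OF s])
  also have "\<dots> = (\<Sum>\<^sub>\<infinity>m. a m * (\<Sum>\<^sub>\<infinity>l. c l * (v (m + l) + v (m - l))))"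
    by (simp add: infsum_cmult_right'[symmetric] mult_ac ev add.commute)
  finally show ?thesis .
qed

locale schwartz_tree = tree +
  fixes r :: 'a and p :: real
  assumes p1: "1 \<le> p" and p2: "p < 2"
begin

text \<open>\<open>Q\<close> is the growth rate in the weight of the Schwartz seminorms; \<open>R\<close> is the outer radius of the
  annulus onto which \<open>z \<mapsto> q\<^sup>i\<^sup>z\<close> maps the strip, that is, the growth rate of the Chebyshev operators.\<close>

definition Q :: real where "Q = real q powr (1 / p)"
definition R :: real where "R = real q powr (1 / p - 1 / 2)"

lemma R_gt_1: "1 < R"
  using q2 p1 p2 unfolding R_def by (intro gr_one_powr) (auto simp: field_simps)

lemma sqrt_q_R: "sqrt q * R = Q"
  using q2 by (simp add: R_def Q_def powr_half_sqrt[symmetric] powr_add[symmetric])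

lemma Q_gt_1: "1 < Q"
  using q2 p1 unfolding Q_def by (intro gr_one_powr) auto

lemma q_le_Q_square: "real q \<le> Q ^ 2"
proof -
  have "real q powr 1 \<le> real q powr (2 / p)"
    using q2 p1 p2 by (intro powr_mono) (auto simp: field_simps)
  also have "\<dots> = Q ^ 2" using q2 by (simp add: Q_def power2_eq_square powr_add[symmetric])
  finally show ?thesis using q2 by simp
qed

text \<open>A bound with an explicit constant is easier to add up and to rescale than a supremum.\<close>

definition weighted_bound :: "nat \<Rightarrow> real \<Rightarrow> ('a \<Rightarrow> complex) \<Rightarrow> bool" where
  "weighted_bound m B f \<longleftrightarrow> (\<forall>x. (1 + real (d r x)) ^ m * Q ^ d r x * cmod (f x) \<le> B)"

lemma weighted_abs_eq: "weighted_abs q E r p m f x = (1 + real (d r x)) ^ m * Q ^ d r x * cmod (f x)"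
proof -
  have "real q powr (real (d r x) / p) = Q ^ d r x"
    using q2 by (simp add: Q_def powr_realpow[symmetric] powr_powr mult.commute)
  then show ?thesis by (simp add: weighted_abs_def)
qed

lemma weighted_bound_seminorm:
  "f \<in> schwartz q E r p \<Longrightarrow> weighted_bound m (schwartz_seminorm q E r p m f) f"
  unfolding weighted_bound_def schwartz_seminorm_def weighted_abs_eq[symmetric] schwartz_def
  by (auto intro: cSUP_upper)

lemma seminorm_le: "weighted_bound m B f \<Longrightarrow> schwartz_seminorm q E r p m f \<le> B"
  unfolding weighted_bound_def schwartz_seminorm_def weighted_abs_eq[symmetric]
  by (auto intro: cSUP_least)

lemma schwartzI: "(\<And>m. \<exists>B. weighted_bound m B f) \<Longrightarrow> f \<in> schwartz q E r p"
  unfolding weighted_bound_def weighted_abs_eq[symmetric] schwartz_def bdd_above_def by auto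

lemma weighted_bound_nonneg: "weighted_bound m B f \<Longrightarrow> 0 \<le> B"
proof -
  assume "weighted_bound m B f"
  then have "(1 + real (d r r)) ^ m * Q ^ d r r * cmod (f r) \<le> B"
    unfolding weighted_bound_def by blast
  moreover have "0 \<le> (1 + real (d r r)) ^ m * Q ^ d r r * cmod (f r)"
    using Q_gt_1 by simp
  ultimately show "0 \<le> B" by linarith
qed

lemma weighted_bound_add:
  assumes "weighted_bound m B f" "weighted_bound m C g"
  shows "weighted_bound m (B + C) (\<lambda>x. f x + g x)"
  unfolding weighted_bound_def
proof
  fix x
  let ?w = "(1 + real (d r x)) ^ m * Q ^ d r x"
  have "?w * cmod (f x + g x) \<le> ?w * (cmod (f x) + cmod (g x))"
    using Q_gt_1 by (intro mult_left_mono norm_triangle_ineq) auto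
  also have "\<dots> \<le> B + C"
    using assms by (auto simp: weighted_bound_def distrib_left intro: add_mono)
  finally show "?w * cmod (f x + g x) \<le> B + C" .
qed

lemma weighted_bound_scale:
  assumes "weighted_bound m B f" shows "weighted_bound m (cmod c * B) (\<lambda>x. c * f x)"
  using assms unfolding weighted_bound_def
  by (auto simp: norm_mult mult.left_commute[of _ "cmod c"] mult_left_mono)

lemma weighted_bound_mono: "weighted_bound m B f \<Longrightarrow> B \<le> C \<Longrightarrow> weighted_bound m C f"
  unfolding weighted_bound_def by (meson order_trans)

lemma weighted_bound_diff:
  assumes "weighted_bound m B f" "weighted_bound m C g"
  shows "weighted_bound m (B + C) (\<lambda>x. f x - g x)"
  using weighted_bound_add[OF assms(1) weighted_bound_scale[OF assms(2), of "-1"]] by simp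

text \<open>By the decomposition of a sphere according to the number \<open>i\<close> of climbing steps there are at most
  \<open>2 q\<^sup>n\<^sup>-\<^sup>i\<close> vertices at distance \<open>d r x + n - 2 i\<close> from \<open>r\<close>. As \<open>q \<le> Q\<^sup>2\<close>, that is \<open>p \<le> 2\<close>, each
  of the \<open>n + 1\<close> pieces contributes at most as much as the last one, \<open>i = n\<close>.\<close>

lemma weighted_bound_sphere_sum:
  assumes "weighted_bound m B f"
  shows "weighted_bound m (2 * (1 + real n) ^ (m + 1) * Q ^ n * B) (sphere_sum E n f)"
  unfolding weighted_bound_def
proof
  fix x
  let ?A = "{y. d x y = n}"
  define I where "I = {..min n (d r x)}"
  define Y where "Y i = {y. d ((parent E r ^^ i) x) y = n - i \<and> d r y = d r x + n - 2 * i}" for i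
  define w where "w = (1 + real (d r x)) ^ m * Q ^ d r x"
  have w0: "0 \<le> w" using Q_gt_1 by (simp add: w_def)
  have B0: "0 \<le> B" using assms by (rule weighted_bound_nonneg)
  have single: "w * cmod (f y) * real (q ^ (n - i)) \<le> (1 + real n) ^ m * Q ^ n * B"
    if i: "i \<in> I" and y: "y \<in> ?A" "y \<in> Y i" for i y
  proof -
    have "real (q ^ (n - i)) \<le> (Q ^ 2) ^ (n - i)" using q_le_Q_square by (simp add: power_mono)
    also have "\<dots> = Q ^ (2 * (n - i))" by (simp add: power_mult)
    finally have q: "real (q ^ (n - i)) \<le> Q ^ (2 * (n - i))" .
    have "d r x + 2 * (n - i) = n + d r y" using i y by (auto simp: I_def Y_def)
    then have Q: "Q ^ d r x * Q ^ (2 * (n - i)) = Q ^ n * Q ^ d r y"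
      by (simp flip: power_add)
    have "d r x \<le> d r y + n" using gdist_triangle[of r x y] y by (simp add: gdist_commute)
    then have "1 + real (d r x) \<le> (1 + real n) * (1 + real (d r y))"
      by (auto simp: algebra_simps simp flip: of_nat_add of_nat_mult)
    then have m: "(1 + real (d r x)) ^ m \<le> ((1 + real n) * (1 + real (d r y))) ^ m"
      by (intro power_mono) auto
    have "w * cmod (f y) * real (q ^ (n - i)) \<le> w * cmod (f y) * Q ^ (2 * (n - i))"
      using w0 q by (intro mult_left_mono) auto
    also have "\<dots> = (1 + real (d r x)) ^ m * (Q ^ n * Q ^ d r y * cmod (f y))"
      unfolding w_def Q[symmetric] by (simp add: mult_ac)
    also have "\<dots> \<le> ((1 + real n) * (1 + real (d r y))) ^ m * (Q ^ n * Q ^ d r y * cmod (f y))"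
      using Q_gt_1 m by (intro mult_right_mono) auto
    also have "\<dots> = (1 + real n) ^ m * Q ^ n * ((1 + real (d r y)) ^ m * Q ^ d r y * cmod (f y))"
      by (simp add: power_mult_distrib mult_ac)
    also have "\<dots> \<le> (1 + real n) ^ m * Q ^ n * B"
      using assms Q_gt_1 by (intro mult_left_mono) (auto simp: weighted_bound_def)
    finally show ?thesis .
  qed
  have "w * cmod (sphere_sum E n f x) \<le> w * (\<Sum>y\<in>?A. cmod (f y))"
    unfolding sphere_sum_def by (intro mult_left_mono norm_sum w0)
  also have "\<dots> = (\<Sum>y\<in>?A. w * cmod (f y))" by (rule sum_distrib_left)
  also have "\<dots> \<le> (\<Sum>y\<in>?A. \<Sum>i\<in>I. if y \<in> Y i then w * cmod (f y) else 0)"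
  proof (rule sum_mono)
    fix y assume "y \<in> ?A"
    then obtain i where i: "i \<in> I" "y \<in> Y i"
      using ancestor_decomposition[of x y n r] by (auto simp: I_def Y_def)
    then have "w * cmod (f y) = (if y \<in> Y i then w * cmod (f y) else 0)" by simp
    also have "\<dots> \<le> (\<Sum>i\<in>I. if y \<in> Y i then w * cmod (f y) else 0)"
      by (rule member_le_sum) (use i w0 in \<open>auto simp: I_def\<close>)
    finally show "w * cmod (f y) \<le> (\<Sum>i\<in>I. if y \<in> Y i then w * cmod (f y) else 0)" .
  qed
  also have "\<dots> = (\<Sum>i\<in>I. \<Sum>y\<in>?A. if y \<in> Y i then w * cmod (f y) else 0)" by (rule sum.swap)
  also have "\<dots> \<le> (\<Sum>i\<in>I. 2 * ((1 + real n) ^ m * Q ^ n * B))"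
  proof (rule sum_mono)
    fix i assume i: "i \<in> I"
    have qpos: "0 < real (q ^ (n - i))" using q2 by simp
    have "card (?A \<inter> Y i) \<le> card {y. d ((parent E r ^^ i) x) y = n - i}"
      by (rule card_mono) (auto simp: Y_def)
    also have "\<dots> \<le> 2 * q ^ (n - i)" by (rule card_sphere_le)
    finally have "real (card (?A \<inter> Y i)) \<le> real (2 * q ^ (n - i))" by (rule of_nat_mono)
    then have c: "real (card (?A \<inter> Y i)) \<le> 2 * real (q ^ (n - i))" by simp
    have "(\<Sum>y\<in>?A. if y \<in> Y i then w * cmod (f y) else 0) = (\<Sum>y\<in>?A \<inter> Y i. w * cmod (f y))"
      by (simp add: sum.inter_restrict[symmetric] Int_def)
    also have "\<dots> \<le> real (card (?A \<inter> Y i)) * ((1 + real n) ^ m * Q ^ n * B / real (q ^ (n - i)))"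
      by (rule sum_bounded_above) (use single[OF i] qpos in \<open>simp add: pos_le_divide_eq del: of_nat_power\<close>)
    also have "\<dots> \<le> 2 * real (q ^ (n - i)) * ((1 + real n) ^ m * Q ^ n * B / real (q ^ (n - i)))"
      using c B0 Q_gt_1 qpos by (intro mult_right_mono) auto
    also have "\<dots> = 2 * ((1 + real n) ^ m * Q ^ n * B)" using q2 by simp
    finally show "(\<Sum>y\<in>?A. if y \<in> Y i then w * cmod (f y) else 0) \<le> \<dots>" .
  qed
  also have "\<dots> \<le> (1 + real n) * (2 * ((1 + real n) ^ m * Q ^ n * B))"
    using B0 Q_gt_1 by (auto simp: I_def intro!: mult_right_mono)
  finally show "(1 + real (d r x)) ^ m * Q ^ d r x * cmod (sphere_sum E n f x)
      \<le> 2 * (1 + real n) ^ (m + 1) * Q ^ n * B"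
    by (simp add: w_def mult_ac)
qed

text \<open>The operator \<open>q\<^sup>n\<^sup>/\<^sup>2\<close>\<open>cheb n\<close> is the sphere sum plus multiples, with bounded coefficients, of at most \<open>n\<close>
  sphere sums of smaller radius, which costs a further factor \<open>n + 1\<close>; and \<open>Q = q\<^sup>1\<^sup>/\<^sup>2 R\<close>.\<close>

lemma weighted_bound_cheb:
  assumes "weighted_bound m B f"
  shows "weighted_bound m (2 * (1 + real q) * (1 + real n) ^ (m + 2) * R ^ n * B) (cheb n f)"
proof -
  define b where "b n = 2 * (1 + real n) ^ (m + 1) * Q ^ n * B" for n :: nat
  have B0: "0 \<le> B" using assms by (rule weighted_bound_nonneg)
  have b_mono: "b k \<le> b n" if "k \<le> n" for k n
    using that B0 Q_gt_1 unfolding b_def by (intro mult_mono power_mono power_increasing) auto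
  have b0: "0 \<le> b n" for n using B0 Q_gt_1 by (simp add: b_def)
  have S: "weighted_bound m (b n) (sphere_sum E n f)" for n
    using weighted_bound_sphere_sum[OF assms] by (simp add: b_def)
  have S_q: "weighted_bound m (real q * b n) (\<lambda>x. of_nat q * sphere_sum E n f x)" for n
    using weighted_bound_scale[OF S[of n], of "of_nat q"] by simp
  have f: "weighted_bound m (b 0) f" by (rule weighted_bound_mono[OF assms]) (use B0 in \<open>simp add: b_def\<close>)
  have W: "weighted_bound m ((1 + real q) * (1 + real n) * b n) (\<lambda>x. sq ^ n * cheb n f x)" for n
  proof (induction n rule: less_induct)
    case (less n)
    consider "n = 0" | "n = 1" | "n = Suc (Suc 0)" | k where "n = Suc (Suc (Suc k))"
      by (metis One_nat_def not0_implies_Suc)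
    then show ?case
    proof cases
      case 1
      have "weighted_bound m (2 * b 0) (\<lambda>x. 2 * f x)" using weighted_bound_scale[OF f, of 2] by simp
      moreover have "2 * b 0 \<le> (1 + real q) * b 0" using q2 b0[of 0] by (intro mult_right_mono) auto
      ultimately show ?thesis using 1 weighted_bound_mono by simp
    next
      case 2
      have "b 1 \<le> (1 + real q) * 2 * b 1" using b0[of 1] q2 by (simp add: algebra_simps)
      then show ?thesis using weighted_bound_mono[OF S[of 1]] 2 q2 by simp
    next
      case 3
      have "sphere_sum E 2 f x = of_nat q * cheb 2 f x + (of_nat q - 1) * f x" for x
      proof -
        have "{..Suc (Suc 0)} = {0, 1, 2}" by auto
        then show ?thesis using sphere_sum_expansion[of 2 f x] q2
          by (simp add: numeral_2_eq_2 of_nat_diff del: cheb.simps(2,3))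
      qed
      then have e: "sq ^ n * cheb n f x = sphere_sum E 2 f x - (of_nat q - 1) * f x" for x
        using 3 by (simp add: numeral_2_eq_2 sq_sq mult.assoc[symmetric] del: cheb.simps)
      have "cmod (of_nat q - 1) = real q - 1"
        using q2 by (metis (no_types) norm_of_nat of_nat_1 of_nat_diff le_trans one_le_numeral)
      then have "weighted_bound m (b 2 + (real q - 1) * b 0) (\<lambda>x. sphere_sum E 2 f x - (of_nat q - 1) * f x)"
        using weighted_bound_diff[OF S[of 2] weighted_bound_scale[OF f, of "of_nat q - 1"]] by simp
      moreover have "b 2 + (real q - 1) * b 0 \<le> (1 + real q) * (1 + real n) * b n"
      proof -
        have "(real q - 1) * b 0 \<le> (real q - 1) * b 2" using b_mono[of 0 2] q2 by (intro mult_left_mono) auto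
        moreover have "real q * b 2 \<le> (1 + real q) * 3 * b 2" using b0[of 2] by (intro mult_right_mono) auto
        ultimately show ?thesis using 3 by (simp add: algebra_simps numeral_2_eq_2)
      qed
      ultimately show ?thesis unfolding e by (rule weighted_bound_mono)
    next
      case (4 k)
      have e: "sq ^ n * cheb n f x = sphere_sum E n f x - of_nat q * sphere_sum E (Suc k) f x
          + sq ^ Suc k * cheb (Suc k) f x" for x
        using sphere_sum_cheb[of k f x] unfolding 4 by simp
      have "weighted_bound m (b n + real q * b (Suc k) + (1 + real q) * (1 + real (Suc k)) * b (Suc k))
          (\<lambda>x. sq ^ n * cheb n f x)"
        unfolding e by (intro weighted_bound_add weighted_bound_diff S S_q less) (simp add: 4)
      moreover have "b n + real q * b (Suc k) + (1 + real q) * (1 + real (Suc k)) * b (Suc k)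
          \<le> b n + real q * b n + (1 + real q) * (1 + real (Suc k)) * b n"
        using b_mono[of "Suc k" n] 4 by (intro add_mono mult_left_mono) auto
      moreover have "\<dots> \<le> (1 + real q) * (1 + real n) * b n"
      proof -
        have "(1 + real q) * (1 + (1 + real (Suc k))) * b n \<le> (1 + real q) * (1 + real n) * b n"
          using b0[of n] 4 by (intro mult_right_mono mult_left_mono) auto
        then show ?thesis by (simp add: algebra_simps)
      qed
      ultimately show ?thesis by (meson weighted_bound_mono order_trans)
    qed
  qed
  have "weighted_bound m (cmod (1 / sq ^ n) * ((1 + real q) * (1 + real n) * b n))
      (\<lambda>x. 1 / sq ^ n * (sq ^ n * cheb n f x))"
    by (rule weighted_bound_scale[OF W])
  moreover have "(\<lambda>x. 1 / sq ^ n * (sq ^ n * cheb n f x)) = cheb n f"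
    using sq_nz by (auto simp del: of_real_eq_0_iff)
  moreover have "cmod (1 / sq ^ n) * ((1 + real q) * (1 + real n) * b n)
      = 2 * (1 + real q) * (1 + real n) ^ (m + 2) * R ^ n * B"
  proof -
    have "Q ^ n = sqrt q ^ n * R ^ n" by (simp flip: sqrt_q_R power_mult_distrib)
    moreover have "cmod (1 / sq ^ n) = 1 / sqrt q ^ n" by (simp add: norm_divide norm_power)
    moreover have "sqrt q ^ n > 0" using q2 by simp
    ultimately show ?thesis using q2 by (simp add: b_def divide_eq_eq mult_ac)
  qed
  ultimately show ?thesis by simp
qed

end

section \<open>Laurent coefficients on an annulus\<close>

definition annulus :: "real \<Rightarrow> complex set" where
  "annulus R = {u. 1 / R < cmod u \<and> cmod u < R}"

lemma open_annulus [simp]: "open (annulus R)"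
  unfolding annulus_def by (intro open_Collect_conj open_Collect_less continuous_intros)

lemma annulus_nz: "R > 1 \<Longrightarrow> u \<in> annulus R \<Longrightarrow> u \<noteq> 0"
  by (auto simp: annulus_def)

definition laurent_coeff :: "int \<Rightarrow> (complex \<Rightarrow> complex) \<Rightarrow> complex" where
  "laurent_coeff n f = contour_integral (circlepath 0 1) (\<lambda>u. f u * u powi (- n - 1)) / (2 * of_real pi * \<i>)"

lemma sphere_subset_annulus:
  assumes "R > 1" "1 / R < \<rho>" "\<rho> < R" shows "path_image (circlepath 0 \<rho>) \<subseteq> annulus R"
proof -
  have "0 < 1 / R" using assms(1) by simp
  then have "\<rho> > 0" using assms(2) by linarith
  then show ?thesis using assms by (auto simp: annulus_def)
qed

lemma holomorphic_times_powi:
  assumes "R > 1" "f holomorphic_on annulus R"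
  shows "(\<lambda>u. f u * u powi k) holomorphic_on annulus R"
  using assms annulus_nz by (intro holomorphic_intros) auto

lemma integrable_times_powi:
  assumes "R > 1" "f holomorphic_on annulus R"
  shows "(\<lambda>u. f u * u powi k) contour_integrable_on circlepath 0 1"
  by (rule contour_integrable_holomorphic_simple[OF holomorphic_times_powi[OF assms] open_annulus])
    (use assms sphere_subset_annulus[of R 1] in auto)

lemma laurent_coeff_add:
  assumes "R > 1" "f holomorphic_on annulus R" "g holomorphic_on annulus R"
  shows "laurent_coeff n (\<lambda>u. f u + g u) = laurent_coeff n f + laurent_coeff n g"
  using contour_integral_add[OF integrable_times_powi[OF assms(1,2)] integrable_times_powi[OF assms(1,3)]]
  by (simp add: laurent_coeff_def distrib_right add_divide_distrib)

lemma laurent_coeff_scale: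
  assumes "R > 1" "f holomorphic_on annulus R"
  shows "laurent_coeff n (\<lambda>u. c * f u) = c * laurent_coeff n f"
  using contour_integral_lmul[OF integrable_times_powi[OF assms], of c]
  by (simp add: laurent_coeff_def mult.assoc)

lemma laurent_coeff_cong:
  assumes "\<And>u. cmod u = 1 \<Longrightarrow> f u = g u"
  shows "laurent_coeff n f = laurent_coeff n g"
  unfolding laurent_coeff_def by (intro arg_cong2[of _ _ _ _ "(/)"] contour_integral_cong refl) (auto simp: assms)

text \<open>Radial segments between the two circles stay in the annulus, so Cauchy's theorem applies.\<close>

lemma laurent_coeff_circle:
  assumes R: "R > 1" and f: "f holomorphic_on annulus R" and \<rho>: "1 / R < \<rho>" "\<rho> < R"
  shows "laurent_coeff n f
    = contour_integral (circlepath 0 \<rho>) (\<lambda>u. f u * u powi (- n - 1)) / (2 * of_real pi * \<i>)"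
proof -
  have "homotopic_loops (annulus R) (circlepath 0 1) (circlepath 0 \<rho>)"
  proof (rule homotopic_loops_linear)
    fix t :: real
    define e where "e = exp (2 * of_real pi * \<i> * of_real t)"
    have e: "cmod e = 1" by (simp add: e_def norm_exp_eq_Re)
    show "closed_segment (circlepath 0 1 t) (circlepath 0 \<rho> t) \<subseteq> annulus R"
    proof
      fix x assume "x \<in> closed_segment (circlepath 0 1 t) (circlepath 0 \<rho> t)"
      then obtain s where s: "0 \<le> s" "s \<le> 1" "x = (1 - s) *\<^sub>R e + s *\<^sub>R (of_real \<rho> * e)"
        unfolding closed_segment_def by (auto simp: circlepath e_def)
      then have x: "x = of_real ((1 - s) * 1 + s * \<rho>) * e" by (simp add: scaleR_conv_of_real algebra_simps)
      have "1 / R < 1" using R by simp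
      then have "1 \<in> {1 / R<..<R}" "\<rho> \<in> {1 / R<..<R}" using R \<rho> by auto
      then have "(1 - s) *\<^sub>R 1 + s *\<^sub>R \<rho> \<in> {1 / R<..<R}"
        using s by (intro convexD[OF convex_real_interval(8)]) auto
      then have "1 / R < (1 - s) * 1 + s * \<rho>" "(1 - s) * 1 + s * \<rho> < R" by auto
      moreover from this R have "0 < (1 - s) * 1 + s * \<rho>"
        by (meson order_less_trans zero_less_divide_1_iff zero_less_one)
      ultimately show "x \<in> annulus R" unfolding x annulus_def by (simp add: norm_mult e del: of_real_add of_real_mult)
    qed
  qed auto
  then show ?thesis
    unfolding laurent_coeff_def
    using Cauchy_theorem_homotopic_loops[OF _ open_annulus holomorphic_times_powi[OF R f]] by simp
qed

text \<open>The radius of integration is free: let it tend to \<open>R\<close> for \<open>n \<ge> 0\<close> and to \<open>1 / R\<close> for \<open>n < 0\<close>.\<close>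

lemma laurent_coeff_bound:
  assumes R: "R > 1" and f: "f holomorphic_on annulus R" and B: "\<And>u. u \<in> annulus R \<Longrightarrow> cmod (f u) \<le> B"
  shows "R ^ nat \<bar>n\<bar> * cmod (laurent_coeff n f) \<le> B"
proof -
  have R1: "1 / R < 1" "0 < 1 / R" using R by auto
  have B0: "0 \<le> B"
    by (rule order_trans[OF norm_ge_zero B[of 1]]) (use R R1 in \<open>auto simp: annulus_def\<close>)
  have *: "\<rho> powi n * cmod (laurent_coeff n f) \<le> B" if \<rho>: "1 / R < \<rho>" "\<rho> < R" for \<rho>
  proof -
    have pos: "0 < \<rho>" using \<rho> R1 by linarith
    have "cmod (contour_integral (circlepath 0 \<rho>) (\<lambda>u. f u * u powi (- n - 1)))
        \<le> (B * \<rho> powi (- n - 1)) * (2 * pi * \<rho>)"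
    proof (rule has_contour_integral_bound_circlepath[OF has_contour_integral_integral])
      show "(\<lambda>u. f u * u powi (- n - 1)) contour_integrable_on circlepath 0 \<rho>"
        by (rule contour_integrable_holomorphic_simple[OF holomorphic_times_powi[OF R f] open_annulus])
          (use R \<rho> sphere_subset_annulus in auto)
      show "cmod (f u * u powi (- n - 1)) \<le> B * \<rho> powi (- n - 1)" if "cmod (u - 0) = \<rho>" for u
      proof -
        have "u \<in> annulus R" using that \<rho> by (simp add: annulus_def)
        then have "cmod (f u) \<le> B" by (rule B)
        then show ?thesis
          using that pos by (auto simp: norm_mult norm_power_int intro!: mult_right_mono)
      qed
    qed (use pos B0 in auto)
    also have "\<dots> = 2 * pi * (B * \<rho> powi (- n))"
      using pos by (simp add: power_int_diff)
    finally have "2 * pi * cmod (laurent_coeff n f) \<le> 2 * pi * (B * \<rho> powi (- n))"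
      unfolding laurent_coeff_circle[OF R f \<rho>] by (simp add: norm_divide norm_mult)
    then have "cmod (laurent_coeff n f) \<le> B * \<rho> powi (- n)" by simp
    then have "\<rho> powi n * cmod (laurent_coeff n f) \<le> \<rho> powi n * (B * \<rho> powi (- n))"
      using pos by (intro mult_left_mono) auto
    also have "\<dots> = B" using pos by (simp add: power_int_minus)
    finally show ?thesis .
  qed
  show ?thesis
  proof (cases "n \<ge> 0")
    case True
    have ev: "eventually (\<lambda>\<rho>. \<rho> powi n * cmod (laurent_coeff n f) \<le> B) (at_left R)"
      using eventually_at_left_real[of "1 / R" R] R R1 by (auto elim!: eventually_mono intro!: *)
    have "((\<lambda>\<rho>. \<rho> powi n * cmod (laurent_coeff n f)) \<longlongrightarrow> R powi n * cmod (laurent_coeff n f)) (at_left R)"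
      using R by (intro tendsto_intros) auto
    from tendsto_upperbound[OF this ev] show ?thesis using True by (simp add: power_int_def)
  next
    case False
    have ev: "eventually (\<lambda>\<rho>. \<rho> powi n * cmod (laurent_coeff n f) \<le> B) (at_right (1 / R))"
      using eventually_at_right_real[of "1 / R" R] R R1 by (auto elim!: eventually_mono intro!: *)
    have "((\<lambda>\<rho>. \<rho> powi n * cmod (laurent_coeff n f)) \<longlongrightarrow> (1 / R) powi n * cmod (laurent_coeff n f)) (at_right (1 / R))"
      using R by (intro tendsto_intros) auto
    from tendsto_upperbound[OF this ev] show ?thesis using False R
      by (simp add: power_int_def inverse_eq_divide)
  qed
qed

text \<open>Integration by parts: \<open>f(u) u\<^sup>-\<^sup>n\<close> is a primitive of the difference of the two integrands.\<close>

lemma laurent_coeff_theta: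
  assumes R: "R > 1" and f: "f holomorphic_on annulus R"
  shows "of_int n * laurent_coeff n f = laurent_coeff n (\<lambda>u. u * deriv f u)"
proof -
  have f': "(\<lambda>u. u * deriv f u) holomorphic_on annulus R"
    using f by (intro holomorphic_intros holomorphic_deriv) auto
  have "((\<lambda>u. (u * deriv f u) * u powi (- n - 1) + (- of_int n) * (f u * u powi (- n - 1))) has_contour_integral
      ((\<lambda>u. f u * u powi (- n)) (pathfinish (circlepath 0 1)) - (\<lambda>u. f u * u powi (- n)) (pathstart (circlepath 0 1))))
      (circlepath 0 1)"
  proof (rule contour_integral_primitive[where S = "annulus R"])
    fix u assume u: "u \<in> annulus R"
    then have nz: "u \<noteq> 0" using R annulus_nz by blast
    have "(f has_field_derivative deriv f u) (at u within annulus R)"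
      using f u by (meson DERIV_subset holomorphic_derivI open_annulus subset_UNIV)
    then show "((\<lambda>u. f u * u powi (- n)) has_field_derivative
        (u * deriv f u) * u powi (- n - 1) + (- of_int n) * (f u * u powi (- n - 1))) (at u within annulus R)"
      using nz by (auto intro!: derivative_eq_intros simp: power_int_diff)
  qed (use R sphere_subset_annulus[of R 1] in auto)
  then have "((\<lambda>u. (u * deriv f u) * u powi (- n - 1) + (- of_int n) * (f u * u powi (- n - 1)))
      has_contour_integral 0) (circlepath 0 1)" by simp
  then have "0 = contour_integral (circlepath 0 1) (\<lambda>u. (u * deriv f u) * u powi (- n - 1) + (- of_int n) * (f u * u powi (- n - 1)))"
    by (metis contour_integral_unique)
  also have "\<dots> = contour_integral (circlepath 0 1) (\<lambda>u. (u * deriv f u) * u powi (- n - 1))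
      + (- of_int n) * contour_integral (circlepath 0 1) (\<lambda>u. f u * u powi (- n - 1))"
    by (subst contour_integral_add[OF integrable_times_powi[OF R f'] contour_integrable_lmul[OF integrable_times_powi[OF R f]]],
        subst contour_integral_lmul[OF integrable_times_powi[OF R f]]) simp
  finally show ?thesis by (simp add: laurent_coeff_def)
qed

lemma laurent_coeff_1: "laurent_coeff n (\<lambda>u. 1) = (if n = 0 then 1 else 0)"
proof (cases "n = 0")
  case True
  have "contour_integral (circlepath 0 1) (\<lambda>u::complex. 1 / (u - 0)) = 2 * of_real pi * \<i> * 1"
    by (subst contour_integral_circlepath) auto
  then show ?thesis using True by (simp add: laurent_coeff_def power_int_minus inverse_eq_divide)
next
  case False
  have "of_int n * laurent_coeff n (\<lambda>u. 1) = laurent_coeff n (\<lambda>u. u * 0)"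
    using laurent_coeff_theta[of 2 "\<lambda>u. 1" n] by simp
  then show ?thesis using False by (simp add: laurent_coeff_def)
qed

text \<open>Functions whose first \<open>j\<close> derivatives along \<open>u d/du\<close> are bounded up to the boundary. This
  derivation, unlike \<open>d/du\<close>, multiplies the \<open>n\<close>th Laurent coefficient by \<open>n\<close>.\<close>

fun smooth_annulus :: "real \<Rightarrow> nat \<Rightarrow> (complex \<Rightarrow> complex) \<Rightarrow> bool" where
  "smooth_annulus R 0 b \<longleftrightarrow> b holomorphic_on annulus R \<and> bounded (b ` annulus R)"
| "smooth_annulus R (Suc j) b \<longleftrightarrow> b holomorphic_on annulus R \<and> bounded (b ` annulus R) \<and>
     smooth_annulus R j (\<lambda>u. u * deriv b u)"

lemma smooth_annulusD:
  "smooth_annulus R j b \<Longrightarrow> b holomorphic_on annulus R" "smooth_annulus R j b \<Longrightarrow> bounded (b ` annulus R)"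
  by (cases j; simp)+

lemma smooth_annulus_cong:
  assumes "\<And>u. u \<in> annulus R \<Longrightarrow> a u = b u"
  shows "smooth_annulus R j a \<longleftrightarrow> smooth_annulus R j b"
  using assms
proof (induction j arbitrary: a b)
  case 0
  then show ?case by (auto cong: holomorphic_cong image_cong)
next
  case (Suc j)
  have "deriv a u = deriv b u" if "u \<in> annulus R" for u
    by (rule deriv_cong_ev) (use Suc.prems that in \<open>auto intro!: eventually_nhds_in_open[THEN eventually_mono] open_annulus\<close>)
  then have "smooth_annulus R j (\<lambda>u. u * deriv a u) \<longleftrightarrow> smooth_annulus R j (\<lambda>u. u * deriv b u)"
    by (intro Suc.IH) auto
  moreover have "a holomorphic_on annulus R \<longleftrightarrow> b holomorphic_on annulus R"
    using Suc.prems by (intro holomorphic_cong) auto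
  moreover have "a ` annulus R = b ` annulus R" using Suc.prems by (intro image_cong) auto
  ultimately show ?case by simp
qed

lemma smooth_annulus_Suc: "smooth_annulus R (Suc j) b \<Longrightarrow> smooth_annulus R j b"
proof (induction j arbitrary: b)
  case (Suc j)
  then have "smooth_annulus R j (\<lambda>u. u * deriv b u)" using smooth_annulus.simps(2) by blast
  with Suc.prems show ?case by simp
qed simp

lemma bounded_image_times:
  fixes a b :: "'a \<Rightarrow> complex"
  assumes "bounded (a ` S)" "bounded (b ` S)"
  shows "bounded ((\<lambda>u. a u * b u) ` S)"
proof -
  obtain A B where "\<And>u. u \<in> S \<Longrightarrow> cmod (a u) \<le> A" "\<And>u. u \<in> S \<Longrightarrow> cmod (b u) \<le> B"
    using assms by (auto simp: bounded_iff)
  then have "cmod (a u * b u) \<le> A * B" if "u \<in> S" for u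
    using that by (auto simp: norm_mult intro!: mult_mono order_trans[OF norm_ge_zero])
  then show ?thesis by (auto simp: bounded_iff)
qed

lemma smooth_annulus_add:
  "smooth_annulus R j a \<Longrightarrow> smooth_annulus R j b \<Longrightarrow> smooth_annulus R j (\<lambda>u. a u + b u)"
proof (induction j arbitrary: a b)
  case 0
  then show ?case by (auto intro!: holomorphic_intros bounded_plus_comp)
next
  case (Suc j)
  then have h: "a holomorphic_on annulus R" "b holomorphic_on annulus R" by auto
  have "smooth_annulus R j (\<lambda>u. u * deriv (\<lambda>u. a u + b u) u)
      \<longleftrightarrow> smooth_annulus R j (\<lambda>u. u * deriv a u + u * deriv b u)"
    using h by (intro smooth_annulus_cong)
      (auto simp: distrib_left holomorphic_on_imp_differentiable_at)
  then show ?case using Suc by (auto intro!: holomorphic_intros bounded_plus_comp)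
qed

lemma smooth_annulus_mult:
  "smooth_annulus R j a \<Longrightarrow> smooth_annulus R j b \<Longrightarrow> smooth_annulus R j (\<lambda>u. a u * b u)"
proof (induction j arbitrary: a b)
  case 0
  then show ?case by (auto intro!: holomorphic_intros bounded_image_times)
next
  case (Suc j)
  then have h: "a holomorphic_on annulus R" "b holomorphic_on annulus R" by auto
  have "smooth_annulus R j (\<lambda>u. u * deriv (\<lambda>u. a u * b u) u)
      \<longleftrightarrow> smooth_annulus R j (\<lambda>u. a u * (u * deriv b u) + (u * deriv a u) * b u)"
    using h by (intro smooth_annulus_cong)
      (auto simp: algebra_simps holomorphic_on_imp_differentiable_at)
  also have "\<dots>"
  proof -
    have "smooth_annulus R j a" "smooth_annulus R j b"
      using smooth_annulus_Suc Suc.prems by blast+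
    moreover have "smooth_annulus R j (\<lambda>u. u * deriv a u)" "smooth_annulus R j (\<lambda>u. u * deriv b u)"
      using Suc.prems by simp_all
    ultimately show ?thesis
      using Suc.IH[of a "\<lambda>u. u * deriv b u"] Suc.IH[of "\<lambda>u. u * deriv a u" b] smooth_annulus_add by blast
  qed
  finally show ?case using Suc by (auto intro!: holomorphic_intros bounded_image_times)
qed

lemma smooth_annulus_const: "smooth_annulus R j (\<lambda>u. c)"
  by (induction j arbitrary: c) (auto simp: image_constant_conv)

text \<open>Norm-controlled inversion. Each factor \<open>n\<close> is traded for one derivative of \<open>b / (w - h)\<^sup>k\<close>, which
  is \<open>b\<^sub>1 / (w - h)\<^sup>k + b\<^sub>2 / (w - h)\<^sup>k\<^sup>+\<^sup>1\<close> with \<open>b\<^sub>1\<close>, \<open>b\<^sub>2\<close> independent of \<open>w\<close>; so \<open>N\<close> factors cost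
  \<open>N\<close> additional powers of the resolvent, and the constant is uniform in \<open>w\<close>.\<close>

lemma laurent_coeff_resolvent_power:
  assumes R: "R > 1" and h: "\<And>j. smooth_annulus R j h"
  shows "(\<And>j. smooth_annulus R j b) \<Longrightarrow>
    \<exists>C. \<forall>w \<epsilon> n. 0 < \<epsilon> \<longrightarrow> \<epsilon> \<le> 1 \<longrightarrow> (\<forall>u\<in>annulus R. \<epsilon> \<le> cmod (w - h u)) \<longrightarrow>
      real_of_int \<bar>n\<bar> ^ N * R ^ nat \<bar>n\<bar> * cmod (laurent_coeff n (\<lambda>u. b u / (w - h u) ^ k)) \<le> C / \<epsilon> ^ (k + N)"
proof (induction N arbitrary: b k)
  case 0
  obtain B where B: "\<And>u. u \<in> annulus R \<Longrightarrow> cmod (b u) \<le> B"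
    using smooth_annulusD(2)[OF 0[of 0]] by (auto simp: bounded_iff)
  show ?case
  proof (rule exI[of _ B], safe)
    fix w \<epsilon> n assume \<epsilon>: "0 < \<epsilon>" "\<forall>u\<in>annulus R. \<epsilon> \<le> cmod (w - h u)"
    have "R ^ nat \<bar>n\<bar> * cmod (laurent_coeff n (\<lambda>u. b u / (w - h u) ^ k)) \<le> B / \<epsilon> ^ k"
    proof (rule laurent_coeff_bound[OF R])
      show "(\<lambda>u. b u / (w - h u) ^ k) holomorphic_on annulus R"
        using \<epsilon> smooth_annulusD(1)[OF h[of 0]] smooth_annulusD(1)[OF 0[of 0]]
        by (intro holomorphic_intros) auto
      fix u assume u: "u \<in> annulus R"
      have "cmod (b u / (w - h u) ^ k) = cmod (b u) / cmod (w - h u) ^ k" by (simp add: norm_divide norm_power)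
      also have "\<dots> \<le> B / \<epsilon> ^ k"
      proof (intro frac_le power_mono zero_less_power)
        show "0 \<le> B" using B[OF u] norm_ge_zero[of "b u"] by linarith
      qed (use \<epsilon> u B[OF u] in auto)
      finally show "cmod (b u / (w - h u) ^ k) \<le> B / \<epsilon> ^ k" .
    qed
    then show "real_of_int \<bar>n\<bar> ^ 0 * R ^ nat \<bar>n\<bar> * cmod (laurent_coeff n (\<lambda>u. b u / (w - h u) ^ k)) \<le> B / \<epsilon> ^ (k + 0)"
      by simp
  qed
next
  case (Suc N)
  define b1 where "b1 = (\<lambda>u. u * deriv b u)"
  define b2 where "b2 = (\<lambda>u. of_nat k * (b u * (u * deriv h u)))"
  have b1: "smooth_annulus R j b1" for j using Suc.prems[of "Suc j"] by (simp add: b1_def)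
  have b2: "smooth_annulus R j b2" for j
  proof -
    have "smooth_annulus R j (\<lambda>u. u * deriv h u)" using h[of "Suc j"] by simp
    then show ?thesis
      unfolding b2_def by (rule smooth_annulus_mult[OF smooth_annulus_const smooth_annulus_mult[OF Suc.prems]])
  qed
  obtain C1 where C1: "\<And>w \<epsilon> n. 0 < \<epsilon> \<Longrightarrow> \<epsilon> \<le> 1 \<Longrightarrow> (\<forall>u\<in>annulus R. \<epsilon> \<le> cmod (w - h u)) \<Longrightarrow>
      real_of_int \<bar>n\<bar> ^ N * R ^ nat \<bar>n\<bar> * cmod (laurent_coeff n (\<lambda>u. b1 u / (w - h u) ^ k)) \<le> C1 / \<epsilon> ^ (k + N)"
    using Suc.IH[of b1 k, OF b1] by blast
  obtain C2 where C2: "\<And>w \<epsilon> n. 0 < \<epsilon> \<Longrightarrow> \<epsilon> \<le> 1 \<Longrightarrow> (\<forall>u\<in>annulus R. \<epsilon> \<le> cmod (w - h u)) \<Longrightarrow>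
      real_of_int \<bar>n\<bar> ^ N * R ^ nat \<bar>n\<bar> * cmod (laurent_coeff n (\<lambda>u. b2 u / (w - h u) ^ Suc k)) \<le> C2 / \<epsilon> ^ (Suc k + N)"
    using Suc.IH[of b2 "Suc k", OF b2] by blast
  show ?case
  proof (rule exI[of _ "\<bar>C1\<bar> + C2"], safe)
    fix w \<epsilon> n assume \<epsilon>: "0 < \<epsilon>" "\<epsilon> \<le> 1" "\<forall>u\<in>annulus R. \<epsilon> \<le> cmod (w - h u)"
    have hh: "h holomorphic_on annulus R" and bh: "b holomorphic_on annulus R"
      using smooth_annulusD(1)[OF h[of 0]] smooth_annulusD(1)[OF Suc.prems[of 0]] by auto
    have hol: "(\<lambda>u. g u / (w - h u) ^ l) holomorphic_on annulus R" if "g holomorphic_on annulus R" for g l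
      using \<epsilon> that hh by (intro holomorphic_intros) auto
    have der: "u * deriv (\<lambda>u. b u / (w - h u) ^ k) u = b1 u / (w - h u) ^ k + b2 u / (w - h u) ^ Suc k"
      if u: "u \<in> annulus R" for u
    proof -
      have nz: "w - h u \<noteq> 0" using \<epsilon> u by force
      have d: "(b has_field_derivative deriv b u) (at u)" "(h has_field_derivative deriv h u) (at u)"
        using bh hh u by (auto intro: holomorphic_derivI)
      have "((\<lambda>u. b u / (w - h u) ^ k) has_field_derivative
          deriv b u / (w - h u) ^ k + of_nat k * (b u * deriv h u) / (w - h u) ^ Suc k) (at u)"
      proof (cases k)
        case 0 then show ?thesis using d by simp
      next
        case (Suc k')
        have "((\<lambda>u. (w - h u) ^ k) has_field_derivative of_nat k * (w - h u) ^ k' * (- deriv h u)) (at u)"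
          using DERIV_power[OF DERIV_diff[OF DERIV_const[of w] d(2)], of k] by (simp add: Suc mult_ac)
        from DERIV_divide[OF d(1) this] nz
        have "((\<lambda>u. b u / (w - h u) ^ k) has_field_derivative
          (deriv b u * (w - h u) ^ k - b u * (of_nat k * (w - h u) ^ k' * (- deriv h u)))
            / ((w - h u) ^ k * (w - h u) ^ k)) (at u)" by simp
        also have "(b' * X ^ k - b0 * (c * X ^ k' * (- h'))) / (X ^ k * X ^ k)
            = b' / X ^ k + c * (b0 * h') / X ^ Suc k" if "X \<noteq> 0" for X b' b0 c h' :: complex
          using that by (simp add: Suc field_simps)
        finally show ?thesis using nz by simp
      qed
      then show ?thesis by (simp add: DERIV_imp_deriv b1_def b2_def distrib_left)
    qed
    have "of_int n * laurent_coeff n (\<lambda>u. b u / (w - h u) ^ k)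
        = laurent_coeff n (\<lambda>u. u * deriv (\<lambda>u. b u / (w - h u) ^ k) u)"
      by (rule laurent_coeff_theta[OF R hol[OF bh]])
    also have "\<dots> = laurent_coeff n (\<lambda>u. b1 u / (w - h u) ^ k + b2 u / (w - h u) ^ Suc k)"
      using R by (intro laurent_coeff_cong der) (auto simp: annulus_def)
    also have "\<dots> = laurent_coeff n (\<lambda>u. b1 u / (w - h u) ^ k) + laurent_coeff n (\<lambda>u. b2 u / (w - h u) ^ Suc k)"
      by (rule laurent_coeff_add[OF R hol hol]) (use smooth_annulusD(1)[OF b1] smooth_annulusD(1)[OF b2] in auto)
    finally have "cmod (of_int n * laurent_coeff n (\<lambda>u. b u / (w - h u) ^ k))
        \<le> cmod (laurent_coeff n (\<lambda>u. b1 u / (w - h u) ^ k)) + cmod (laurent_coeff n (\<lambda>u. b2 u / (w - h u) ^ Suc k))"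
      using norm_triangle_ineq by simp
    then have *: "real_of_int \<bar>n\<bar> * cmod (laurent_coeff n (\<lambda>u. b u / (w - h u) ^ k))
        \<le> cmod (laurent_coeff n (\<lambda>u. b1 u / (w - h u) ^ k)) + cmod (laurent_coeff n (\<lambda>u. b2 u / (w - h u) ^ Suc k))"
      by (simp only: norm_mult norm_of_int of_int_abs)
    have "real_of_int \<bar>n\<bar> ^ Suc N * R ^ nat \<bar>n\<bar> * cmod (laurent_coeff n (\<lambda>u. b u / (w - h u) ^ k))
        = real_of_int \<bar>n\<bar> ^ N * R ^ nat \<bar>n\<bar> * (real_of_int \<bar>n\<bar> * cmod (laurent_coeff n (\<lambda>u. b u / (w - h u) ^ k)))"
      by (simp add: mult_ac)
    also have "\<dots> \<le> real_of_int \<bar>n\<bar> ^ N * R ^ nat \<bar>n\<bar> * (cmod (laurent_coeff n (\<lambda>u. b1 u / (w - h u) ^ k)) + cmod (laurent_coeff n (\<lambda>u. b2 u / (w - h u) ^ Suc k)))"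
      using R by (intro mult_left_mono *) auto
    also have "\<dots> \<le> C1 / \<epsilon> ^ (k + N) + C2 / \<epsilon> ^ (Suc k + N)"
      unfolding distrib_left by (intro add_mono C1 C2 \<epsilon>)
    also have "\<dots> \<le> \<bar>C1\<bar> / \<epsilon> ^ (k + Suc N) + C2 / \<epsilon> ^ (k + Suc N)"
    proof -
      have "C1 / \<epsilon> ^ (k + N) \<le> \<bar>C1\<bar> / \<epsilon> ^ (k + Suc N)"
        using \<epsilon> by (intro frac_le power_decreasing) auto
      then show ?thesis by simp
    qed
    finally show "real_of_int \<bar>n\<bar> ^ Suc N * R ^ nat \<bar>n\<bar> * cmod (laurent_coeff n (\<lambda>u. b u / (w - h u) ^ k))
        \<le> (\<bar>C1\<bar> + C2) / \<epsilon> ^ (k + Suc N)"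
      by (simp add: add_divide_distrib)
  qed
qed

section \<open>Rapidly convergent Laurent series\<close>

abbreviation nweight :: "real \<Rightarrow> nat \<Rightarrow> nat \<Rightarrow> real" where
  "nweight R K n \<equiv> (1 + real n) ^ K * R ^ n"

abbreviation closed_annulus :: "real \<Rightarrow> complex set" where
  "closed_annulus R \<equiv> {u. 1 / R \<le> cmod u \<and> cmod u \<le> R}"

definition nrapid :: "real \<Rightarrow> (nat \<Rightarrow> complex) \<Rightarrow> bool" where
  "nrapid R a \<longleftrightarrow> (\<forall>K. \<exists>C. \<forall>n. nweight R K n * cmod (a n) \<le> C)"

lemma nrapid_uminus: "nrapid R a \<Longrightarrow> nrapid R (\<lambda>n. - a n)"
  by (simp add: nrapid_def)

lemma nrapid_scale: "nrapid R a \<Longrightarrow> nrapid R (\<lambda>n. c * a n)"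
  unfolding nrapid_def
proof
  fix K
  assume "\<forall>K. \<exists>C. \<forall>n. nweight R K n * cmod (a n) \<le> C"
  then obtain C where "\<And>n. nweight R K n * cmod (a n) \<le> C" by meson
  then have "cmod c * (nweight R K n * cmod (a n)) \<le> cmod c * C" for n
    by (intro mult_left_mono) auto
  then show "\<exists>C. \<forall>n. nweight R K n * cmod (c * a n) \<le> C"
    by (intro exI[of _ "cmod c * C"]) (simp add: norm_mult mult_ac)
qed

lemma nrapid_index:
  assumes "nrapid R a" "R > 0" shows "nrapid R (\<lambda>n. of_nat n * a n)"
  unfolding nrapid_def
proof
  fix K
  obtain C where C: "\<And>n. nweight R (K + 1) n * cmod (a n) \<le> C"
    using assms unfolding nrapid_def by meson
  have "nweight R K n * cmod (of_nat n * a n) \<le> C" for n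
  proof -
    have "real n * (nweight R K n * cmod (a n)) \<le> (1 + real n) * (nweight R K n * cmod (a n))"
      using assms by (intro mult_right_mono) auto
    also have "\<dots> \<le> C" using C[of n] by (simp add: mult_ac)
    finally show ?thesis by (simp add: norm_mult mult_ac)
  qed
  then show "\<exists>C. \<forall>n. nweight R K n * cmod (of_nat n * a n) \<le> C" by blast
qed

lemma nrapid_weight_summable:
  assumes "nrapid R a" "R > 0"
  shows "summable (\<lambda>n. cmod (a n) * nweight R K n)"
proof -
  obtain C where C: "\<And>n. nweight R (K + 2) n * cmod (a n) \<le> C"
    using assms(1) unfolding nrapid_def by meson
  have "summable (\<lambda>n. C * (1 / (real n + 1) ^ 2))"
    using sums_summable[OF inverse_squares_sums] by (intro summable_mult) (simp add: add.commute)
  then show ?thesis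
  proof (rule summable_comparison_test'[where N = 0])
    fix n
    have "cmod (a n) * nweight R K n * (real n + 1) ^ 2 \<le> C"
      using C[of n] by (simp only: power_add mult_ac add.commute)
    then have "cmod (a n) * nweight R K n \<le> C / (real n + 1) ^ 2"
      by (subst pos_le_divide_eq) auto
    then show "norm (cmod (a n) * nweight R K n) \<le> C * (1 / (real n + 1) ^ 2)"
      using assms(2) by simp
  qed
qed

lemma nrapid_summable:
  assumes "nrapid R a" "R > 0"
  shows "summable (\<lambda>n. cmod (a n) * R ^ n)"
  using nrapid_weight_summable[OF assms, of 0] by simp

definition pow_series :: "(nat \<Rightarrow> complex) \<Rightarrow> complex \<Rightarrow> complex" where
  "pow_series a u = (\<Sum>n. a n * u ^ n)"

lemma pow_series_term:
  assumes "R > 0" "cmod u \<le> R" shows "norm (a n * u ^ n) \<le> cmod (a n) * R ^ n"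
  using assms by (auto simp: norm_mult norm_power intro!: mult_left_mono power_mono)

lemma pow_series_summable:
  assumes "nrapid R a" "R > 0" "cmod u \<le> R"
  shows "summable (\<lambda>n. norm (a n * u ^ n))" "summable (\<lambda>n. a n * u ^ n)"
proof -
  show *: "summable (\<lambda>n. norm (a n * u ^ n))"
  proof (rule summable_comparison_test'[OF nrapid_summable[OF assms(1,2)], of 0])
    show "norm (norm (a n * u ^ n)) \<le> cmod (a n) * R ^ n" for n
      using pow_series_term[OF assms(2,3), of a n] by simp
  qed
  show "summable (\<lambda>n. a n * u ^ n)" by (rule summable_norm_cancel[OF *])
qed

lemma pow_series_scale:
  assumes "nrapid R a" "R > 0" "cmod u \<le> R"
  shows "pow_series (\<lambda>n. c * a n) u = c * pow_series a u"
  unfolding pow_series_def using suminf_mult[OF pow_series_summable(2)[OF assms], of c] by (simp add: mult.assoc)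

lemma pow_series_bound:
  assumes "nrapid R a" "R > 0" "cmod u \<le> R"
  shows "cmod (pow_series a u) \<le> (\<Sum>n. cmod (a n) * R ^ n)"
proof -
  have "cmod (pow_series a u) \<le> (\<Sum>n. norm (a n * u ^ n))"
    unfolding pow_series_def by (rule summable_norm[OF pow_series_summable(1)[OF assms]])
  also have "\<dots> \<le> (\<Sum>n. cmod (a n) * R ^ n)"
    by (intro suminf_le pow_series_term pow_series_summable(1)[OF assms] nrapid_summable assms)
  finally show ?thesis .
qed

lemma pow_series_deriv:
  assumes "nrapid R a" "R > 0" "cmod u < R"
  shows "\<exists>D. (pow_series a has_field_derivative D) (at u) \<and> u * D = pow_series (\<lambda>n. of_nat n * a n) u"
proof -
  let ?D = "\<Sum>n. diffs a n * u ^ n"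
  have s: "summable (\<lambda>n. a n * v ^ n)" if "cmod v < R" for v
    by (rule pow_series_summable(2)) (use assms that in auto)
  have "(\<lambda>n. of_nat n * a n * u ^ (n - Suc 0)) sums ?D"
    by (rule diffs_equiv[OF termdiff_converges[OF assms(3) s]])
  then have "(\<lambda>n. u * (of_nat n * a n * u ^ (n - Suc 0))) sums (u * ?D)" by (rule sums_mult)
  moreover have "u * (of_nat n * a n * u ^ (n - Suc 0)) = of_nat n * a n * u ^ n" for n
    by (cases n) auto
  ultimately have "u * ?D = pow_series (\<lambda>n. of_nat n * a n) u"
    unfolding pow_series_def by (simp add: sums_iff)
  moreover have "(pow_series a has_field_derivative ?D) (at u)"
    using termdiffs_strong'[OF s assms(3)] by (simp add: pow_series_def[abs_def])
  ultimately show ?thesis by blast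
qed

lemma pow_series_uniform:
  assumes "nrapid R a" "R > 0"
  shows "uniform_limit (cball 0 R) (\<lambda>n u. \<Sum>i<n. a i * u ^ i) (pow_series a) sequentially"
  unfolding pow_series_def[abs_def]
  by (rule Weierstrass_m_test[OF _ nrapid_summable[OF assms]]) (use pow_series_term[OF assms(2)] in auto)

lemma continuous_on_pow_series:
  assumes "nrapid R a" "R > 0" shows "continuous_on (cball 0 R) (pow_series a)"
  by (rule uniform_limit_theorem[OF _ pow_series_uniform[OF assms]])
    (auto intro!: always_eventually continuous_intros)

text \<open>Splitting off the negative powers as a power series in \<open>1 / u\<close> leaves only power series to handle.\<close>

definition laurent_series :: "(nat \<Rightarrow> complex) \<Rightarrow> (nat \<Rightarrow> complex) \<Rightarrow> complex \<Rightarrow> complex" where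
  "laurent_series a b u = pow_series a u + pow_series b (1 / u)"

lemma annulus_inverse:
  assumes "R > 1" "u \<in> annulus R" shows "cmod (1 / u) < R"
proof -
  have "0 < 1 / R" "1 / R < cmod u" using assms by (auto simp: annulus_def)
  then have "0 < cmod u" by linarith
  then show ?thesis using \<open>1 / R < cmod u\<close> assms by (simp add: norm_divide divide_less_eq mult.commute)
qed

lemma laurent_series_deriv:
  assumes R: "R > 1" and a: "nrapid R a" "nrapid R b" and u: "u \<in> annulus R"
  shows "laurent_series a b field_differentiable at u"
    "u * deriv (laurent_series a b) u = laurent_series (\<lambda>n. of_nat n * a n) (\<lambda>n. - (of_nat n * b n)) u"
proof -
  have u': "cmod u < R" "cmod (1 / u) < R" "u \<noteq> 0"
    using annulus_inverse[OF R u] annulus_nz[OF R u] u by (auto simp: annulus_def)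
  obtain D1 where D1: "(pow_series a has_field_derivative D1) (at u)" "u * D1 = pow_series (\<lambda>n. of_nat n * a n) u"
    using pow_series_deriv[OF a(1) _ u'(1)] R by auto
  obtain D2 where D2: "(pow_series b has_field_derivative D2) (at (1 / u))"
      "1 / u * D2 = pow_series (\<lambda>n. of_nat n * b n) (1 / u)"
    using pow_series_deriv[OF a(2) _ u'(2)] R by auto
  have "((\<lambda>u. 1 / u) has_field_derivative - 1 / u ^ 2) (at u)"
    using u'(3) by (auto intro!: derivative_eq_intros simp: power2_eq_square)
  then have D: "(laurent_series a b has_field_derivative D1 + D2 * (- 1 / u ^ 2)) (at u)"
    unfolding laurent_series_def[abs_def] by (intro DERIV_add D1 DERIV_chain2[where f = "pow_series b"] D2)
  show "laurent_series a b field_differentiable at u"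
    using D by (auto simp: field_differentiable_def)
  have "pow_series (\<lambda>n. - (of_nat n * b n)) (1 / u) = - pow_series (\<lambda>n. of_nat n * b n) (1 / u)"
    unfolding pow_series_def
    using pow_series_summable(2)[OF nrapid_index[OF a(2)], of "1 / u"] u' R by (simp flip: suminf_minus)
  then show "u * deriv (laurent_series a b) u = laurent_series (\<lambda>n. of_nat n * a n) (\<lambda>n. - (of_nat n * b n)) u"
    unfolding laurent_series_def[of "\<lambda>n. of_nat n * a n"] D1(2)[symmetric] D2(2)[symmetric] DERIV_imp_deriv[OF D]
    using u'(3) by (simp add: D2(2)[symmetric] field_simps power2_eq_square)
qed

lemma laurent_series_holomorphic:
  assumes "R > 1" "nrapid R a" "nrapid R b" shows "laurent_series a b holomorphic_on annulus R"
  using laurent_series_deriv(1)[OF assms] by (auto simp: holomorphic_on_def intro: field_differentiable_at_within)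

text \<open>The derivation \<open>u d/du\<close> maps the class of these series to itself, and all of them are bounded by
  the sum of the absolute values of their terms on the boundary circles.\<close>

lemma smooth_laurent_series:
  assumes R: "R > 1"
  shows "nrapid R a \<Longrightarrow> nrapid R b \<Longrightarrow> smooth_annulus R j (laurent_series a b)"
proof (induction j arbitrary: a b)
  have bdd: "bounded (laurent_series a b ` annulus R)" if ab: "nrapid R a" "nrapid R b" for a b
  proof (rule boundedI[of _ "(\<Sum>n. cmod (a n) * R ^ n) + (\<Sum>n. cmod (b n) * R ^ n)"], safe)
    fix u assume u: "u \<in> annulus R"
    then have "cmod u \<le> R" "cmod (1 / u) \<le> R" using annulus_inverse[OF R u] by (auto simp: annulus_def)
    then show "cmod (laurent_series a b u) \<le> (\<Sum>n. cmod (a n) * R ^ n) + (\<Sum>n. cmod (b n) * R ^ n)"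
      unfolding laurent_series_def using R ab
      by (intro order_trans[OF norm_triangle_ineq add_mono] pow_series_bound) auto
  qed
  {
    case 0
    then show ?case using bdd laurent_series_holomorphic[OF R] by simp
  next
    case (Suc j)
    have "smooth_annulus R j (\<lambda>u. u * deriv (laurent_series a b) u)
        \<longleftrightarrow> smooth_annulus R j (laurent_series (\<lambda>n. of_nat n * a n) (\<lambda>n. - (of_nat n * b n)))"
      by (rule smooth_annulus_cong) (rule laurent_series_deriv(2)[OF R Suc.prems])
    also have "\<dots>" using R by (intro Suc.IH nrapid_index nrapid_uminus Suc.prems) auto
    finally show ?case using bdd laurent_series_holomorphic[OF R] Suc.prems by simp
  }
qed

lemma continuous_on_laurent_series:
  assumes "R > 1" "nrapid R a" "nrapid R b"
  shows "continuous_on (closed_annulus R) (laurent_series a b)"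
proof -
  let ?A = "closed_annulus R"
  have pos: "0 < 1 / R" using assms(1) by simp
  have nz: "u \<noteq> 0" "cmod (1 / u) \<le> R" if "u \<in> ?A" for u
  proof -
    have "0 < cmod u" using that pos by auto
    then show "u \<noteq> 0" "cmod (1 / u) \<le> R"
      using that assms(1) by (auto simp: norm_divide divide_le_eq mult.commute)
  qed
  have "continuous_on ?A (pow_series a)"
    by (rule continuous_on_subset[OF continuous_on_pow_series[OF assms(2)]]) (use assms in auto)
  moreover have "continuous_on ?A (\<lambda>u. pow_series b (1 / u))"
    by (rule continuous_on_compose2[OF continuous_on_pow_series[OF assms(3)]])
      (use assms nz in \<open>auto intro!: continuous_intros\<close>)
  ultimately show ?thesis
    unfolding laurent_series_def[abs_def] by (rule continuous_on_add)
qed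

lemma laurent_series_sums:
  assumes "nrapid R a" "nrapid R b" "R > 0" "cmod u \<le> R" "cmod (1 / u) \<le> R"
  shows "(\<lambda>n. a n * u ^ n + b n * (1 / u) ^ n) sums laurent_series a b u"
  unfolding laurent_series_def pow_series_def
  by (intro sums_add summable_sums pow_series_summable(2)[of R] assms)

text \<open>On the unit circle the series converges uniformly, so the product may be integrated term by term.\<close>

lemma laurent_coeff_convolution:
  assumes R: "R > 1" and a: "nrapid R a" and f: "f holomorphic_on annulus R"
  shows "(\<lambda>m. a m * (laurent_coeff (k - int m) f + laurent_coeff (k + int m) f))
    sums laurent_coeff k (\<lambda>u. laurent_series a a u * f u)"
proof -
  let ?F = "\<lambda>m u. a m * (f u * u powi (- (k - int m) - 1) + f u * u powi (- (k + int m) - 1))"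
  let ?l = "\<lambda>u. laurent_series a a u * f u * u powi (- k - 1)"
  have int: "(\<lambda>u. f u * u powi j) contour_integrable_on circlepath 0 1" for j
    by (rule integrable_times_powi[OF R f])
  have F_int: "?F m contour_integrable_on circlepath 0 1" for m
    by (intro contour_integrable_lmul contour_integrable_add int)
  have sub: "sphere 0 1 \<subseteq> annulus R" using R by (auto simp: annulus_def)
  obtain B where B: "\<And>u. u \<in> sphere 0 1 \<Longrightarrow> cmod (f u) \<le> B"
  proof -
    have "continuous_on (sphere 0 1) f"
      by (rule continuous_on_subset[OF holomorphic_on_imp_continuous_on[OF f] sub])
    then have "bounded (f ` sphere 0 1)"
      by (intro compact_imp_bounded compact_continuous_image) auto
    then show thesis using that unfolding bounded_iff by blast
  qed
  have ul': "uniform_limit (sphere 0 1) (\<lambda>n u. \<Sum>m<n. ?F m u) (\<lambda>u. \<Sum>m. ?F m u) sequentially"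
  proof (rule Weierstrass_m_test)
    show "summable (\<lambda>m. cmod (a m) * R ^ m * (2 * B))"
      using R by (intro summable_mult2 nrapid_summable[OF a]) auto
    fix m and u :: complex assume u: "u \<in> sphere 0 1"
    have "norm (f u * u powi (- (k - int m) - 1) + f u * u powi (- (k + int m) - 1)) \<le> B + B"
      by (rule order_trans[OF norm_triangle_ineq add_mono]) (use B[OF u] u in \<open>auto simp: norm_mult norm_power_int\<close>)
    then have "norm (?F m u) \<le> cmod (a m) * (2 * B)"
      unfolding norm_mult[of "a m"] by (intro mult_left_mono) auto
    also have "\<dots> \<le> cmod (a m) * R ^ m * (2 * B)"
    proof -
      have "1 \<le> R ^ m" using R by simp
      moreover have "0 \<le> B" using B[OF u] norm_ge_zero[of "f u"] by linarith
      then have "0 \<le> cmod (a m) * (2 * B)" by simp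
      ultimately have "1 * (cmod (a m) * (2 * B)) \<le> R ^ m * (cmod (a m) * (2 * B))" by (intro mult_right_mono)
      then show ?thesis by (simp add: mult_ac)
    qed
    finally show "norm (?F m u) \<le> cmod (a m) * R ^ m * (2 * B)" .
  qed
  have l: "(\<Sum>m. ?F m u) = ?l u" if u: "u \<in> sphere 0 1" for u
  proof -
    have nz: "u \<noteq> 0" using u by auto
    have "(\<lambda>m. (a m * u ^ m + a m * (1 / u) ^ m) * (f u * u powi (- k - 1)))
        sums (laurent_series a a u * (f u * u powi (- k - 1)))"
      by (rule sums_mult2[OF laurent_series_sums[OF a a]]) (use R u in \<open>auto simp: norm_divide\<close>)
    moreover have "(a m * u ^ m + a m * (1 / u) ^ m) * (f u * u powi (- k - 1)) = ?F m u" for m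
    proof -
      have "u powi (- (k - int m) - 1) = u powi (- k - 1) * u ^ m"
        "u powi (- (k + int m) - 1) = u powi (- k - 1) * (1 / u) ^ m"
        using nz power_int_add[of u "- k - 1" "int m"] power_int_diff[of u "- k - 1" "int m"]
        by (simp_all add: algebra_simps power_divide)
      then show ?thesis by (simp add: algebra_simps)
    qed
    ultimately show ?thesis by (simp add: sums_iff mult.assoc)
  qed
  have ul: "uniform_limit (sphere 0 1) (\<lambda>n u. \<Sum>m<n. ?F m u) ?l sequentially"
    by (rule uniform_limit_cong'[THEN iffD1, rotated 2, OF ul']) (rule refl, rule l)
  have "((\<lambda>n. contour_integral (circlepath 0 1) (\<lambda>u. \<Sum>m<n. ?F m u)) \<longlongrightarrow> contour_integral (circlepath 0 1) ?l) sequentially"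
    by (rule contour_integral_uniform_limit_circlepath[OF _ ul])
      (intro always_eventually allI contour_integrable_sum F_int, auto)
  moreover have "contour_integral (circlepath 0 1) (\<lambda>u. \<Sum>m<n. ?F m u) = 
      2 * of_real pi * \<i> * (\<Sum>m<n. a m * (laurent_coeff (k - int m) f + laurent_coeff (k + int m) f))" for n
  proof -
    have "contour_integral (circlepath 0 1) (?F m)
        = 2 * of_real pi * \<i> * (a m * (laurent_coeff (k - int m) f + laurent_coeff (k + int m) f))" for m
      unfolding contour_integral_lmul[OF contour_integrable_add[OF int int]] contour_integral_add[OF int int]
      by (simp add: laurent_coeff_def field_simps)
    then show ?thesis
      by (subst contour_integral_sum) (use F_int in \<open>auto simp: sum_distrib_left\<close>)
  qed
  ultimately have "(\<lambda>n. 2 * of_real pi * \<i> * (\<Sum>m<n. a m * (laurent_coeff (k - int m) f + laurent_coeff (k + int m) f)))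
      \<longlonglongrightarrow> contour_integral (circlepath 0 1) ?l" by simp
  then have "(\<lambda>n. 2 * of_real pi * \<i> * (\<Sum>m<n. a m * (laurent_coeff (k - int m) f + laurent_coeff (k + int m) f)) / (2 * of_real pi * \<i>))
      \<longlonglongrightarrow> contour_integral (circlepath 0 1) ?l / (2 * of_real pi * \<i>)"
    by (intro tendsto_divide tendsto_const) auto
  then show ?thesis by (simp add: sums_def laurent_coeff_def)
qed

lemma resolvent_coeff_bound:
  assumes R: "R > 1" and a: "nrapid R a"
  shows "\<exists>C. \<forall>w \<epsilon> l. 0 < \<epsilon> \<longrightarrow> \<epsilon> \<le> 1 \<longrightarrow> (\<forall>u\<in>annulus R. \<epsilon> \<le> cmod (w - laurent_series a a u)) \<longrightarrow>
    weight R N l * cmod (laurent_coeff l (\<lambda>u. 1 / (w - laurent_series a a u)))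
      \<le> C / \<epsilon> ^ (N + 1)"
proof -
  let ?h = "laurent_series a a"
  let ?c = "\<lambda>w l. laurent_coeff l (\<lambda>u. 1 / (w - ?h u))"
  have "\<exists>C. \<forall>w \<epsilon> n. 0 < \<epsilon> \<longrightarrow> \<epsilon> \<le> 1 \<longrightarrow> (\<forall>u\<in>annulus R. \<epsilon> \<le> cmod (w - ?h u)) \<longrightarrow>
      real_of_int \<bar>n\<bar> ^ N * R ^ nat \<bar>n\<bar> * cmod (?c w n) \<le> C / \<epsilon> ^ (1 + N)" for N
    using laurent_coeff_resolvent_power[OF R smooth_laurent_series[OF R a a] smooth_annulus_const[of R _ 1], of N 1]
    by simp
  then obtain C where C: "\<And>N w \<epsilon> n. 0 < \<epsilon> \<Longrightarrow> \<epsilon> \<le> 1 \<Longrightarrow> (\<forall>u\<in>annulus R. \<epsilon> \<le> cmod (w - ?h u)) \<Longrightarrow>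
      real_of_int \<bar>n\<bar> ^ N * R ^ nat \<bar>n\<bar> * cmod (?c w n) \<le> C N / \<epsilon> ^ (1 + N)"
    by metis
  show ?thesis
  proof (rule exI[of _ "2 ^ N * (\<bar>C 0\<bar> + C N)"], safe)
    fix w \<epsilon> l assume \<epsilon>: "0 < \<epsilon>" "\<epsilon> \<le> 1" "\<forall>u\<in>annulus R. \<epsilon> \<le> cmod (w - ?h u)"
    let ?x = "real_of_int \<bar>l\<bar>" and ?y = "R ^ nat \<bar>l\<bar> * cmod (?c w l)"
    have y0: "0 \<le> ?y" using R by simp
    have "(1 + ?x) ^ N \<le> 2 ^ N * (1 + ?x ^ N)"
    proof (cases "l = 0")
      case False
      then have "1 + ?x \<le> 2 * ?x" by linarith
      then have "(1 + ?x) ^ N \<le> (2 * ?x) ^ N" by (intro power_mono) auto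
      also have "\<dots> \<le> 2 ^ N * (1 + ?x ^ N)" by (simp add: power_mult_distrib)
      finally show ?thesis .
    qed (use one_le_power[of "2::real" N] in \<open>auto simp: power_0_left\<close>)
    then have "(1 + ?x) ^ N * ?y \<le> 2 ^ N * (1 + ?x ^ N) * ?y" using y0 by (rule mult_right_mono)
    also have "\<dots> = 2 ^ N * (?y + ?x ^ N * ?y)" by (simp add: algebra_simps)
    also have "\<dots> \<le> 2 ^ N * (\<bar>C 0\<bar> / \<epsilon> ^ (N + 1) + C N / \<epsilon> ^ (N + 1))"
    proof (intro mult_left_mono add_mono)
      have "?y \<le> C 0 / \<epsilon> ^ (1 + 0)" using C[OF \<epsilon>, of l 0] by simp
      also have "\<dots> \<le> \<bar>C 0\<bar> / \<epsilon> ^ (N + 1)"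
        using \<epsilon> by (intro frac_le power_decreasing) auto
      finally show "?y \<le> \<bar>C 0\<bar> / \<epsilon> ^ (N + 1)" .
      show "?x ^ N * ?y \<le> C N / \<epsilon> ^ (N + 1)" using C[OF \<epsilon>, of l N] by (simp add: mult_ac)
    qed auto
    also have "\<dots> = 2 ^ N * (\<bar>C 0\<bar> + C N) / \<epsilon> ^ (N + 1)"
      by (simp only: add_divide_distrib[symmetric] times_divide_eq_right)
    finally show "(1 + ?x) ^ N * R ^ nat \<bar>l\<bar> * cmod (?c w l) \<le> 2 ^ N * (\<bar>C 0\<bar> + C N) / \<epsilon> ^ (N + 1)"
      by (simp add: mult_ac)
  qed
qed

text \<open>This is \<open>h / (w - h) = w / (w - h) - 1\<close> in terms of Laurent coefficients.\<close>

lemma resolvent_coeff_convolution: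
  assumes R: "R > 1" and a: "nrapid R a" and \<epsilon>: "0 < \<epsilon>" "\<forall>u\<in>annulus R. \<epsilon> \<le> cmod (w - laurent_series a a u)"
  defines "c \<equiv> \<lambda>l. laurent_coeff l (\<lambda>u. 1 / (w - laurent_series a a u))"
  shows "(\<lambda>m. a m * (c (k - int m) + c (k + int m))) sums (w * c k - (if k = 0 then 1 else 0))"
proof -
  let ?h = "laurent_series a a"
  have nz: "w - ?h u \<noteq> 0" if "u \<in> annulus R" for u using \<epsilon> that by force
  have hol: "(\<lambda>u. 1 / (w - ?h u)) holomorphic_on annulus R"
    using nz laurent_series_holomorphic[OF R a a] by (intro holomorphic_intros) auto
  have "laurent_coeff k (\<lambda>u. ?h u * (1 / (w - ?h u)))
      = laurent_coeff k (\<lambda>u. w * (1 / (w - ?h u)) + (-1) * 1)"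
    by (rule laurent_coeff_cong) (use nz R in \<open>auto simp: annulus_def field_simps\<close>)
  also have "\<dots> = w * c k - laurent_coeff k (\<lambda>u. 1)"
    using hol unfolding c_def
    using laurent_coeff_add[OF R, of "\<lambda>u. w * (1 / (w - ?h u))" "\<lambda>u. (-1) * 1" k]
      laurent_coeff_scale[OF R hol, of k w] laurent_coeff_scale[OF R holomorphic_on_const[of 1], of k "-1"]
      holomorphic_on_mult[OF holomorphic_on_const[of w] hol]
    by simp
  finally show ?thesis
    using laurent_coeff_convolution[OF R a hol, of k] by (simp add: c_def laurent_coeff_1)
qed

section \<open>Bounded sequences with finite unimodular spectrum\<close>

text \<open>On the circle \<open>cmod (w - \<alpha>) = \<rho>\<close> the conjugate of \<open>w\<close> is a rational function of \<open>w\<close>; clearing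
  denominators, the defect \<open>(cmod w)\<^sup>2 - 1\<close> becomes the modulus of a polynomial in \<open>w\<close>, up to a
  constant. This supplies a holomorphic factor that is as small as the distance from the unit circle.\<close>

lemma unit_circle_defect:
  assumes "cmod \<alpha> = 1" "cmod (w - \<alpha>) = \<rho>"
  shows "cmod ((w - \<alpha>) ^ 2 + of_real (\<rho> ^ 2) * (\<alpha> * w)) = \<rho> * \<bar>(cmod w) ^ 2 - 1\<bar>"
proof -
  have a: "\<alpha> * cnj \<alpha> = 1" using assms(1) by (simp add: complex_norm_square[symmetric])
  have r: "of_real (\<rho> ^ 2) = (w - \<alpha>) * cnj (w - \<alpha>)"
    using assms(2) by (metis complex_norm_square)
  have "(w - \<alpha>) ^ 2 + of_real (\<rho> ^ 2) * (\<alpha> * w) = (w - \<alpha>) * ((w - \<alpha>) + \<alpha> * w * cnj (w - \<alpha>))"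
    unfolding r by (simp add: power2_eq_square algebra_simps)
  also have "(w - \<alpha>) + \<alpha> * w * cnj (w - \<alpha>) = \<alpha> * (w * cnj w) - w * (\<alpha> * cnj \<alpha>) + w - \<alpha>"
    by (simp add: algebra_simps)
  also have "\<dots> = \<alpha> * of_real ((cmod w) ^ 2 - 1)"
    unfolding a by (simp add: complex_norm_square[symmetric] algebra_simps)
  finally show ?thesis using assms by (simp add: norm_mult del: of_real_diff)
qed

text \<open>Near \<open>\<alpha>\<close> nothing is known about \<open>G\<close> on the unit circle itself. Multiplied by the \<open>N\<close>th power of the
  polynomial of the preceding lemma, \<open>G\<close> is bounded on the circle of radius \<open>\<rho>\<close>, so the integral is
  \<open>O(\<rho>)\<close>. The contour can be kept fixed instead, where the polynomial tends to \<open>(w - \<alpha>)\<^sup>2\<close> as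
  \<open>\<rho> \<rightarrow> 0\<close>. Thus \<open>G\<close> has a pole of order at most \<open>2 N\<close>.\<close>

lemma residue_eq_0_of_growth:
  assumes \<alpha>: "cmod \<alpha> = 1" and e: "0 < e" and N: "N \<noteq> 0"
    and G: "G holomorphic_on ball \<alpha> e - {\<alpha>}" and F: "F holomorphic_on ball \<alpha> e"
    and growth: "\<And>w. w \<in> ball \<alpha> e \<Longrightarrow> cmod w \<noteq> 1 \<Longrightarrow> \<bar>cmod w - 1\<bar> ^ N * cmod (G w) \<le> C"
  shows "residue (\<lambda>w. (w - \<alpha>) ^ (2 * N) * (F w * G w)) \<alpha> = 0"
proof -
  define r where "r = min 1 (e / 2)"
  have r: "0 < r" "r < e" "r \<le> 1" using e by (auto simp: r_def min_def)
  define T where "T k w = (w - \<alpha>) ^ (2 * (N - k)) * (\<alpha> * w) ^ k * (F w * G w)" for k w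
  define J where "J k = contour_integral (circlepath \<alpha> r) (T k)" for k
  have T_hol: "T k holomorphic_on ball \<alpha> e - {\<alpha>}" for k
    unfolding T_def[abs_def] by (intro holomorphic_intros G holomorphic_on_subset[OF F]) auto
  have T_int: "T k contour_integrable_on circlepath \<alpha> \<rho>" if "0 < \<rho>" "\<rho> < e" for k \<rho>
    by (rule contour_integrable_holomorphic_simple[OF T_hol])
      (use that in \<open>auto simp: dist_norm norm_minus_commute\<close>)
  have circ: "contour_integral (circlepath \<alpha> \<rho>) (T k) = J k" if "0 < \<rho>" "\<rho> \<le> r" for \<rho> k
    unfolding J_def
    by (rule contour_integral_circlepath_eq(3)[OF open_ball T_hol, symmetric]) (use that r in auto)
  define Q where "Q \<rho> w = ((w - \<alpha>) ^ 2 + of_real (\<rho> ^ 2) * (\<alpha> * w)) ^ N * (F w * G w)" for \<rho> w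
  \<comment> \<open>Expanding the power turns the integral into a polynomial in \<open>\<rho>\<close> with coefficients \<open>J k\<close>, whose
    limit at \<open>0\<close> is \<open>J 0\<close>.\<close>
  have Q_T: "Q \<rho> w = (\<Sum>k\<le>N. of_nat (N choose k) * of_real \<rho> ^ (2 * k) * T k w)" for \<rho> w
  proof -
    have "(of_real (\<rho> ^ 2) * (\<alpha> * w) + (w - \<alpha>) ^ 2) ^ N
      = (\<Sum>k\<le>N. of_nat (N choose k) * (of_real (\<rho> ^ 2) * (\<alpha> * w)) ^ k * ((w - \<alpha>) ^ 2) ^ (N - k))"
      by (rule binomial_ring)
    then have "Q \<rho> w
      = (\<Sum>k\<le>N. of_nat (N choose k) * (of_real (\<rho> ^ 2) * (\<alpha> * w)) ^ k * ((w - \<alpha>) ^ 2) ^ (N - k) * (F w * G w))"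
      unfolding Q_def by (simp only: add.commute sum_distrib_right)
    also have "\<dots> = (\<Sum>k\<le>N. of_nat (N choose k) * of_real \<rho> ^ (2 * k) * T k w)"
      unfolding T_def by (rule sum.cong[OF refl]) (simp only: power_mult_distrib power_mult[symmetric] of_real_power mult_ac)
    finally show ?thesis .
  qed
  have int_Q: "(Q \<rho> has_contour_integral (\<Sum>k\<le>N. of_nat (N choose k) * of_real \<rho> ^ (2 * k) * J k)) (circlepath \<alpha> \<rho>)"
    if "0 < \<rho>" "\<rho> \<le> r" for \<rho>
    unfolding Q_T[abs_def] circ[OF that, symmetric]
    by (intro has_contour_integral_sum has_contour_integral_lmul has_contour_integral_integral T_int)
      (use that r in auto)
  obtain B where B: "\<And>w. w \<in> cball \<alpha> r \<Longrightarrow> cmod (F w) \<le> B"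
  proof -
    have "cball \<alpha> r \<subseteq> ball \<alpha> e" using r by auto
    then have "bounded (F ` cball \<alpha> r)"
      using holomorphic_on_imp_continuous_on[OF F]
      by (intro compact_imp_bounded compact_continuous_image) (auto intro: continuous_on_subset)
    then show thesis using that unfolding bounded_iff by blast
  qed
  have B0: "0 \<le> B" using order_trans[OF norm_ge_zero B[of \<alpha>]] r by simp
  have C0: "0 \<le> C"
  proof -
    have "of_real (1 + r) * \<alpha> \<in> ball \<alpha> e"
      using r \<alpha> by (simp add: dist_norm algebra_simps norm_mult)
    moreover have "cmod (of_real (1 + r) * \<alpha>) = 1 + r" using r \<alpha> by (simp add: norm_mult del: of_real_add)
    ultimately have "\<bar>1 + r - 1\<bar> ^ N * cmod (G (of_real (1 + r) * \<alpha>)) \<le> C"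
      using growth[of "of_real (1 + r) * \<alpha>"] r by simp
    then show ?thesis using r by (meson mult_nonneg_nonneg norm_ge_zero order_trans zero_le_power abs_ge_zero)
  qed
  have bound: "cmod (\<Sum>k\<le>N. of_nat (N choose k) * of_real \<rho> ^ (2 * k) * J k) \<le> 3 ^ N * B * C * (2 * pi * \<rho>)"
    if \<rho>: "0 < \<rho>" "\<rho> \<le> r" for \<rho>
  proof (rule has_contour_integral_bound_circlepath[OF int_Q[OF \<rho>]])
    fix w assume w: "cmod (w - \<alpha>) = \<rho>"
    then have wb: "w \<in> ball \<alpha> e" "w \<in> cball \<alpha> r" using \<rho> r by (auto simp: dist_norm norm_minus_commute)
    have "cmod w \<le> cmod \<alpha> + cmod (w - \<alpha>)" by (metis add.commute diff_add_cancel norm_triangle_ineq)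
    then have w2: "cmod w \<le> 2" using w \<rho> r \<alpha> by simp
    have "\<rho> * \<bar>(cmod w)\<^sup>2 - 1\<bar> = \<rho> * ((cmod w + 1) * \<bar>cmod w - 1\<bar>)"
    proof -
      have "(cmod w)\<^sup>2 - 1 = (cmod w + 1) * (cmod w - 1)" by (simp add: power2_eq_square algebra_simps)
      then show ?thesis by (simp add: abs_mult)
    qed
    also have "\<dots> \<le> 1 * (3 * \<bar>cmod w - 1\<bar>)"
      using \<rho> r w2 by (intro mult_mono) auto
    finally have "\<rho> * \<bar>(cmod w)\<^sup>2 - 1\<bar> \<le> 3 * \<bar>cmod w - 1\<bar>" by simp
    then have "(\<rho> * \<bar>(cmod w)\<^sup>2 - 1\<bar>) ^ N \<le> (3 * \<bar>cmod w - 1\<bar>) ^ N" using \<rho> by (intro power_mono) auto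
    then have "cmod (Q \<rho> w) \<le> (3 * \<bar>cmod w - 1\<bar>) ^ N * (cmod (F w) * cmod (G w))"
      unfolding Q_def norm_mult norm_power unit_circle_defect[OF \<alpha> w] by (intro mult_right_mono) auto
    also have "\<dots> = 3 ^ N * cmod (F w) * (\<bar>cmod w - 1\<bar> ^ N * cmod (G w))"
      by (simp add: power_mult_distrib mult_ac)
    also have "\<dots> \<le> 3 ^ N * B * C"
    proof (intro mult_mono)
      show "\<bar>cmod w - 1\<bar> ^ N * cmod (G w) \<le> C"
        using growth[OF wb(1)] C0 N by (cases "cmod w = 1") (auto simp: power_0_left)
    qed (use B[OF wb(2)] B0 in auto)
    finally show "cmod (Q \<rho> w) \<le> 3 ^ N * B * C" .
  qed (use \<rho> B0 C0 in auto)
  have "((\<lambda>\<rho>. cmod (\<Sum>k\<le>N. of_nat (N choose k) * of_real \<rho> ^ (2 * k) * J k)) \<longlongrightarrow>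
      cmod (\<Sum>k\<le>N. of_nat (N choose k) * of_real 0 ^ (2 * k) * J k)) (at_right 0)"
    by (intro tendsto_intros)
  moreover have "((\<lambda>\<rho>. 3 ^ N * B * C * (2 * pi * \<rho>)) \<longlongrightarrow> 3 ^ N * B * C * (2 * pi * 0)) (at_right 0)"
    by (intro tendsto_intros)
  moreover have "eventually (\<lambda>\<rho>. cmod (\<Sum>k\<le>N. of_nat (N choose k) * of_real \<rho> ^ (2 * k) * J k)
      \<le> 3 ^ N * B * C * (2 * pi * \<rho>)) (at_right 0)"
    using eventually_at_right_real[OF r(1)] by eventually_elim (auto intro!: bound)
  ultimately have "cmod (\<Sum>k\<le>N. of_nat (N choose k) * of_real 0 ^ (2 * k) * J k) \<le> 3 ^ N * B * C * (2 * pi * 0)"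
    using tendsto_le[of "at_right (0::real)"] trivial_limit_at_right_real by blast
  moreover have "(\<Sum>k\<le>N. of_nat (N choose k) * of_real 0 ^ (2 * k) * J k) = J 0"
    by (subst sum.remove[of _ 0]) (auto simp: power_0_left)
  ultimately have "J 0 = 0" by simp
  moreover have "(T 0 has_contour_integral 2 * of_real pi * \<i> * residue (T 0) \<alpha>) (circlepath \<alpha> r)"
  proof -
    have "\<alpha> \<in> ball \<alpha> e" "cball \<alpha> r \<subseteq> ball \<alpha> e" using e r by auto
    from base_residue[OF open_ball this(1) r(1) T_hol[of 0] this(2)] show ?thesis by simp
  qed
  then have "J 0 = 2 * of_real pi * \<i> * residue (T 0) \<alpha>"
    unfolding J_def by (rule contour_integral_unique)
  ultimately show ?thesis by (simp add: T_def[abs_def])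
qed

lemma lagrange_polynomials:
  fixes Z :: "complex set"
  assumes "finite Z"
  shows "\<exists>lag. \<forall>\<alpha>\<in>Z. \<forall>\<beta>\<in>Z. poly (lag \<alpha>) \<beta> = (if \<alpha> = \<beta> then 1 else 0)"
proof -
  define lag where "lag \<alpha> = (\<Prod>\<gamma>\<in>Z - {\<alpha>}. smult (1 / (\<alpha> - \<gamma>)) [:- \<gamma>, 1:])" for \<alpha>
  have "poly (lag \<alpha>) \<beta> = (if \<alpha> = \<beta> then 1 else 0)" if "\<alpha> \<in> Z" "\<beta> \<in> Z" for \<alpha> \<beta>
  proof (cases "\<alpha> = \<beta>")
    case True
    have one: "1 / x * - \<gamma> + \<beta> * (1 / x) = 1" if "x = \<beta> - \<gamma>" "x \<noteq> 0" for x \<gamma>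
    proof -
      have "1 / x * - \<gamma> + \<beta> * (1 / x) = (\<beta> - \<gamma>) / x" by (simp add: diff_divide_distrib)
      then show ?thesis using that by simp
    qed
    have "poly (smult (1 / (\<beta> - \<gamma>)) [:- \<gamma>, 1:]) \<beta> = 1" if "\<gamma> \<in> Z - {\<beta>}" for \<gamma>
      using one[OF refl, of \<gamma>] that by (auto simp: algebra_simps)
    then show ?thesis unfolding True lag_def poly_prod by (simp del: poly_smult poly_pCons)
  next
    case False
    then have "(\<Prod>\<gamma>\<in>Z - {\<alpha>}. poly (smult (1 / (\<alpha> - \<gamma>)) [:- \<gamma>, 1:]) \<beta>) = 0"
      using assms that by (intro prod_zero bexI[of _ \<beta>]) auto
    then show ?thesis using False by (simp add: lag_def poly_prod)
  qed
  then show ?thesis by blast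
qed

lemma prod_roots_dvd:
  fixes P :: "complex poly"
  assumes "finite Z" "\<And>\<alpha>. \<alpha> \<in> Z \<Longrightarrow> poly P \<alpha> = 0"
  shows "(\<Prod>\<alpha>\<in>Z. [:- \<alpha>, 1:]) dvd P"
  using assms
proof (induction Z arbitrary: P rule: finite_induct)
  case (insert \<beta> Z)
  then obtain P' where P': "P = [:- \<beta>, 1:] * P'" by (metis poly_eq_0_iff_dvd dvd_def insertI1)
  have "poly P' \<alpha> = 0" if "\<alpha> \<in> Z" for \<alpha>
    using insert.prems[of \<alpha>] insert.hyps that by (auto simp: P')
  then have "(\<Prod>\<alpha>\<in>Z. [:- \<alpha>, 1:]) dvd P'" by (rule insert.IH)
  then show ?case using insert.hyps by (simp add: P' mult_dvd_mono del: mult_pCons_left)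
qed auto

text \<open>A bounded sequence annihilated by \<open>(x - \<alpha>)\<^sup>2\<close> with \<open>cmod \<alpha> = 1\<close> is already annihilated by
  \<open>x - \<alpha>\<close>, because the general solution \<open>\<alpha>\<^sup>n (v + n c)\<close> of the recurrence is unbounded unless \<open>c = 0\<close>.\<close>

lemma bounded_double_root:
  fixes v :: "nat \<Rightarrow> complex"
  assumes \<alpha>: "cmod \<alpha> = 1" and rec: "\<And>n. v (n + 2) - 2 * \<alpha> * v (n + 1) + \<alpha> ^ 2 * v n = 0"
    and bdd: "\<And>n. cmod (v n) \<le> B"
  shows "v 1 - \<alpha> * v 0 = 0"
proof (rule ccontr)
  define c where "c = v 1 - \<alpha> * v 0"
  assume "v 1 - \<alpha> * v 0 \<noteq> 0"
  then have c: "cmod c > 0" by (simp add: c_def)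
  have step: "v (n + 1) = \<alpha> * v n + \<alpha> ^ n * c" for n
  proof (induction n)
    case (Suc n)
    have "v (n + 2) = \<alpha> * v (n + 1) + \<alpha> * (v (n + 1) - \<alpha> * v n)"
      using rec[of n] by (simp add: algebra_simps power2_eq_square)
    then show ?case using Suc by simp
  qed (simp add: c_def)
  have sol: "\<alpha> * v n = \<alpha> ^ n * (\<alpha> * v 0 + of_nat n * c)" for n
  proof (induction n)
    case (Suc n)
    then show ?case using step[of n] by (simp add: algebra_simps)
  qed simp
  obtain n :: nat where n: "2 * B < real n * cmod c" using c reals_Archimedean3 by blast
  have "real n * cmod c = cmod ((\<alpha> * v 0 + of_nat n * c) - \<alpha> * v 0)" by (simp add: norm_mult)
  also have "\<dots> \<le> cmod (\<alpha> * v 0 + of_nat n * c) + cmod (\<alpha> * v 0)" by (rule norm_triangle_ineq4)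
  also have "cmod (\<alpha> * v 0 + of_nat n * c) = cmod (v n)"
    using arg_cong[OF sol[of n], of cmod] \<alpha> by (simp add: norm_mult norm_power)
  finally show False using n bdd[of n] bdd[of 0] \<alpha> by (simp add: norm_mult)
qed

text \<open>The generating function \<open>G\<close> of the sequence has only finitely many singularities, all on the unit
  circle, and by the growth bounds they are at worst poles. The functional \<open>L\<close> that integrates a polynomial against
  \<open>G\<close> around all of them sends \<open>x\<^sup>n\<close> to \<open>t n\<close>, and it kills every multiple of a high power of
  \<open>\<Prod>(x - \<alpha>)\<close>. Boundedness of the sequence brings the power down to \<open>1\<close>, and interpolating \<open>x\<^sup>n\<close> at
  the points of \<open>Z\<close> gives the formula.\<close>

theorem bounded_sequence_finite_spectrum:
  fixes t :: "nat \<Rightarrow> complex"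
  assumes Z: "finite Z" "\<And>\<alpha>. \<alpha> \<in> Z \<Longrightarrow> cmod \<alpha> = 1"
    and t: "\<And>n. cmod (t n) \<le> B"
    and G: "G holomorphic_on - Z"
    and G_out: "\<And>w. 1 < cmod w \<Longrightarrow> (\<lambda>n. t n / w ^ Suc n) sums G w"
    and G_in: "\<And>w. cmod w < 1 \<Longrightarrow> (1 - cmod w) ^ N * cmod (G w) \<le> C"
  shows "\<exists>c. \<forall>n. t n = (\<Sum>\<alpha>\<in>Z. c \<alpha> * \<alpha> ^ n)"
proof -
  define M where "M = Suc N"
  have B0: "0 \<le> B" using t[of 0] norm_ge_zero order_trans by blast
  have out_bound: "(cmod w - 1) * cmod (G w) \<le> B" if w: "1 < cmod w" for w
  proof -
    have s: "(\<lambda>n. B / cmod w * (1 / cmod w) ^ n) sums (B / cmod w * (1 / (1 - 1 / cmod w)))"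
      using w by (intro sums_mult geometric_sums) (simp add: norm_divide divide_less_eq)
    have le: "norm (t n / w ^ Suc n) \<le> B / cmod w * (1 / cmod w) ^ n" for n
    proof -
      have "norm (t n / w ^ Suc n) = cmod (t n) / cmod w ^ Suc n" by (simp only: norm_divide norm_power)
      also have "\<dots> \<le> B / cmod w ^ Suc n" using t[of n] by (intro divide_right_mono) auto
      finally show ?thesis by (simp add: power_divide)
    qed
    have "cmod (G w) \<le> B / cmod w * (1 / (1 - 1 / cmod w))"
      using norm_suminf_le[OF le sums_summable[OF s]] sums_unique[OF G_out[OF w]] sums_unique[OF s] by simp
    also have "\<dots> = B / (cmod w - 1)"
    proof -
      have "w \<noteq> 0" using w by auto
      then show ?thesis using w by (simp add: field_simps)
    qed
    finally show ?thesis using w by (simp add: field_simps)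
  qed
  \<comment> \<open>The exponent \<open>N + 1\<close> serves both sides: outside the unit disc the growth is of order \<open>1\<close>, and for
    \<open>cmod w \<le> 2\<close> higher powers of the distance only help.\<close>
  have growth: "\<bar>cmod w - 1\<bar> ^ M * cmod (G w) \<le> max B C" if w: "cmod w \<noteq> 1" "cmod w \<le> 2" for w
  proof (cases "cmod w < 1")
    case True
    have "\<bar>cmod w - 1\<bar> ^ M * cmod (G w) \<le> (1 - cmod w) ^ N * cmod (G w)"
      using True power_decreasing[of N M "1 - cmod w"] by (intro mult_right_mono) (auto simp: M_def)
    then show ?thesis using G_in[OF True] by simp
  next
    case False
    have "\<bar>cmod w - 1\<bar> ^ M * cmod (G w) \<le> (cmod w - 1) * cmod (G w)"
      using False w power_decreasing[of 1 M "cmod w - 1"] by (intro mult_right_mono) (auto simp: M_def)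
    then show ?thesis using out_bound[of w] False w by simp
  qed
  define g where "g = circlepath 0 (2 :: real)"
  have g: "valid_path g" "path_image g \<subseteq> - Z" "pathfinish g = pathstart g"
    using Z(2) by (force simp: g_def)+
  define L where "L P = contour_integral g (\<lambda>w. poly P w * G w) / (2 * of_real pi * \<i>)" for P
  have PG_int: "(\<lambda>w. poly P w * G w) contour_integrable_on g" for P
    by (rule contour_integrable_holomorphic_simple[of _ "- Z"])
      (use Z g in \<open>auto intro!: holomorphic_intros G finite_imp_closed open_Compl\<close>)
  have L_add: "L (P + Q) = L P + L Q" for P Q
    using contour_integral_add[OF PG_int[of P] PG_int[of Q]]
    by (simp add: L_def distrib_right add_divide_distrib)
  have L_smult: "L (smult c P) = c * L P" for c P
    using contour_integral_lmul[OF PG_int[of P], of c] by (simp add: L_def mult.assoc)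
  have L_diff: "L (P - Q) = L P - L Q" for P Q
    using L_add[of P "- Q"] L_smult[of "-1" Q] by simp
  have L_0: "L 0 = 0" using L_smult[of 0 0] by simp
  have L_sum: "L (\<Sum>i\<in>I. P i) = (\<Sum>i\<in>I. L (P i))" for I :: "complex set" and P
    by (induction I rule: infinite_finite_induct) (auto simp: L_add L_0)
  have L_monom: "L (monom 1 n) = t n" for n
  proof -
    let ?f = "\<lambda>i w. t i * (1 * w powi (- (int i - int n) - 1))"
    have f_sums: "(\<lambda>i. ?f i w) sums (poly (monom 1 n) w * G w)" and f_le: "norm (?f i w) \<le> B * 2 ^ n * (1 / 2) ^ i"
      if w: "w \<in> sphere 0 2" for w i
    proof -
      have w0: "w \<noteq> 0" "1 < cmod w" using w by auto
      have e: "w powi (- (int i - int n) - 1) = w ^ n / w ^ Suc i" for i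
      proof -
        have k: "- (int i - int n) - 1 = int n - int (Suc i)" by simp
        have "w powi (int n - int (Suc i)) = w powi int n / w powi int (Suc i)"
          by (rule power_int_diff) (use w0 in auto)
        then show ?thesis unfolding k by (simp only: power_int_of_nat)
      qed
      show "(\<lambda>i. ?f i w) sums (poly (monom 1 n) w * G w)"
        using sums_mult[OF G_out[OF w0(2)], of "w ^ n"] unfolding e by (simp add: poly_monom mult_ac)
      have "norm (?f i w) = cmod (t i) * (2 ^ n / 2 ^ Suc i)"
        using w unfolding e by (simp add: norm_mult norm_divide norm_power)
      also have "\<dots> \<le> B * (2 ^ n / 2 ^ i)"
        using t[of i] B0 by (intro mult_mono frac_le) auto
      finally show "norm (?f i w) \<le> B * 2 ^ n * (1 / 2) ^ i" by (simp add: power_divide)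
    qed
    have ul': "uniform_limit (sphere 0 2) (\<lambda>k w. \<Sum>i<k. ?f i w) (\<lambda>w. \<Sum>i. ?f i w) sequentially"
      by (rule Weierstrass_m_test[OF f_le]) (auto intro!: summable_mult)
    have ul: "uniform_limit (sphere 0 2) (\<lambda>k w. \<Sum>i<k. ?f i w) (\<lambda>w. poly (monom 1 n) w * G w) sequentially"
      by (rule uniform_limit_cong'[THEN iffD1, rotated 2, OF ul']) (rule refl, rule sums_unique[OF f_sums, symmetric])
    have f_int: "?f i contour_integrable_on g" for i
      by (rule contour_integrable_holomorphic_simple[of _ "- {0}"])
        (use g in \<open>auto intro!: holomorphic_intros simp: g_def\<close>)
    have f_val: "contour_integral g (?f i) = 2 * of_real pi * \<i> * (if i = n then t n else 0)" for i
    proof -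
      have int: "(\<lambda>w. 1 * w powi (- (int i - int n) - 1)) contour_integrable_on g"
        by (rule contour_integrable_holomorphic_simple[of _ "- {0}"])
          (use g in \<open>auto intro!: holomorphic_intros simp: g_def\<close>)
      show ?thesis
        using laurent_coeff_circle[of 3 "\<lambda>_. 1" 2 "int i - int n"] laurent_coeff_1[of "int i - int n"]
        by (subst contour_integral_lmul[OF int]) (auto simp: g_def split: if_splits)
    qed
    have "((\<lambda>k. contour_integral g (\<lambda>w. \<Sum>i<k. ?f i w)) \<longlongrightarrow> contour_integral g (\<lambda>w. poly (monom 1 n) w * G w)) sequentially"
      unfolding g_def by (rule contour_integral_uniform_limit_circlepath[OF _ ul])
        (intro always_eventually allI contour_integrable_sum f_int[unfolded g_def], auto)
    moreover have "eventually (\<lambda>k. contour_integral g (\<lambda>w. \<Sum>i<k. ?f i w) = 2 * of_real pi * \<i> * t n) sequentially"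
      using eventually_gt_at_top[of n]
    proof eventually_elim
      case (elim k)
      have "contour_integral g (\<lambda>w. \<Sum>i<k. ?f i w) = (\<Sum>i<k. contour_integral g (?f i))"
        by (rule contour_integral_sum) (rule finite_lessThan f_int)+
      also have "\<dots> = 2 * of_real pi * \<i> * t n"
        unfolding f_val sum_distrib_left[symmetric] using elim by simp
      finally show ?case .
    qed
    ultimately have "contour_integral g (\<lambda>w. poly (monom 1 n) w * G w) = 2 * of_real pi * \<i> * t n"
      by (rule LIMSEQ_unique[OF _ tendsto_eventually])
    then show ?thesis by (simp add: L_def)
  qed
  define kills where "kills P \<longleftrightarrow> (\<forall>Y. L (P * Y) = 0)" for P
  have kills_big: "kills (\<Prod>\<alpha>\<in>Z. [:- \<alpha>, 1:] ^ (2 * M))"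
    unfolding kills_def
  proof
    fix Y
    let ?P = "\<Prod>\<alpha>\<in>Z. [:- \<alpha>, 1:] ^ (2 * M)"
    have "residue (\<lambda>w. poly (?P * Y) w * G w) \<alpha> = 0" if \<alpha>: "\<alpha> \<in> Z" for \<alpha>
    proof -
      obtain e where e: "0 < e" "\<And>x. x \<in> Z \<Longrightarrow> x \<noteq> \<alpha> \<Longrightarrow> e \<le> dist \<alpha> x"
        using finite_set_avoid[OF Z(1), of \<alpha>] by blast
      define F where "F = poly ((\<Prod>\<beta>\<in>Z - {\<alpha>}. [:- \<beta>, 1:] ^ (2 * M)) * Y)"
      have eq: "poly (?P * Y) w * G w = (w - \<alpha>) ^ (2 * M) * (F w * G w)" for w
        using \<alpha> Z(1) by (simp add: F_def prod.remove[of Z \<alpha>] mult_ac)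
      have "residue (\<lambda>w. (w - \<alpha>) ^ (2 * M) * (F w * G w)) \<alpha> = 0"
      proof (rule residue_eq_0_of_growth[where e = "min e 1" and C = "max B C"])
        show "G holomorphic_on ball \<alpha> (min e 1) - {\<alpha>}"
          by (rule holomorphic_on_subset[OF G]) (use e(2) in force)
        fix w assume w: "w \<in> ball \<alpha> (min e 1)" "cmod w \<noteq> 1"
        have "cmod w \<le> cmod \<alpha> + cmod (w - \<alpha>)" by (metis add.commute diff_add_cancel norm_triangle_ineq)
        then show "\<bar>cmod w - 1\<bar> ^ M * cmod (G w) \<le> max B C"
          using w Z(2)[OF \<alpha>] by (intro growth) (auto simp: dist_norm norm_minus_commute)
      qed (use e Z(2)[OF \<alpha>] in \<open>auto simp: M_def F_def intro!: holomorphic_intros\<close>)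
      then show ?thesis unfolding eq .
    qed
    moreover have "contour_integral g (\<lambda>w. poly (?P * Y) w * G w)
        = 2 * of_real pi * \<i> * (\<Sum>\<alpha>\<in>Z. winding_number g \<alpha> * residue (\<lambda>w. poly (?P * Y) w * G w) \<alpha>)"
    proof -
      have "(\<lambda>w. poly (?P * Y) w * G w) holomorphic_on UNIV - Z"
        by (intro holomorphic_intros holomorphic_on_subset[OF G]) auto
      from Residue_theorem[OF open_UNIV connected_UNIV Z(1) this g(1) g(3)] g(2)
      show ?thesis by (simp add: Compl_eq_Diff_UNIV del: poly_mult)
    qed
    ultimately show "L (?P * Y) = 0" by (simp add: L_def del: poly_mult)
  qed
  \<comment> \<open>Iterating multiplication by \<open>x\<close> shifts the sequence, which is bounded.\<close>
  have L_bdd: "\<exists>b. \<forall>n. cmod (L (Y * monom 1 n)) \<le> b" for Y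
  proof (induction Y)
    case 0
    then show ?case using L_0 by (intro exI[of _ 0]) simp
  next
    case (pCons a Y)
    then obtain b where b: "\<And>n. cmod (L (Y * monom 1 n)) \<le> b" by blast
    have "cmod (L (pCons a Y * monom 1 n)) \<le> cmod a * B + b" for n
    proof -
      have "pCons a Y * monom 1 n = smult a (monom 1 n) + Y * monom 1 (Suc n)"
        by (simp add: monom_Suc)
      then have "L (pCons a Y * monom 1 n) = a * t n + L (Y * monom 1 (Suc n))"
        by (simp only: L_add L_smult L_monom)
      then show ?thesis
        using norm_triangle_ineq[of "a * t n" "L (Y * monom 1 (Suc n))"] b[of "Suc n"]
          mult_left_mono[OF t[of n], of "cmod a"] by (simp add: norm_mult)
    qed
    then show ?case by blast
  qed
  have kills_square: "kills ([:- \<alpha>, 1:] * P)" if k: "kills ([:- \<alpha>, 1:] ^ 2 * P)" and \<alpha>: "\<alpha> \<in> Z" for \<alpha> P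
    unfolding kills_def
  proof
    fix Y
    define v where "v n = L (P * Y * monom 1 n)" for n
    obtain b where b: "\<And>n. cmod (v n) \<le> b" using L_bdd unfolding v_def by blast
    have "v (n + 2) - 2 * \<alpha> * v (n + 1) + \<alpha> ^ 2 * v n = 0" for n
    proof -
      have "[:- \<alpha>, 1:] ^ 2 * P * (Y * monom 1 n) = P * Y * monom 1 (n + 2)
          - smult (2 * \<alpha>) (P * Y * monom 1 (n + 1)) + smult (\<alpha> ^ 2) (P * Y * monom 1 n)"
        unfolding poly_eq_poly_eq_iff[symmetric]
        by (rule ext) (simp add: poly_monom power2_eq_square algebra_simps)
      then show ?thesis using k unfolding kills_def v_def
        by (metis L_add L_diff L_smult)
    qed
    then have "v 1 - \<alpha> * v 0 = 0" by (rule bounded_double_root[OF Z(2)[OF \<alpha>] _ b])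
    moreover have "[:- \<alpha>, 1:] * P * Y = P * Y * monom 1 1 - smult \<alpha> (P * Y * monom 1 0)"
      by (simp add: monom_Suc algebra_simps)
    ultimately show "L ([:- \<alpha>, 1:] * P * Y) = 0" unfolding v_def by (simp only: L_diff L_smult)
  qed
  have kills_power: "kills ([:- \<alpha>, 1:] ^ Suc k * P) \<Longrightarrow> kills ([:- \<alpha>, 1:] * P)" if "\<alpha> \<in> Z" for \<alpha> P k
  proof (induction k)
    case (Suc k)
    have "[:- \<alpha>, 1:] ^ Suc (Suc k) * P = [:- \<alpha>, 1:] ^ 2 * ([:- \<alpha>, 1:] ^ k * P)"
      by (simp only: power_Suc power2_eq_square mult_ac)
    with Suc.prems have "kills ([:- \<alpha>, 1:] ^ 2 * ([:- \<alpha>, 1:] ^ k * P))" by (simp only:)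
    from kills_square[OF this that] have "kills ([:- \<alpha>, 1:] * ([:- \<alpha>, 1:] ^ k * P))" .
    then show ?case using Suc.IH by (simp only: power_Suc mult_ac)
  qed simp
  have kills_prod: "kills (P * (\<Prod>\<alpha>\<in>W. [:- \<alpha>, 1:] ^ Suc k)) \<Longrightarrow> kills (P * (\<Prod>\<alpha>\<in>W. [:- \<alpha>, 1:]))"
    if "finite W" "W \<subseteq> Z" for W P k
    using that
  proof (induction W arbitrary: P rule: finite_induct)
    case (insert \<beta> W)
    from insert.prems(1) have "kills ((P * [:- \<beta>, 1:] ^ Suc k) * (\<Prod>\<alpha>\<in>W. [:- \<alpha>, 1:] ^ Suc k))"
      using insert.hyps by (simp add: mult.assoc del: power_Suc mult_pCons_left mult_pCons_right)
    then have "kills ((P * [:- \<beta>, 1:] ^ Suc k) * (\<Prod>\<alpha>\<in>W. [:- \<alpha>, 1:]))"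
      using insert.IH insert.prems(2) by blast
    then have "kills ([:- \<beta>, 1:] ^ Suc k * (P * (\<Prod>\<alpha>\<in>W. [:- \<alpha>, 1:])))"
      by (simp only: mult_ac)
    then have "kills ([:- \<beta>, 1:] * (P * (\<Prod>\<alpha>\<in>W. [:- \<alpha>, 1:])))"
      using kills_power insert.prems(2) by blast
    then show ?case using insert.hyps by (simp add: mult.left_commute del: mult_pCons_left mult_pCons_right)
  qed simp
  have kills_Z: "L ((\<Prod>\<alpha>\<in>Z. [:- \<alpha>, 1:]) * Y) = 0" for Y
    using kills_prod[OF Z(1) order_refl, of 1 "2 * M - 1"] kills_big by (simp add: kills_def M_def)
  obtain lag where lag: "\<And>\<alpha> \<beta>. \<alpha> \<in> Z \<Longrightarrow> \<beta> \<in> Z \<Longrightarrow> poly (lag \<alpha>) \<beta> = (if \<alpha> = \<beta> then 1 else 0)"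
    using lagrange_polynomials[OF Z(1)] by blast
  have "t n = (\<Sum>\<alpha>\<in>Z. L (lag \<alpha>) * \<alpha> ^ n)" for n
  proof -
    have "(\<Prod>\<alpha>\<in>Z. [:- \<alpha>, 1:]) dvd monom 1 n - (\<Sum>\<alpha>\<in>Z. smult (\<alpha> ^ n) (lag \<alpha>))"
    proof (rule prod_roots_dvd[OF Z(1)])
      fix \<beta> assume "\<beta> \<in> Z"
      then have "(\<Sum>\<alpha>\<in>Z. \<alpha> ^ n * poly (lag \<alpha>) \<beta>) = (\<Sum>\<alpha>\<in>Z. if \<alpha> = \<beta> then \<beta> ^ n else 0)"
        by (intro sum.cong) (auto simp: lag)
      then show "poly (monom 1 n - (\<Sum>\<alpha>\<in>Z. smult (\<alpha> ^ n) (lag \<alpha>))) \<beta> = 0"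
        using Z(1) \<open>\<beta> \<in> Z\<close> by (simp add: poly_monom poly_sum)
    qed
    then obtain Y where "monom 1 n - (\<Sum>\<alpha>\<in>Z. smult (\<alpha> ^ n) (lag \<alpha>)) = (\<Prod>\<alpha>\<in>Z. [:- \<alpha>, 1:]) * Y" by (rule dvdE)
    then have "L (monom 1 n - (\<Sum>\<alpha>\<in>Z. smult (\<alpha> ^ n) (lag \<alpha>))) = 0" using kills_Z by simp
    then show ?thesis by (simp add: L_diff L_monom L_sum L_smult mult.commute)
  qed
  then show ?thesis by (intro exI[of _ "\<lambda>\<alpha>. L (lag \<alpha>)"]) auto
qed

section \<open>Spherical functions\<close>

text \<open>Locates the last element of an index range with a property; below, the confluent of a ray and a
  geodesic path is such an element.\<close>

lemma last_filter_upt: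
  assumes "P 0"
  shows "P (last (filter P [0..<Suc n]))" "last (filter P [0..<Suc n]) \<le> n"
    "j \<le> n \<Longrightarrow> P j \<Longrightarrow> j \<le> last (filter P [0..<Suc n])"
proof -
  have "P (last (filter P [0..<Suc n])) \<and> last (filter P [0..<Suc n]) \<le> n
      \<and> (\<forall>j\<le>n. P j \<longrightarrow> j \<le> last (filter P [0..<Suc n]))"
  proof (induction n)
    case 0
    then show ?case using assms by simp
  next
    case (Suc n)
    have e: "filter P [0..<Suc (Suc n)] = filter P [0..<Suc n] @ filter P [Suc n]" by simp
    show ?case
    proof (cases "P (Suc n)")
      case True
      then show ?thesis unfolding e by simp
    next
      case False
      then have "filter P [0..<Suc (Suc n)] = filter P [0..<Suc n]" unfolding e by simp
      with Suc False show ?thesis by (auto simp: le_Suc_eq simp del: upt_Suc)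
    qed
  qed
  then show "P (last (filter P [0..<Suc n]))" "last (filter P [0..<Suc n]) \<le> n"
    "j \<le> n \<Longrightarrow> P j \<Longrightarrow> j \<le> last (filter P [0..<Suc n])" by blast+
qed

lemma of_real_powi_powr:
  assumes "0 < x" shows "complex_of_real (x powi n) powr s = exp (s * of_real (ln x)) powi n"
proof -
  have "x powi n = exp (of_int n * ln x)"
    using assms exp_power_int[of "ln x" n] by simp
  then have "complex_of_real (x powi n) powr s = exp (s * (of_int n * of_real (ln x)))"
    by (simp add: powr_def Ln_of_real del: of_real_mult of_real_exp exp_of_real) (simp add: exp_of_real[symmetric])?
  then show ?thesis by (simp add: exp_power_int mult_ac)
qed

context tree begin

text \<open>The vertex at level \<open>j\<close> on the geodesic from \<open>r\<close> to \<open>x\<close>.\<close>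

definition ancestor :: "'v \<Rightarrow> 'v \<Rightarrow> nat \<Rightarrow> 'v" where
  "ancestor r x j = (parent E r ^^ (d r x - j)) x"

lemma funpow_parent_dist: "k \<le> d r x \<Longrightarrow> d r ((parent E r ^^ k) x) = d r x - k"
proof (induction k)
  case (Suc k)
  then have "r \<noteq> (parent E r ^^ k) x" by auto
  from parent(2)[OF this] Suc show ?case by auto
qed auto

lemma ancestor_dist: "j \<le> d r x \<Longrightarrow> d r (ancestor r x j) = j"
  unfolding ancestor_def by (subst funpow_parent_dist) auto

lemma ancestor_parent: "j < d r x \<Longrightarrow> parent E r (ancestor r x (Suc j)) = ancestor r x j"
proof -
  assume "j < d r x"
  then have "d r x - j = Suc (d r x - Suc j)" by simp
  then show ?thesis unfolding ancestor_def by simp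
qed

lemma ancestor_self: "ancestor r x (d r x) = x" by (simp add: ancestor_def)

text \<open>A walk of minimal length gains one level at each step, so it is determined backwards from \<open>x\<close> by
  taking parents.\<close>

lemma geodesic_path_eq: "geodesic_path E r x = map (ancestor r x) [0..<Suc (d r x)]"
  unfolding geodesic_path_def
proof (rule the1_equality)
  have uniq: "xs = map (ancestor r x) [0..<Suc (d r x)]" if xs: "walk E r x xs" "length xs = d r x + 1" for xs
  proof -
    have step: "E (xs ! i) (xs ! Suc i)" if "Suc i < length xs" for i
      using xs that by (auto simp: walk_def successively_conv_nth)
    have ends: "xs ! 0 = r" "xs ! d r x = x"
    proof -
      have "xs \<noteq> []" "hd xs = r" "last xs = x" "length xs - 1 = d r x"
        using xs by (simp_all add: walk_def)
      then show "xs ! 0 = r" "xs ! d r x = x" by (metis hd_conv_nth, metis last_conv_nth)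
    qed
    have up: "d r (xs ! i) \<le> i" if "i < length xs" for i
      using that
    proof (induction i)
      case (Suc i)
      then show ?case using gdist_adj_le[OF step[of i], of r] by simp
    qed (simp add: ends)
    have down: "d r x \<le> d r (xs ! (d r x - k)) + k" if "k \<le> d r x" for k
      using that
    proof (induction k)
      case (Suc k)
      have "Suc (d r x - Suc k) = d r x - k" using Suc.prems by simp
      then have "E (xs ! (d r x - Suc k)) (xs ! (d r x - k))"
        using step[of "d r x - Suc k"] xs Suc.prems by simp
      from gdist_adj_le[OF this, of r] Suc show ?case by simp
    qed (simp add: ends)
    have dist: "d r (xs ! i) = i" if "i \<le> d r x" for i
      using up[of i] down[of "d r x - i"] that xs by simp
    have "xs ! (d r x - k) = (parent E r ^^ k) x" if "k \<le> d r x" for k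
      using that
    proof (induction k)
      case (Suc k)
      have s: "Suc (d r x - Suc k) = d r x - k" using Suc.prems by simp
      then have adj: "E (xs ! (d r x - Suc k)) (xs ! (d r x - k))"
        using step[of "d r x - Suc k"] xs Suc.prems by simp
      then have "parent E r (xs ! (d r x - k)) = xs ! (d r x - Suc k)"
        using dist[of "d r x - Suc k"] dist[of "d r x - k"] Suc.prems
        by (intro parent_eqI adj_sym[OF adj]) auto
      then show ?case using Suc by simp
    qed (simp add: ends)
    then have "xs ! i = ancestor r x i" if "i \<le> d r x" for i
      using that unfolding ancestor_def by (metis diff_diff_cancel diff_le_self)
    then show ?thesis using xs by (intro nth_equalityI) (auto simp del: upt_Suc)
  qed
  obtain xs where "walk E r x xs" "length xs = d r x + 1"
    using walk_iff_relpowp[of E r x "d r x"] relpowp_gdist by blast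
  moreover from this uniq have "xs = map (ancestor r x) [0..<Suc (d r x)]" by blast
  ultimately show *: "walk E r x (map (ancestor r x) [0..<Suc (d r x)])
    \<and> length (map (ancestor r x) [0..<Suc (d r x)]) = d r x + 1" by blast
  then show "\<exists>!xs. walk E r x xs \<and> length xs = d r x + 1" using uniq by blast
qed

lemma boundary_ray:
  assumes "\<omega> \<in> boundary E r"
  shows "\<omega> 0 = r" "d r (\<omega> n) = n" "parent E r (\<omega> (Suc n)) = \<omega> n"
proof -
  have \<omega>: "\<omega> 0 = r" "\<And>m n. m \<le> n \<Longrightarrow> d (\<omega> m) (\<omega> n) = n - m"
    using assms by (auto simp: boundary_def)
  then show 0: "\<omega> 0 = r" and dist: "d r (\<omega> n) = n" for n using \<omega>(2)[of 0 n] by auto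
  have adj: "E (\<omega> n) (\<omega> (Suc n))" using \<omega>(2)[of n "Suc n"] by simp
  show "parent E r (\<omega> (Suc n)) = \<omega> n"
    by (intro parent_eqI adj_sym[OF adj]) (simp add: dist)
qed

lemma boundary_follows_ancestors:
  assumes "\<omega> \<in> boundary E r" "\<omega> j = ancestor r x j" "i \<le> j" "j \<le> d r x"
  shows "\<omega> i = ancestor r x i"
  using assms(3)
proof (induction i rule: inc_induct)
  case (step n)
  then show ?case using boundary_ray(3)[OF assms(1), of n] ancestor_parent[of n r x] assms(4) by simp
qed (rule assms(2))

text \<open>A ray meets the geodesic from \<open>r\<close> to \<open>x\<close> in an initial segment of it, because it can only reach a
  vertex through the ancestors of that vertex.\<close>

lemma confluent_dist:
  assumes \<omega>: "\<omega> \<in> boundary E r"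
  shows "d r (confluent E r x \<omega>) \<le> d r x"
    "j \<le> d r x \<Longrightarrow> j \<le> d r (confluent E r x \<omega>) \<longleftrightarrow> \<omega> j = ancestor r x j"
proof -
  define P where "P j \<longleftrightarrow> ancestor r x j \<in> range \<omega>" for j
  define J where "J = last (filter P [0..<Suc (d r x)])"
  have P: "P j \<longleftrightarrow> \<omega> j = ancestor r x j" if "j \<le> d r x" for j
    unfolding P_def using boundary_ray(2)[OF \<omega>] ancestor_dist[OF that] by (metis rangeE rangeI)
  have P0: "P 0"
  proof -
    have "d r (ancestor r x 0) = 0" by (rule ancestor_dist) simp
    then show ?thesis using boundary_ray(1)[OF \<omega>] P[of 0] by simp
  qed
  note J = last_filter_upt[where P = P and n = "d r x", OF P0, folded J_def]
  have "0 \<in> set (filter P [0..<Suc (d r x)])" using P0 by (simp del: upt_Suc)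
  then have "filter P [0..<Suc (d r x)] \<noteq> []" by (metis empty_iff empty_set)
  then have "confluent E r x \<omega> = ancestor r x J"
    unfolding confluent_def geodesic_path_eq J_def filter_map o_def P_def[symmetric]
    by (rule last_map)
  then have dJ: "d r (confluent E r x \<omega>) = J" using ancestor_dist J(2) by simp
  show "d r (confluent E r x \<omega>) \<le> d r x" using dJ J(2) by simp
  assume j: "j \<le> d r x"
  show "j \<le> d r (confluent E r x \<omega>) \<longleftrightarrow> \<omega> j = ancestor r x j"
  proof
    assume "j \<le> d r (confluent E r x \<omega>)"
    then show "\<omega> j = ancestor r x j"
      using boundary_follows_ancestors[OF \<omega> _ _ J(2)] P[OF J(2)] J(1) dJ by simp
  next
    assume "\<omega> j = ancestor r x j"
    then show "j \<le> d r (confluent E r x \<omega>)" using J(3)[OF j] P[OF j] dJ by simp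
  qed
qed

lemma boundary_cyl_eq: "boundary_cyl E r v = {\<omega> \<in> boundary E r. \<omega> (d r v) = v}"
proof -
  have "d r (confluent E r v \<omega>) = d r v \<longleftrightarrow> \<omega> (d r v) = v" if "\<omega> \<in> boundary E r" for \<omega>
    using confluent_dist(1)[OF that, of v] confluent_dist(2)[OF that, where j = "d r v" and x = v]
    by (auto simp: ancestor_self)
  then show ?thesis unfolding boundary_cyl_def by blast
qed

lemma confluent_cyl:
  assumes "j \<le> d r x"
  shows "{\<omega> \<in> boundary E r. j \<le> d r (confluent E r x \<omega>)} = boundary_cyl E r (ancestor r x j)"
  unfolding boundary_cyl_eq ancestor_dist[OF assms] using confluent_dist(2)[OF _ assms] by blast

text \<open>Telescoping: the function is \<open>f 0\<close> plus the increments \<open>f (j + 1) - f j\<close> on the events that the ray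
  follows the geodesic to level \<open>j + 1\<close>, which are cylinder sets of known measure.\<close>

lemma integral_confluent:
  fixes f :: "nat \<Rightarrow> complex"
  assumes \<nu>: "boundary_measure q E r \<nu>"
  shows "(\<integral>\<omega>. f (d r (confluent E r x \<omega>)) \<partial>\<nu>)
    = f 0 + (\<Sum>j<d r x. (f (Suc j) - f j) / (of_nat q ^ j * (of_nat q + 1)))"
proof -
  let ?n = "d r x"
  interpret prob_space \<nu> using \<nu> by (simp add: boundary_measure_def)
  have sp: "space \<nu> = boundary E r" using \<nu> by (simp add: boundary_measure_def)
  have meas: "boundary_cyl E r v \<in> sets \<nu>" for v
  proof -
    have "openin (boundary_topology E r) (boundary_cyl E r v)"
      unfolding boundary_topology_def by (rule topology_generated_by_Basis) auto
    then show ?thesis using \<nu> by (auto simp: boundary_measure_def intro: sigma_sets.Basic)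
  qed
  have prob: "measure \<nu> (boundary_cyl E r (ancestor r x (Suc j))) = 1 / (real q ^ j * (real q + 1))" if "j < ?n" for j
  proof -
    have "\<And>v. 1 \<le> d r v \<Longrightarrow> measure \<nu> (boundary_cyl E r v) = 1 / (real q + 1) * real q powi (1 - int (d r v))"
      using \<nu> by (simp add: boundary_measure_def)
    from this[of "ancestor r x (Suc j)"] show ?thesis
      using ancestor_dist[of "Suc j" r x] that
      by (simp add: power_int_minus inverse_eq_divide mult.commute)
  qed
  let ?A = "\<lambda>j. boundary_cyl E r (ancestor r x (Suc j))"
  have "f (d r (confluent E r x \<omega>))
      = f 0 + (\<Sum>j<?n. (f (Suc j) - f j) * of_real (indicat_real (?A j) \<omega>))" if "\<omega> \<in> space \<nu>" for \<omega>
  proof -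
    have b: "\<omega> \<in> boundary E r" using that sp by simp
    let ?J = "d r (confluent E r x \<omega>)"
    have J: "?J \<le> ?n" by (rule confluent_dist[OF b])
    have "(\<Sum>j<?n. (f (Suc j) - f j) * of_real (indicat_real (?A j) \<omega>)) = (\<Sum>j<?n. if j < ?J then f (Suc j) - f j else 0)"
    proof (rule sum.cong[OF refl])
      fix j assume "j \<in> {..<?n}"
      then have "\<omega> \<in> ?A j \<longleftrightarrow> Suc j \<le> ?J"
        using confluent_cyl[of "Suc j" r x] b by auto
      then show "(f (Suc j) - f j) * of_real (indicat_real (?A j) \<omega>) = (if j < ?J then f (Suc j) - f j else 0)"
        by (auto simp: indicator_def)
    qed
    also have "\<dots> = (\<Sum>j<?J. f (Suc j) - f j)"
      by (rule sum.mono_neutral_cong_right) (use J in auto)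
    also have "\<dots> = f ?J - f 0" by (rule sum_lessThan_telescope)
    finally show ?thesis by simp
  qed
  then have "(\<integral>\<omega>. f (d r (confluent E r x \<omega>)) \<partial>\<nu>)
      = (\<integral>\<omega>. f 0 + (\<Sum>j<?n. (f (Suc j) - f j) * of_real (indicat_real (?A j) \<omega>)) \<partial>\<nu>)"
    by (intro Bochner_Integration.integral_cong) auto
  also have "\<dots> = f 0 + (\<Sum>j<?n. (f (Suc j) - f j) * of_real (measure \<nu> (?A j)))"
  proof -
    have int: "integrable \<nu> (\<lambda>\<omega>. complex_of_real (indicat_real (?A j) \<omega>))" for j
      by (intro integrable_of_real) (simp add: meas emeasure_eq_measure)
    have "(\<integral>\<omega>. complex_of_real (indicat_real (?A j) \<omega>) \<partial>\<nu>) = of_real (measure \<nu> (?A j))" for j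
      using meas sets.sets_into_space by (simp add: Int_absorb2)
    then show ?thesis
      using int by (simp add: prob_space)
  qed
  also have "(\<Sum>j<?n. (f (Suc j) - f j) * of_real (measure \<nu> (?A j)))
      = (\<Sum>j<?n. (f (Suc j) - f j) / (of_nat q ^ j * (of_nat q + 1)))"
    by (rule sum.cong) (auto simp: prob)
  finally show ?thesis .
qed

text \<open>Value of the spherical function at distance \<open>n\<close> from \<open>r\<close>, where \<open>t = q\<^sup>1\<^sup>/\<^sup>2\<^sup>+\<^sup>i\<^sup>z\<close>.\<close>

definition spherical_value :: "complex \<Rightarrow> nat \<Rightarrow> complex" where
  "spherical_value t n = (1 + (\<Sum>j<n. t ^ (2 * j) * (t ^ 2 - 1) / (of_nat q ^ j * (of_nat q + 1)))) / t ^ n"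

lemma spherical_function_eq:
  assumes \<nu>: "boundary_measure q E r \<nu>"
  shows "spherical_function q E r \<nu> z x = spherical_value (sq * exp (\<i> * z * of_real (ln q))) (d r x)"
proof -
  define t where "t = sq * exp (\<i> * z * of_real (ln q))"
  have t0: "t \<noteq> 0" using sq_nz by (simp add: t_def del: of_real_eq_0_iff)
  have t: "exp ((1 / 2 + \<i> * z) * of_real (ln q)) = t"
  proof -
    have "sq = exp (1 / 2 * of_real (ln q))"
    proof -
      have "ln (sqrt (real q)) = 1 / 2 * ln q" "0 < sqrt (real q)" using q2 by (simp_all add: ln_sqrt)
      then have "sqrt (real q) = exp (1 / 2 * ln q)" by (metis exp_ln)
      then show ?thesis by (simp add: exp_of_real[symmetric])
    qed
    then show ?thesis by (simp add: t_def distrib_right exp_add)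
  qed
  let ?n = "d r x"
  let ?f = "\<lambda>j. t powi (2 * int j - int ?n)"
  have f: "?f j = t ^ (2 * j) / t ^ ?n" for j
    using t0 power_int_diff[of t "2 * int j" "int ?n"] by (simp add: power_int_mult power_mult flip: of_nat_mult)
  have "spherical_function q E r \<nu> z x = (\<integral>\<omega>. ?f (d r (confluent E r x \<omega>)) \<partial>\<nu>)"
    unfolding spherical_function_def poisson_kernel_def
    using q2 by (subst of_real_powi_powr) (auto simp: t)
  also have "\<dots> = ?f 0 + (\<Sum>j<?n. (?f (Suc j) - ?f j) / (of_nat q ^ j * (of_nat q + 1)))"
    by (rule integral_confluent[OF \<nu>])
  also have "\<dots> = spherical_value t ?n"
    unfolding f spherical_value_def add_divide_distrib sum_divide_distrib
    by (intro arg_cong2[of _ _ _ _ "(+)"] sum.cong refl)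
      (simp_all add: diff_divide_distrib power2_eq_square algebra_simps)
  finally show ?thesis by (simp add: t_def)
qed

lemma spherical_value_step:
  assumes t: "t \<noteq> 0"
  shows "of_nat q * spherical_value t (Suc (Suc n)) + spherical_value t n
      = (t + of_nat q / t) * spherical_value t (Suc n)"
    "(of_nat q + 1) * spherical_value t (Suc 0) = (t + of_nat q / t) * spherical_value t 0"
proof -
  define Q where "Q = complex_of_nat q"
  have Q: "Q \<noteq> 0" "Q + 1 \<noteq> 0"
    using q2 by (auto simp: Q_def) (metis of_nat_0_neq of_nat_Suc add.commute)
  define H where "H n = 1 + (\<Sum>j<n. t ^ (2 * j) * (t ^ 2 - 1) / (Q ^ j * (Q + 1)))" for n
  define e where "e = t ^ (2 * n) * (t ^ 2 - 1) / (Q ^ n * (Q + 1))"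
  have H1: "H (Suc n) = H n + e" by (simp add: H_def e_def)
  have "t ^ (2 * Suc n) * (t ^ 2 - 1) / (Q ^ Suc n * (Q + 1)) = t ^ 2 / Q * e"
    by (simp add: e_def power2_eq_square mult_ac)
  then have H2: "H (Suc (Suc n)) = H n + e + t ^ 2 / Q * e" using H1 by (simp add: H_def)
  have r: "spherical_value t n = H n / t ^ n" for n
    by (simp add: spherical_value_def H_def Q_def)
  have "Q * ((h + e + t ^ 2 / Q * e) / t ^ Suc (Suc n)) + h / t ^ n = (t + Q / t) * ((h + e) / t ^ Suc n)" for h
    using t Q by (simp add: field_simps power2_eq_square)
  then show "of_nat q * spherical_value t (Suc (Suc n)) + spherical_value t n
      = (t + of_nat q / t) * spherical_value t (Suc n)"
    unfolding r H1 H2 Q_def[symmetric] .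
  show "(of_nat q + 1) * spherical_value t (Suc 0) = (t + of_nat q / t) * spherical_value t 0"
  proof -
    have "(Q + 1) * (1 + (t ^ 2 - 1) / (Q + 1)) = Q + t ^ 2" using Q by (simp add: distrib_left)
    then have "(Q + 1) * ((1 + (t ^ 2 - 1) / (Q + 1)) / t) = (Q + t ^ 2) / t" by simp
    also have "\<dots> = t + Q / t" using t by (simp add: add_divide_distrib power2_eq_square)
    finally show ?thesis unfolding r Q_def[symmetric] by (simp add: H_def)
  qed
qed

lemma sphere_sum_spherical_value:
  assumes "t \<noteq> 0"
  shows "sphere_sum E 1 (\<lambda>x. spherical_value t (d r x)) x
    = (t + of_nat q / t) * spherical_value t (d r x)"
proof (cases "r = x")
  case True
  then have dy: "d r y = Suc 0" if "E x y" for y using that by simp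
  have "sphere_sum E 1 (\<lambda>x. spherical_value t (d r x)) x = (\<Sum>y | E x y. spherical_value t (Suc 0))"
    unfolding One_nat_def sphere_sum_1
  proof (rule sum.cong[OF refl])
    fix y assume "y \<in> {y. E x y}"
    then have "d r y = Suc 0" using dy by blast
    then show "spherical_value t (d r y) = spherical_value t (Suc 0)" by (rule arg_cong)
  qed
  then show ?thesis using spherical_value_step(2)[OF assms] True card_nbrs[of x] by (simp add: add.commute)
next
  case False
  let ?g = "\<lambda>x. spherical_value t (d r x)"
  obtain n where n: "d r x = Suc n" using False gdist_eq_0 not0_implies_Suc by blast
  have "sphere_sum E 1 ?g x = sum ?g (insert (parent E r x) {v. E x v \<and> d r v = Suc (d r x)})"
    by (simp add: sphere_sum_1 nbrs_inner(1)[OF False, symmetric])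
  also have "\<dots> = ?g (parent E r x) + (\<Sum>v | E x v \<and> d r v = Suc (d r x). ?g v)"
    by (rule sum.insert) (use nbrs_inner(2)[OF False] finite_subset[OF _ finite_nbrs[of x]] in auto)
  also have "(\<Sum>v | E x v \<and> d r v = Suc (d r x). ?g v) = (\<Sum>v | E x v \<and> d r v = Suc (d r x). spherical_value t (Suc (Suc n)))"
    using n by (intro sum.cong) auto
  also have "\<dots> = of_nat q * spherical_value t (Suc (Suc n))"
    using card_children[OF False] by simp
  finally show ?thesis using spherical_value_step(1)[OF assms, of n] parent(2)[OF False] n by (simp add: add.commute)
qed

lemma cheb_eigenfunction:
  assumes g: "\<And>x. sphere_sum E 1 g x = sq * (u + 1 / u) * g x" and u: "u \<noteq> 0"
  shows "cheb n g = (\<lambda>x. (u ^ n + (1 / u) ^ n) * g x)"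
proof (induction n rule: induct_nat_012)
  case 1
  show ?case unfolding cheb.simps(2) using g sq_nz by (simp del: of_real_eq_0_iff)
next
  case (ge2 n)
  have g1: "cheb 1 g = (\<lambda>x. (u + 1 / u) * g x)"
    unfolding cheb_1 using g sq_nz by (simp del: of_real_eq_0_iff)
  have "cheb (Suc (Suc n)) g = (\<lambda>x. (u + 1 / u) * cheb (Suc n) g x - cheb n g x)"
    unfolding cheb_Suc_Suc g1 cheb_lin(3) ..
  also have "\<dots> = (\<lambda>x. (u ^ Suc (Suc n) + (1 / u) ^ Suc (Suc n)) * g x)"
    unfolding ge2 using u by (intro ext) (simp add: field_simps)
  finally show ?case .
qed simp

text \<open>Spheres are finite, so absolute convergence over the vertices can be tested on sphere sums of moduli.\<close>

lemma infsum_spheres: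
  fixes g :: "'v \<Rightarrow> complex"
  assumes "summable (\<lambda>n. \<Sum>y | d x y = n. norm (g y))"
  shows "(\<lambda>n. sphere_sum E n g x) sums infsum g UNIV"
proof -
  let ?S = "Sigma UNIV (\<lambda>n. {y. d x y = n})"
  have bij: "bij_betw snd ?S UNIV"
    by (rule bij_betwI[where g = "\<lambda>y. (d x y, y)"]) auto
  have "(\<lambda>n. \<Sum>y | d x y = n. norm (g y)) summable_on UNIV"
    by (rule norm_summable_imp_summable_on) (use assms in \<open>simp add: sum_nonneg\<close>)
  then have "(\<lambda>(n, y). norm (g y)) summable_on ?S"
    by (intro summable_on_SigmaI[where g = "\<lambda>n. \<Sum>y | d x y = n. norm (g y)"]) auto
  then have s: "(\<lambda>z. norm (g (snd z))) summable_on ?S" by (simp add: case_prod_unfold)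
  then have s': "(\<lambda>z. g (snd z)) summable_on ?S" by (rule abs_summable_summable)
  have "((\<lambda>z. g (snd z)) has_sum infsum g UNIV) ?S"
    using has_sum_infsum[OF s'] infsum_reindex_bij_betw[OF bij, of g] by simp
  then have "((\<lambda>n. sphere_sum E n g x) has_sum infsum g UNIV) UNIV"
    by (rule has_sum_SigmaD) (simp add: sphere_sum_def)
  then show ?thesis by (rule has_sum_imp_sums)
qed

end

section \<open>The Abel transform\<close>

lemma has_sum_finite_sum:
  fixes f :: "'i \<Rightarrow> 'l \<Rightarrow> complex"
  assumes "finite I" "\<And>i. i \<in> I \<Longrightarrow> (f i has_sum s i) A"
  shows "((\<lambda>l. \<Sum>i\<in>I. f i l) has_sum (\<Sum>i\<in>I. s i)) A"
  using assms by (induction I rule: finite_induct) (auto intro!: has_sum_add)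

context tree begin

lemma cheb_has_sum:
  assumes "\<And>x. ((\<lambda>l. F l x) has_sum g x) A"
  shows "((\<lambda>l. cheb n (F l) x) has_sum cheb n g x) A"
  using assms
proof (induction n g arbitrary: F x rule: cheb.induct)
  case (1 g)
  then show ?case by (auto intro: has_sum_cmult_right)
next
  case (2 g)
  have "((\<lambda>l. sphere_sum E 1 (F l) x) has_sum sphere_sum E 1 g x) A"
    unfolding sphere_sum_def by (rule has_sum_finite_sum) (use 2 in auto)
  then show ?case
    unfolding cheb.simps divide_inverse by (rule has_sum_cmult_left)
next
  case (3 n g)
  have "((\<lambda>l. sphere_sum E 1 (F l) x / sq) has_sum sphere_sum E 1 g x / sq) A" for x
    unfolding sphere_sum_def divide_inverse by (intro has_sum_cmult_left has_sum_finite_sum) (use 3 in auto)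
  from "3.IH"(1)[OF this] "3.IH"(2)[OF "3.prems"]
  show ?case unfolding cheb.simps(3) diff_conv_add_uminus by (intro has_sum_add has_sum_uminusI)
qed

end

context schwartz_tree begin

lemma R_pos: "0 < R" and R_ge_1: "1 \<le> R" and Q_pos: "0 < Q"
  using R_gt_1 Q_gt_1 by auto

lemma q_Q_power: "real q * Q ^ n \<le> Q ^ (n + 2)"
  using mult_right_mono[OF q_le_Q_square, of "Q ^ n"] Q_pos by (simp add: power_add power2_eq_square mult_ac)

text \<open>In the recurrence for the coefficients the factor \<open>q\<close> is absorbed by \<open>q \<le> Q\<^sup>2\<close>; so each step adds a
  bounded multiple of the top weight, which gives the linear factor.\<close>

lemma sphere_coeff_weight:
  "(\<Sum>j\<le>n. \<bar>sphere_coeff n j\<bar> * nweight R K j) \<le> 2 * real q * (1 + real n) * nweight Q K n"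
proof (induction n rule: less_induct)
  case (less n)
  define w where "w j = nweight R K j" for j :: nat
  define W where "W j = nweight Q K j" for j :: nat
  have w0: "0 \<le> w j" and W0: "0 \<le> W j" for j using R_pos Q_pos by (auto simp: w_def W_def)
  have wW: "sqrt q ^ j * w j = W j" for j
    by (simp add: w_def W_def power_mult_distrib flip: sqrt_q_R)
  have W_mono: "W i \<le> W j" if "i \<le> j" for i j
    unfolding W_def using that Q_gt_1 by (intro mult_mono power_mono power_increasing) auto
  have qW: "real q * W j \<le> W (j + 2)" for j
  proof -
    have "real q * W j = (1 + real j) ^ K * (real q * Q ^ j)" by (simp add: W_def)
    also have "\<dots> \<le> (1 + real (j + 2)) ^ K * Q ^ (j + 2)"
      using q_Q_power Q_pos by (intro mult_mono power_mono) auto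
    finally show ?thesis by (simp add: W_def)
  qed
  have "(\<Sum>j\<le>n. \<bar>sphere_coeff n j\<bar> * w j) \<le> 2 * real q * (1 + real n) * W n"
  proof -
    consider "n = 0" | "n = 1" | "n = Suc (Suc 0)" | k where "n = Suc (Suc (Suc k))"
      by (metis One_nat_def not0_implies_Suc)
    then show ?thesis
    proof cases
      case 1
      then show ?thesis using q2 by (simp add: w_def W_def)
    next
      case 2
      have "W 1 \<le> 2 * real q * 2 * W 1" using W0[of 1] q2 mult_right_mono[of 1 "2 * real q * 2" "W 1"] by simp
      then show ?thesis using 2 wW[of 1] by simp
    next
      case 3
      have "{..Suc (Suc 0)} = {0, 1, 2}" by auto
      then have "(\<Sum>j\<le>n. \<bar>sphere_coeff n j\<bar> * w j) = (real q - 1) / 2 + real q * w 2"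
        using 3 q2 by (simp add: w_def of_nat_diff)
      also have "\<dots> \<le> real q * W 2 + W 2"
      proof -
        have "1 \<le> W 2" using W_mono[of 0 2] by (simp add: W_def)
        then have "real q * 1 \<le> real q * W 2" by (intro mult_left_mono) auto
        moreover have "real q * w 2 = W 2" using wW[of 2] by simp
        ultimately show ?thesis by simp
      qed
      also have "\<dots> \<le> 2 * real q * 3 * W 2"
        using W0[of 2] q2 mult_right_mono[of "real q + 1" "2 * real q * 3" "W 2"] by (simp add: distrib_right)
      finally show ?thesis using 3 by (simp add: numeral_2_eq_2)
    next
      case (4 k)
      have "(\<Sum>j\<le>n. \<bar>sphere_coeff n j\<bar> * w j)
        \<le> (\<Sum>j\<le>n. real q * (\<bar>sphere_coeff (Suc k) j\<bar> * w j) + (if j = k + 3 then sqrt q ^ (k + 3) * w j else 0)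
            + (if j = k + 1 then sqrt q ^ (k + 1) * w j else 0))"
      proof (rule sum_mono)
        fix j
        have "\<bar>sphere_coeff n j\<bar> \<le> real q * \<bar>sphere_coeff (Suc k) j\<bar> + (if j = k + 3 then sqrt q ^ (k + 3) else 0)
            + (if j = k + 1 then sqrt q ^ (k + 1) else 0)"
          unfolding 4 sphere_coeff.simps(4)
          by (intro order_trans[OF abs_triangle_ineq4] add_mono order_trans[OF abs_triangle_ineq]) (auto simp: abs_mult)
        from mult_right_mono[OF this w0[of j]]
        show "\<bar>sphere_coeff n j\<bar> * w j \<le> real q * (\<bar>sphere_coeff (Suc k) j\<bar> * w j) + (if j = k + 3 then sqrt q ^ (k + 3) * w j else 0)
            + (if j = k + 1 then sqrt q ^ (k + 1) * w j else 0)"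
          by (auto simp: algebra_simps split: if_splits)
      qed
      also have "\<dots> = real q * (\<Sum>j\<le>n. \<bar>sphere_coeff (Suc k) j\<bar> * w j) + W (k + 3) + W (k + 1)"
      proof -
        have "k + 3 \<le> n" "k + 1 \<le> n" using 4 by auto
        then show ?thesis
          using wW[of "k + 3"] wW[of "k + 1"] by (simp add: sum.distrib sum_distrib_left)
      qed
      also have "(\<Sum>j\<le>n. \<bar>sphere_coeff (Suc k) j\<bar> * w j) = (\<Sum>j\<le>Suc k. \<bar>sphere_coeff (Suc k) j\<bar> * w j)"
        by (rule sum.mono_neutral_right) (use 4 sphere_coeff_eq_0 in auto)
      also have "real q * (\<Sum>j\<le>Suc k. \<bar>sphere_coeff (Suc k) j\<bar> * w j) + W (k + 3) + W (k + 1)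
          \<le> 2 * real q * (1 + real (Suc k)) * W n + W n + W n"
      proof (intro add_mono)
        have "(\<Sum>j\<le>Suc k. \<bar>sphere_coeff (Suc k) j\<bar> * w j) \<le> 2 * real q * (1 + real (Suc k)) * W (Suc k)"
          using less[of "Suc k"] 4 by (simp add: w_def W_def)
        then have "real q * (\<Sum>j\<le>Suc k. \<bar>sphere_coeff (Suc k) j\<bar> * w j)
            \<le> real q * (2 * real q * (1 + real (Suc k)) * W (Suc k))" by (rule mult_left_mono) simp
        also have "real q * (2 * real q * (1 + real (Suc k)) * W (Suc k)) = 2 * real q * (1 + real (Suc k)) * (real q * W (Suc k))"
          by (simp add: mult_ac)
        also have "\<dots> \<le> 2 * real q * (1 + real (Suc k)) * W n"
          using qW[of "Suc k"] 4 by (intro mult_left_mono) auto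
        finally show "real q * (\<Sum>j\<le>Suc k. \<bar>sphere_coeff (Suc k) j\<bar> * w j) \<le> \<dots>" .
      qed (use W_mono 4 in auto)
      also have "\<dots> = (2 * real q * (1 + real (Suc k)) + 2) * W n" by (simp add: distrib_right)
      also have "\<dots> \<le> 2 * real q * (1 + real n) * W n"
        using 4 q2 W0[of n] by (intro mult_right_mono) (auto simp: algebra_simps)
      finally show ?thesis by simp
    qed
  qed
  then show ?case by (simp add: w_def W_def)
qed

text \<open>The coefficients, in the Chebyshev operators, of convolution with the radial kernel \<open>k\<close>.\<close>

definition abel :: "(nat \<Rightarrow> complex) \<Rightarrow> nat \<Rightarrow> complex" where
  "abel k j = (\<Sum>\<^sub>\<infinity>n. k n * of_real (sphere_coeff n j))"

lemma abel_majorant: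
  assumes k: "nrapid Q k"
  shows "(\<lambda>(n, j). cmod (k n) * (\<bar>sphere_coeff n j\<bar> * nweight R K j)) summable_on UNIV \<times> UNIV"
proof (rule summable_on_SigmaI)
  let ?N = "\<lambda>n. \<Sum>j\<le>n. \<bar>sphere_coeff n j\<bar> * nweight R K j"
  fix n :: nat
  have "((\<lambda>j. \<bar>sphere_coeff n j\<bar> * nweight R K j) has_sum ?N n) UNIV"
    by (rule has_sum_finite_neutralI) (auto simp: sphere_coeff_eq_0)
  then show "((\<lambda>j. case (n, j) of (n, j) \<Rightarrow> cmod (k n) * (\<bar>sphere_coeff n j\<bar> * nweight R K j))
      has_sum cmod (k n) * ?N n) UNIV"
    unfolding prod.case by (rule has_sum_cmult_right)
next
  let ?N = "\<lambda>n. \<Sum>j\<le>n. \<bar>sphere_coeff n j\<bar> * nweight R K j"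
  have "summable (\<lambda>n. 2 * real q * (cmod (k n) * nweight Q (K + 1) n))"
    by (intro summable_mult nrapid_weight_summable k Q_pos)
  then have "summable (\<lambda>n. norm (cmod (k n) * ?N n))"
  proof (rule summable_comparison_test'[where N = 0])
    fix n
    have "cmod (k n) * ?N n \<le> cmod (k n) * (2 * real q * (1 + real n) * nweight Q K n)"
      by (intro mult_left_mono sphere_coeff_weight) auto
    also have "\<dots> = 2 * real q * (cmod (k n) * nweight Q (K + 1) n)"
      by (simp only: power_add power_one_right mult_ac)
    finally have "cmod (k n) * ?N n \<le> \<dots>" .
    moreover have "0 \<le> cmod (k n) * ?N n" using R_pos by (intro mult_nonneg_nonneg sum_nonneg) auto
    ultimately show "norm (norm (cmod (k n) * ?N n)) \<le> 2 * real q * (cmod (k n) * nweight Q (K + 1) n)"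
      by (simp only: real_norm_def abs_of_nonneg)
  qed
  then show "(\<lambda>n. cmod (k n) * ?N n) summable_on UNIV" by (rule norm_summable_imp_summable_on)
qed (use R_pos in auto)

lemma abel_nrapid:
  assumes k: "nrapid Q k" shows "nrapid R (abel k)"
  unfolding nrapid_def
proof
  fix K
  let ?G = "\<lambda>(n, j). cmod (k n) * (\<bar>sphere_coeff n j\<bar> * nweight R K j)"
  have G: "?G summable_on UNIV \<times> UNIV" by (rule abel_majorant[OF k])
  have "nweight R K j * cmod (abel k j) \<le> infsum ?G (UNIV \<times> UNIV)" for j
  proof -
    have inj: "inj_on (\<lambda>n. (n, j)) UNIV" by (auto simp: inj_on_def)
    have sub: "?G summable_on range (\<lambda>n. (n, j))" by (rule summable_on_subset_banach[OF G]) auto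
    then have s: "(\<lambda>n. cmod (k n) * (\<bar>sphere_coeff n j\<bar> * nweight R K j)) summable_on UNIV"
      using summable_on_reindex[OF inj, of ?G] by (simp add: o_def)
    have w: "0 < nweight R K j" using R_pos by simp
    have "(\<lambda>n. (1 / (nweight R K j)) * (cmod (k n) * (\<bar>sphere_coeff n j\<bar> * nweight R K j))) summable_on UNIV"
      by (rule summable_on_cmult_right[OF s])
    then have ns: "(\<lambda>n. norm (k n * of_real (sphere_coeff n j))) summable_on UNIV"
      using w R_pos by (simp add: norm_mult)
    have "nweight R K j * cmod (abel k j)
        \<le> nweight R K j * (\<Sum>\<^sub>\<infinity>n. norm (k n * of_real (sphere_coeff n j)))"
      unfolding abel_def using w by (intro mult_left_mono norm_infsum_bound ns) auto
    also have "\<dots> = (\<Sum>\<^sub>\<infinity>n. cmod (k n) * (\<bar>sphere_coeff n j\<bar> * nweight R K j))"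
      by (simp add: infsum_cmult_right'[symmetric] norm_mult mult_ac)
    also have "\<dots> = infsum ?G (range (\<lambda>n. (n, j)))" using infsum_reindex[OF inj, of ?G] by (simp add: o_def)
    also have "\<dots> \<le> infsum ?G (UNIV \<times> UNIV)"
      by (rule infsum_mono2[OF sub G]) (use R_pos in auto)
    finally show ?thesis .
  qed
  then show "\<exists>C. \<forall>j. nweight R K j * cmod (abel k j) \<le> C" by blast
qed

text \<open>Both sums come from one absolutely convergent double series, once summed along spheres and once along
  Chebyshev indices. It is used with \<open>y j = cheb j f x\<close> for convolution operators and with
  \<open>y j = u ^ j + (1 / u) ^ j\<close> for spherical transforms.\<close>

lemma abel_expansion:
  assumes k: "nrapid Q k" and y: "\<And>j. cmod (y j) \<le> C * nweight R 2 j"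
    and S: "(\<lambda>n. k n * (\<Sum>j\<le>n. of_real (sphere_coeff n j) * y j)) sums S"
  shows "((\<lambda>j. abel k j * y j) has_sum S) UNIV"
proof -
  let ?F = "\<lambda>(n, j). k n * of_real (sphere_coeff n j) * y j"
  have "(\<lambda>z. C * (\<lambda>(n, j). cmod (k n) * (\<bar>sphere_coeff n j\<bar> * nweight R 2 j)) z) summable_on UNIV \<times> UNIV"
    by (intro summable_on_cmult_right abel_majorant k)
  then have "(\<lambda>z. norm (?F z)) summable_on UNIV \<times> UNIV"
  proof (rule Infinite_Sum.abs_summable_on_comparison_test', safe)
    fix n j
    show "norm (k n * of_real (sphere_coeff n j) * y j)
        \<le> C * (cmod (k n) * (\<bar>sphere_coeff n j\<bar> * nweight R 2 j))"
      using mult_left_mono[OF y[of j], of "cmod (k n) * \<bar>sphere_coeff n j\<bar>"] by (simp add: norm_mult mult_ac)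
  qed
  then have F: "?F summable_on UNIV \<times> UNIV" by (rule abs_summable_summable)
  have row: "((\<lambda>j. ?F (n, j)) has_sum k n * (\<Sum>j\<le>n. of_real (sphere_coeff n j) * y j)) UNIV" for n
    unfolding prod.case sum_distrib_left
    by (rule has_sum_finite_neutralI) (auto simp: sphere_coeff_eq_0 mult.assoc)
  have "((\<lambda>n. k n * (\<Sum>j\<le>n. of_real (sphere_coeff n j) * y j)) has_sum infsum ?F (UNIV \<times> UNIV)) UNIV"
    by (rule has_sum_SigmaD[OF has_sum_infsum[OF F]]) (rule row)
  then have inf: "infsum ?F (UNIV \<times> UNIV) = S"
    using S has_sum_imp_sums sums_unique2 by blast
  have bij: "bij_betw (\<lambda>(j, n). (n, j)) (UNIV \<times> UNIV) (UNIV \<times> UNIV :: (nat \<times> nat) set)"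
    by (rule bij_betwI[where g = "\<lambda>(n, j). (j, n)"]) auto
  have F': "((\<lambda>(j, n). k n * of_real (sphere_coeff n j) * y j) has_sum S) (UNIV \<times> UNIV)"
    using has_sum_reindex_bij_betw[OF bij, of ?F S] has_sum_infsum[OF F] inf by (simp add: case_prod_unfold)
  show ?thesis
  proof (rule has_sum_SigmaD[OF F'])
    fix j :: nat
    have "(\<lambda>n. k n * of_real (sphere_coeff n j) * y j) summable_on UNIV"
      using summable_on_SigmaD1[of "\<lambda>j n. k n * of_real (sphere_coeff n j) * y j" UNIV "\<lambda>_. UNIV" j]
        has_sum_imp_summable[OF F'] by simp
    then have "((\<lambda>n. k n * of_real (sphere_coeff n j) * y j) has_sum (\<Sum>\<^sub>\<infinity>n. k n * of_real (sphere_coeff n j) * y j)) UNIV"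
      by (rule has_sum_infsum)
    then show "((\<lambda>n. case (j, n) of (j, n) \<Rightarrow> k n * of_real (sphere_coeff n j) * y j) has_sum abel k j * y j) UNIV"
      unfolding abel_def by (simp add: infsum_cmult_left')
  qed
qed

lemma cheb_bound:
  assumes "weighted_bound 0 B f"
  shows "cmod (cheb n f x) \<le> (2 * (1 + real q) * B) * nweight R 2 n"
proof -
  have "1 * cmod (cheb n f x) \<le> Q ^ d r x * cmod (cheb n f x)"
    using Q_gt_1 by (intro mult_right_mono) auto
  also have "\<dots> \<le> 2 * (1 + real q) * (1 + real n) ^ 2 * R ^ n * B"
    using weighted_bound_cheb[OF assms, of n] unfolding weighted_bound_def by (simp add: numeral_2_eq_2)
  finally show ?thesis by (simp add: mult_ac)
qed

lemma conv_expansion: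
  assumes k: "nrapid Q k" and kr: "\<And>n. radial_value E r kk n = k n" and f: "weighted_bound 0 B f"
  shows "((\<lambda>j. abel k j * cheb j f x) has_sum conv E r f kk x) UNIV"
proof (rule abel_expansion[OF k cheb_bound[OF f]])
  have sph: "(\<Sum>y | d x y = n. cmod (f y * k (d x y))) \<le> cmod (k n) * (2 * nweight Q 1 n * B)" for n
  proof -
    let ?f = "\<lambda>y. of_real (cmod (f y)) :: complex"
    have "weighted_bound 0 B ?f" using f by (simp add: weighted_bound_def)
    from weighted_bound_sphere_sum[OF this, of n]
    have "Q ^ d r x * cmod (sphere_sum E n ?f x) \<le> 2 * (1 + real n) * Q ^ n * B"
      unfolding weighted_bound_def by simp
    moreover have "1 * cmod (sphere_sum E n ?f x) \<le> Q ^ d r x * cmod (sphere_sum E n ?f x)"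
      using Q_gt_1 by (intro mult_right_mono) auto
    ultimately have le: "cmod (sphere_sum E n ?f x) \<le> 2 * nweight Q 1 n * B"
      by (simp add: mult.assoc distrib_right distrib_left)
    have "sphere_sum E n ?f x = of_real (\<Sum>y | d x y = n. cmod (f y))" by (simp add: sphere_sum_def)
    then have "cmod (sphere_sum E n ?f x) = (\<Sum>y | d x y = n. cmod (f y))"
      by (simp only: norm_of_real) (simp add: sum_nonneg)
    moreover have "(\<Sum>y | d x y = n. cmod (f y * k (d x y))) = cmod (k n) * (\<Sum>y | d x y = n. cmod (f y))"
      by (simp add: norm_mult sum_distrib_left mult.commute)
    ultimately show ?thesis using le by (simp add: mult_left_mono)
  qed
  have "summable (\<lambda>n. \<Sum>y | d x y = n. norm (f y * k (d x y)))"
  proof (rule summable_comparison_test'[where N = 0])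
    have "summable (\<lambda>n. cmod (k n) * nweight Q 1 n * (2 * B))"
      by (intro summable_mult2 nrapid_weight_summable k Q_pos)
    then show "summable (\<lambda>n. cmod (k n) * (2 * nweight Q 1 n * B))" by (simp add: mult_ac)
    show "norm (\<Sum>y | d x y = n. norm (f y * k (d x y))) \<le> cmod (k n) * (2 * nweight Q 1 n * B)" for n
      using sph[of n] by (simp add: sum_nonneg)
  qed
  from infsum_spheres[OF this]
  have "(\<lambda>n. sphere_sum E n (\<lambda>y. f y * k (d x y)) x) sums conv E r f kk x"
    by (simp add: conv_def kr)
  moreover have "sphere_sum E n (\<lambda>y. f y * k (d x y)) x = k n * (\<Sum>j\<le>n. of_real (sphere_coeff n j) * cheb j f x)" for n
    unfolding sphere_sum_expansion[symmetric] by (simp add: sphere_sum_def sum_distrib_left mult.commute)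
  ultimately show "(\<lambda>n. k n * (\<Sum>j\<le>n. of_real (sphere_coeff n j) * cheb j f x)) sums conv E r f kk x" by simp
qed

text \<open>With \<open>v = cmod u\<close>, the summands of the spherical value are comparable to \<open>v\<^sup>2\<^sup>j\<^sup>-\<^sup>n\<close>, which is at most \<open>R\<^sup>n\<close>
  on the closed annulus.\<close>

lemma spherical_value_bound:
  assumes u: "1 / R \<le> cmod u" "cmod u \<le> R"
  shows "\<exists>C. \<forall>n. real q ^ n * cmod (spherical_value (sq * u) n) \<le> C * ((1 + real n) * Q ^ n)"
proof -
  define t where "t = sq * u"
  define v where "v = cmod u"
  have v: "0 < v" "v \<le> R" "1 / v \<le> R"
  proof -
    have "0 < 1 / R" using R_pos by simp
    then show "0 < v" using u(1) unfolding v_def by linarith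
    then show "1 / v \<le> R" using u(1) R_pos by (simp add: v_def divide_le_eq mult.commute)
  qed (use u v_def in auto)
  have tq: "cmod t ^ (2 * j) = real q ^ j * v ^ (2 * j)" for j
    by (simp add: t_def v_def norm_mult power_mult_distrib power_mult)
  have pow_le: "v ^ (2 * j) / v ^ n \<le> R ^ n" if "j \<le> n" for j n
  proof (cases "n \<le> 2 * j")
    case True
    then have "v ^ (2 * j) / v ^ n = v ^ (2 * j - n)" using v by (simp add: power_diff)
    also have "\<dots> \<le> R ^ (2 * j - n)" using v by (intro power_mono) auto
    also have "\<dots> \<le> R ^ n" using that R_ge_1 by (intro power_increasing) auto
    finally show ?thesis .
  next
    case False
    then have "v ^ (2 * j) / v ^ n = (1 / v) ^ (n - 2 * j)" using v by (simp add: power_diff power_divide)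
    also have "\<dots> \<le> R ^ (n - 2 * j)" using v by (intro power_mono) auto
    also have "\<dots> \<le> R ^ n" using R_ge_1 by (intro power_increasing) auto
    finally show ?thesis .
  qed
  define D where "D = cmod (t ^ 2 - 1) + 1"
  have D: "1 \<le> D" "cmod (t ^ 2 - 1) \<le> D" by (auto simp: D_def)
  have "real q ^ n * cmod (spherical_value t n) \<le> D * ((1 + real n) * Q ^ n)" for n
  proof -
    have tm: "cmod (t ^ (2 * j) * (t ^ 2 - 1) / (of_nat q ^ j * (of_nat q + 1))) \<le> D * v ^ (2 * j)" for j
    proof -
      have "cmod (of_nat q + 1) = real q + 1" by (metis norm_of_nat of_nat_Suc add.commute)
      then have "cmod (t ^ (2 * j) * (t ^ 2 - 1) / (of_nat q ^ j * (of_nat q + 1)))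
          = v ^ (2 * j) * cmod (t ^ 2 - 1) / (real q + 1)"
        using q2 by (simp add: norm_mult norm_divide norm_power tq)
      also have "\<dots> \<le> v ^ (2 * j) * cmod (t ^ 2 - 1) / 1"
        using v by (intro divide_left_mono) auto
      also have "\<dots> \<le> D * v ^ (2 * j)" using D(2) v by (simp add: mult.commute mult_right_mono)
      finally show ?thesis .
    qed
    have "cmod (1 + (\<Sum>j<n. t ^ (2 * j) * (t ^ 2 - 1) / (of_nat q ^ j * (of_nat q + 1))))
        \<le> D * v ^ (2 * 0) + (\<Sum>j<n. D * v ^ (2 * j))"
      by (rule order_trans[OF norm_triangle_ineq add_mono]) (use D tm in \<open>auto intro!: sum_norm_le\<close>)
    then have "cmod (spherical_value t n) \<le> (D * v ^ (2 * 0) + (\<Sum>j<n. D * v ^ (2 * j))) / cmod t ^ n"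
      unfolding spherical_value_def norm_divide norm_power by (intro divide_right_mono) auto
    then have "real q ^ n * cmod (spherical_value t n)
        \<le> real q ^ n * ((D * v ^ (2 * 0) + (\<Sum>j<n. D * v ^ (2 * j))) / cmod t ^ n)"
      by (intro mult_left_mono) auto
    also have "\<dots> = sqrt q ^ n * (D * (v ^ (2 * 0) / v ^ n) + (\<Sum>j<n. D * (v ^ (2 * j) / v ^ n)))"
    proof -
      have "cmod t ^ n = sqrt q ^ n * v ^ n" by (simp add: t_def v_def norm_mult power_mult_distrib)
      moreover have "real q ^ n = sqrt q ^ n * sqrt q ^ n" by (simp flip: power_mult_distrib)
      moreover have "sqrt q ^ n \<noteq> 0" using q2 by simp
      ultimately show ?thesis using q2 by (simp add: sum_distrib_left[symmetric] sum_divide_distrib[symmetric] add_divide_distrib distrib_left)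
    qed
    also have "\<dots> \<le> sqrt q ^ n * (D * R ^ n + (\<Sum>j<n. D * R ^ n))"
      using D pow_le[of 0 n] pow_le[of _ n] by (intro mult_left_mono add_mono sum_mono) auto
    also have "\<dots> = D * ((1 + real n) * Q ^ n)"
      by (simp add: sqrt_q_R[symmetric] power_mult_distrib algebra_simps)
    finally show ?thesis .
  qed
  then show ?thesis unfolding t_def by blast
qed

text \<open>The spherical function is an eigenfunction of the neighbour sum, hence of every Chebyshev operator, and
  it takes the value \<open>1\<close> at \<open>r\<close>; evaluate the expansion of the sphere sums there.\<close>

lemma transform_expansion:
  assumes k: "nrapid Q k" and kr: "\<And>x. kk x = k (d r x)" and \<nu>: "boundary_measure q E r \<nu>"
    and u: "1 / R \<le> cmod u" "cmod u \<le> R" "u = exp (\<i> * z * of_real (ln q))"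
  shows "spherical_transform q E r \<nu> kk z = laurent_series (abel k) (abel k) u"
proof -
  define g where "g x = spherical_value (sq * u) (d r x)" for x
  have g: "spherical_function q E r \<nu> z x = g x" for x
    unfolding g_def u(3) by (rule spherical_function_eq[OF \<nu>])
  have u0: "u \<noteq> 0" by (simp add: u(3))
  have eig: "sphere_sum E 1 g x = sq * (u + 1 / u) * g x" for x
  proof -
    have "sq * u \<noteq> 0" using u0 sq_nz by (simp del: of_real_eq_0_iff)
    moreover have "of_nat q / (sq * u) = sq * (1 / u)" using sq_nz u0 by (simp add: field_simps sq_sq del: of_real_eq_0_iff)
    ultimately show ?thesis using sphere_sum_spherical_value[of "sq * u" r x]
      by (simp add: g_def[abs_def] distrib_left)
  qed
  obtain C where C: "\<And>n. real q ^ n * cmod (spherical_value (sq * u) n) \<le> C * ((1 + real n) * Q ^ n)"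
    using spherical_value_bound[OF u(1,2)] by blast
  have "summable (\<lambda>n. \<Sum>x | d r x = n. norm (k (d r x) * g x))"
  proof (rule summable_comparison_test'[where N = 0])
    have "summable (\<lambda>n. cmod (k n) * nweight Q 1 n * (2 * C))"
      by (intro summable_mult2 nrapid_weight_summable k Q_pos)
    then show "summable (\<lambda>n. cmod (k n) * (2 * (C * ((1 + real n) * Q ^ n))))" by (simp add: mult_ac)
    fix n
    have "(\<Sum>x | d r x = n. norm (k (d r x) * g x)) = real (card {x. d r x = n}) * (cmod (k n) * cmod (spherical_value (sq * u) n))"
      by (simp add: g_def norm_mult)
    also have "\<dots> \<le> (2 * real q ^ n) * (cmod (k n) * cmod (spherical_value (sq * u) n))"
    proof (rule mult_right_mono)
      have "real (card {x. d r x = n}) \<le> real (2 * q ^ n)" by (rule of_nat_mono[OF card_sphere_le])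
      then show "real (card {x. d r x = n}) \<le> 2 * real q ^ n" by simp
    qed auto
    also have "\<dots> = cmod (k n) * (2 * (real q ^ n * cmod (spherical_value (sq * u) n)))" by (simp add: mult_ac)
    also have "\<dots> \<le> cmod (k n) * (2 * (C * ((1 + real n) * Q ^ n)))"
      by (intro mult_left_mono C) auto
    finally show "norm (\<Sum>x | d r x = n. norm (k (d r x) * g x)) \<le> cmod (k n) * (2 * (C * ((1 + real n) * Q ^ n)))"
      by (simp add: sum_nonneg)
  qed
  from infsum_spheres[OF this]
  have "(\<lambda>n. sphere_sum E n (\<lambda>x. k (d r x) * g x) r) sums spherical_transform q E r \<nu> kk z"
    by (simp add: spherical_transform_def kr g)
  moreover have "sphere_sum E n (\<lambda>x. k (d r x) * g x) r = k n * (\<Sum>j\<le>n. of_real (sphere_coeff n j) * (u ^ j + (1 / u) ^ j))" for n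
  proof -
    have gr: "g r = 1" by (simp add: g_def spherical_value_def)
    have "sphere_sum E n (\<lambda>x. k (d r x) * g x) r = k n * sphere_sum E n g r"
      by (simp add: sphere_sum_def sum_distrib_left)
    also have "sphere_sum E n g r = (\<Sum>j\<le>n. of_real (sphere_coeff n j) * (u ^ j + (1 / u) ^ j))"
      unfolding sphere_sum_expansion cheb_eigenfunction[OF eig u0] by (simp add: gr)
    finally show ?thesis .
  qed
  ultimately have "(\<lambda>n. k n * (\<Sum>j\<le>n. of_real (sphere_coeff n j) * (u ^ j + (1 / u) ^ j))) sums spherical_transform q E r \<nu> kk z"
    by simp
  moreover have u': "cmod (1 / u) \<le> R"
    using u(1) R_pos u0 by (simp add: norm_divide divide_le_eq mult.commute)
  have "cmod (u ^ j + (1 / u) ^ j) \<le> 2 * nweight R 2 j" for j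
  proof -
    have "cmod (u ^ j + (1 / u) ^ j) \<le> R ^ j + R ^ j"
      by (rule order_trans[OF norm_triangle_ineq add_mono]) (use u(2) u' in \<open>auto simp: norm_power intro!: power_mono\<close>)
    also have "\<dots> \<le> 2 * nweight R 2 j"
      using mult_right_mono[of 1 "(1 + real j) ^ 2" "R ^ j"] R_pos by simp
    finally show ?thesis .
  qed
  ultimately have "((\<lambda>j. abel k j * (u ^ j + (1 / u) ^ j)) has_sum spherical_transform q E r \<nu> kk z) UNIV"
    by (intro abel_expansion[OF k])
  then have "(\<lambda>j. abel k j * u ^ j + abel k j * (1 / u) ^ j) sums spherical_transform q E r \<nu> kk z"
    by (simp add: distrib_left has_sum_imp_sums)
  moreover have "(\<lambda>j. abel k j * u ^ j + abel k j * (1 / u) ^ j) sums laurent_series (abel k) (abel k) u"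
    by (rule laurent_series_sums[OF abel_nrapid[OF k] abel_nrapid[OF k] R_pos u(2) u'])
  ultimately show ?thesis by (rule sums_unique2)
qed

end

section \<open>The resolvent of a multiplier\<close>

text \<open>Extended by \<open>0\<close> to the negative integers, the coefficients of a multiplier are of the same kind as
  those of its resolvents.\<close>

definition int_ext :: "(nat \<Rightarrow> complex) \<Rightarrow> int \<Rightarrow> complex" where
  "int_ext b l = (if 0 \<le> l then b (nat l) else 0)"

lemma rapid_int_ext:
  assumes "nrapid R b" shows "rapid R (int_ext b)"
  unfolding rapid_def
proof
  fix K
  obtain C where C: "\<And>n. (1 + real n) ^ K * R ^ n * cmod (b n) \<le> C"
    using assms unfolding nrapid_def by meson
  have "weight R K l * cmod (int_ext b l) \<le> max C 0" for l
    using C[of "nat l"] by (auto simp: int_ext_def max_def)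
  then show "\<exists>C. \<forall>l. weight R K l * cmod (int_ext b l) \<le> C" by blast
qed

lemma int_ext_has_sum:
  "((\<lambda>l. int_ext b l * y l) has_sum s) UNIV \<longleftrightarrow> ((\<lambda>n. b n * y (int n)) has_sum s) UNIV"
proof -
  have "((\<lambda>l. int_ext b l * y l) has_sum s) UNIV \<longleftrightarrow> ((\<lambda>l. int_ext b l * y l) has_sum s) (range int)"
  proof (rule has_sum_cong_neutral)
    fix l :: int assume "l \<in> UNIV - range int"
    then have "l < 0" by (metis DiffD2 int_nat_eq not_less rangeI nonneg_int_cases)
    then show "int_ext b l * y l = 0" by (simp add: int_ext_def)
  qed auto
  also have "\<dots> \<longleftrightarrow> ((\<lambda>n. b n * y (int n)) has_sum s) UNIV"
    using has_sum_reindex[of int UNIV "\<lambda>l. int_ext b l * y l" s] by (simp add: o_def int_ext_def)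
  finally show ?thesis .
qed

lemma closed_annulus_compact: "compact (closed_annulus R)"
proof -
  have "closed_annulus R = cball 0 R - ball 0 (1 / R)" by auto
  then show ?thesis by (simp add: compact_diff)
qed

text \<open>The factor \<open>1 / 2\<close> compensates that the series below sums \<open>cheb (nat \<bar>l\<bar>)\<close> over all integers, so
  that its symbol counts each power of \<open>u\<close> twice.\<close>

definition resolvent_coeff :: "(nat \<Rightarrow> complex) \<Rightarrow> complex \<Rightarrow> int \<Rightarrow> complex" where
  "resolvent_coeff b w l = laurent_coeff l (\<lambda>u. 1 / (w - laurent_series b b u)) / 2"

text \<open>Where the resolvent is controlled: \<open>\<epsilon>\<close> is a lower bound for the distance from the
  values of the symbol, capped by \<open>1\<close> so that powers of \<open>1 / \<epsilon>\<close> increase with the exponent.\<close>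

definition avoids :: "real \<Rightarrow> (nat \<Rightarrow> complex) \<Rightarrow> real \<Rightarrow> complex \<Rightarrow> bool" where
  "avoids R b \<epsilon> w \<longleftrightarrow> 0 < \<epsilon> \<and> \<epsilon> \<le> 1 \<and> (\<forall>u\<in>annulus R. \<epsilon> \<le> cmod (w - laurent_series b b u))"

lemma avoids_near:
  assumes "avoids R b \<epsilon> w" "dist w w' < \<epsilon> / 2" shows "avoids R b (\<epsilon> / 2) w'"
  unfolding avoids_def
proof (intro conjI ballI)
  fix u assume "u \<in> annulus R"
  then have "\<epsilon> \<le> cmod (w - laurent_series b b u)" using assms by (auto simp: avoids_def)
  also have "\<dots> \<le> cmod (w - w') + cmod (w' - laurent_series b b u)"
    using norm_triangle_ineq[of "w - w'" "w' - laurent_series b b u"] by simp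
  finally show "\<epsilon> / 2 \<le> cmod (w' - laurent_series b b u)" using assms(2) by (simp add: dist_norm)
qed (use assms in \<open>auto simp: avoids_def\<close>)

lemma resolvent_coeff_estimate:
  assumes "R > 1" "nrapid R b"
  shows "\<exists>C. \<forall>w \<epsilon> l. avoids R b \<epsilon> w \<longrightarrow>
    weight R N l * cmod (resolvent_coeff b w l) \<le> C / \<epsilon> ^ (N + 1)"
proof -
  obtain C where C: "\<And>w \<epsilon> l. avoids R b \<epsilon> w \<Longrightarrow>
    weight R N l * cmod (laurent_coeff l (\<lambda>u. 1 / (w - laurent_series b b u)))
      \<le> C / \<epsilon> ^ (N + 1)"
    using resolvent_coeff_bound[OF assms, of N] unfolding avoids_def by blast
  have "weight R N l * cmod (resolvent_coeff b w l) \<le> (C / 2) / \<epsilon> ^ (N + 1)"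
    if "avoids R b \<epsilon> w" for w \<epsilon> l
    using C[OF that, of l] by (simp add: resolvent_coeff_def norm_divide)
  then show ?thesis by blast
qed

lemma rapid_resolvent_coeff:
  assumes "R > 1" "nrapid R b" "avoids R b \<epsilon> w" shows "rapid R (resolvent_coeff b w)"
  unfolding rapid_def using resolvent_coeff_estimate[OF assms(1,2)] assms(3) by meson

lemma resolvent_coeff_identity:
  assumes R: "R > 1" and b: "nrapid R b" and av: "avoids R b \<epsilon> w"
  shows "(\<Sum>\<^sub>\<infinity>m. int_ext b m * (resolvent_coeff b w (k - m) + resolvent_coeff b w (k + m)))
    = w * resolvent_coeff b w k - (if k = 0 then 1 / 2 else 0)"
proof -
  let ?c = "resolvent_coeff b w"
  let ?l = "\<lambda>l. laurent_coeff l (\<lambda>u. 1 / (w - laurent_series b b u))"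
  obtain C where C: "\<And>l. weight R 0 l * cmod (?c l) \<le> C"
    using rapid_resolvent_coeff[OF R b av] unfolding rapid_def by meson
  have c: "cmod (?c l) \<le> C" for l
    using C[of l] mult_right_mono[OF one_le_power[of R "nat \<bar>l\<bar>"], of "cmod (?c l)"] R by simp
  have "summable (\<lambda>m. norm (b m * (?c (k - int m) + ?c (k + int m))))"
  proof (rule summable_comparison_test'[where N = 0])
    show "summable (\<lambda>m. cmod (b m) * R ^ m * (2 * C))"
      using R by (intro summable_mult2 nrapid_summable b) auto
    fix m
    have C0: "0 \<le> C" using c[of 0] norm_ge_zero order_trans by blast
    have "norm (b m * (?c (k - int m) + ?c (k + int m))) \<le> cmod (b m) * (C + C)"
      unfolding norm_mult by (intro mult_left_mono order_trans[OF norm_triangle_ineq add_mono] c) auto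
    also have "\<dots> \<le> (cmod (b m) * R ^ m) * (C + C)"
      using R C0 mult_left_mono[OF one_le_power[of R m], of "cmod (b m)"] by (intro mult_right_mono) auto
    finally show "norm (norm (b m * (?c (k - int m) + ?c (k + int m)))) \<le> cmod (b m) * R ^ m * (2 * C)" by simp
  qed
  moreover have "(\<lambda>m. b m * (?c (k - int m) + ?c (k + int m))) sums (w * ?c k - (if k = 0 then 1 / 2 else 0))"
  proof -
    have "(\<lambda>m. (b m * (?l (k - int m) + ?l (k + int m))) / 2) sums ((w * ?l k - (if k = 0 then 1 else 0)) / 2)"
      by (rule sums_divide[OF resolvent_coeff_convolution[OF R b]]) (use av in \<open>auto simp: avoids_def\<close>)
    moreover have "(b m * (?l (k - int m) + ?l (k + int m))) / 2 = b m * (?c (k - int m) + ?c (k + int m))" for m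
      by (simp add: resolvent_coeff_def field_simps)
    moreover have "(w * ?l k - (if k = 0 then 1 else 0)) / 2 = w * ?c k - (if k = 0 then 1 / 2 else 0)"
      by (simp add: resolvent_coeff_def field_simps)
    ultimately show ?thesis by simp
  qed
  ultimately have "((\<lambda>m. b m * (?c (k - int m) + ?c (k + int m))) has_sum (w * ?c k - (if k = 0 then 1 / 2 else 0))) UNIV"
    by (rule norm_summable_imp_has_sum)
  then have "((\<lambda>m. int_ext b m * (?c (k - m) + ?c (k + m))) has_sum (w * ?c k - (if k = 0 then 1 / 2 else 0))) UNIV"
    by (subst int_ext_has_sum)
  then show ?thesis by (rule infsumI)
qed

context schwartz_tree begin

abbreviation X where "X \<equiv> schwartz q E r p"
abbreviation seminorm where "seminorm \<equiv> schwartz_seminorm q E r p"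

definition cheb_series :: "(int \<Rightarrow> complex) \<Rightarrow> ('a \<Rightarrow> complex) \<Rightarrow> 'a \<Rightarrow> complex" where
  "cheb_series c f x = (\<Sum>\<^sub>\<infinity>l. c l * cheb_int l f x)"

lemma moderate_cheb:
  assumes "f \<in> X" shows "moderate R (\<lambda>l. cheb_int l f x)"
  unfolding moderate_def
proof (intro exI allI)
  fix l :: int
  show "cmod (cheb_int l f x) \<le> (2 * (1 + real q) * seminorm 0 f) * (weight R 2 l)"
    using cheb_bound[OF weighted_bound_seminorm[OF assms], of "nat \<bar>l\<bar>" x] by simp
qed

lemma cheb_series_has_sum:
  assumes "rapid R c" "f \<in> X"
  shows "((\<lambda>l. c l * cheb_int l f x) has_sum cheb_series c f x) UNIV"
  unfolding cheb_series_def
  by (rule has_sum_infsum[OF rapid_moderate_summable(2)[OF assms(1) R_pos moderate_cheb[OF assms(2)]]])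

text \<open>The seminorms of the terms grow like \<open>(1 + \<bar>l\<bar>)\<^sup>m\<^sup>+\<^sup>2 R\<^bsup>\<bar>l\<bar>\<^esup>\<close>; two more powers make the series
  converge.\<close>

lemma cheb_series_bound:
  assumes c: "rapid R c" "\<And>l. weight R (m + 4) l * cmod (c l) \<le> C"
    and f: "f \<in> X" and B: "weighted_bound m B f"
  shows "weighted_bound m (2 * (1 + real q) * (\<Sum>\<^sub>\<infinity>l::int. 1 / (1 + real_of_int \<bar>l\<bar>) ^ 2) * C * B) (cheb_series c f)"
  unfolding weighted_bound_def
proof
  fix x
  define w where "w = (1 + real (d r x)) ^ m * Q ^ d r x"
  have w0: "0 \<le> w" using Q_pos by (simp add: w_def)
  have B0: "0 \<le> B" by (rule weighted_bound_nonneg[OF B])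
  let ?s = "\<lambda>l::int. 1 / (1 + real_of_int \<bar>l\<bar>) ^ 2"
  have s: "(\<lambda>l. norm (c l * cheb_int l f x)) summable_on UNIV"
    by (rule rapid_moderate_summable(1)[OF c(1) R_pos moderate_cheb[OF f]])
  have "w * cmod (cheb_series c f x) \<le> w * (\<Sum>\<^sub>\<infinity>l. norm (c l * cheb_int l f x))"
    unfolding cheb_series_def by (intro mult_left_mono norm_infsum_bound s w0)
  also have "\<dots> = (\<Sum>\<^sub>\<infinity>l. w * norm (c l * cheb_int l f x))" by (simp add: infsum_cmult_right')
  also have "\<dots> \<le> (\<Sum>\<^sub>\<infinity>l. (2 * (1 + real q) * C * B) * ?s l)"
  proof (rule infsum_mono)
    show "(\<lambda>l. w * norm (c l * cheb_int l f x)) summable_on UNIV" by (rule summable_on_cmult_right[OF s])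
    show "(\<lambda>l. (2 * (1 + real q) * C * B) * ?s l) summable_on UNIV"
      by (intro summable_on_cmult_right inverse_square_summable_int)
    fix l :: int
    let ?y = "1 + real_of_int \<bar>l\<bar>" and ?n = "nat \<bar>l\<bar>"
    have y: "0 < ?y" by simp
    have "w * cmod (cheb ?n f x) \<le> 2 * (1 + real q) * ?y ^ (m + 2) * R ^ ?n * B"
      using weighted_bound_cheb[OF B, of ?n] unfolding weighted_bound_def w_def by simp
    then have "cmod (c l) * (w * cmod (cheb ?n f x)) \<le> cmod (c l) * (2 * (1 + real q) * ?y ^ (m + 2) * R ^ ?n * B)"
      by (rule mult_left_mono) simp
    then have "w * norm (c l * cheb ?n f x) \<le> cmod (c l) * (2 * (1 + real q) * ?y ^ (m + 2) * R ^ ?n * B)"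
      by (simp only: norm_mult mult.left_commute)
    also have "\<dots> = (2 * (1 + real q) * B) * (?y ^ (m + 2) * R ^ ?n * cmod (c l))" by (simp only: mult_ac)
    also have "\<dots> \<le> (2 * (1 + real q) * B) * (C / ?y ^ 2)"
    proof (rule mult_left_mono)
      have "(?y ^ (m + 2) * R ^ ?n * cmod (c l)) * ?y ^ 2 = ?y ^ (m + 4) * R ^ ?n * cmod (c l)"
      proof -
        have e: "m + 4 = (m + 2) + 2" by simp
        have "?y ^ (m + 2) * ?y ^ 2 = ?y ^ (m + 4)" unfolding e by (simp only: power_add)
        moreover have "(?y ^ (m + 2) * R ^ ?n * cmod (c l)) * ?y ^ 2 = (?y ^ (m + 2) * ?y ^ 2) * R ^ ?n * cmod (c l)"
          by (simp only: mult_ac)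
        ultimately show ?thesis by simp
      qed
      then show "?y ^ (m + 2) * R ^ ?n * cmod (c l) \<le> C / ?y ^ 2"
        using c(2)[of l] y by (subst pos_le_divide_eq) (simp_all only: zero_less_power)
    qed (use B0 in auto)
    finally show "w * norm (c l * cheb ?n f x) \<le> (2 * (1 + real q) * C * B) * ?s l" by (simp add: mult_ac)
  qed
  also have "\<dots> = 2 * (1 + real q) * (\<Sum>\<^sub>\<infinity>l. ?s l) * C * B"
    unfolding infsum_cmult_right' by (simp only: mult_ac)
  finally show "(1 + real (d r x)) ^ m * Q ^ d r x * cmod (cheb_series c f x)
      \<le> 2 * (1 + real q) * (\<Sum>\<^sub>\<infinity>l. ?s l) * C * B"
    by (simp add: w_def)
qed

lemma cheb_series_schwartz:
  assumes "rapid R c" "f \<in> X" shows "cheb_series c f \<in> X"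
proof (rule schwartzI)
  fix m
  obtain C where "\<And>l. weight R (m + 4) l * cmod (c l) \<le> C"
    using assms(1) unfolding rapid_def by meson
  from cheb_series_bound[OF assms(1) this assms(2) weighted_bound_seminorm[OF assms(2)]]
  show "\<exists>B. weighted_bound m B (cheb_series c f)" by blast
qed

lemma schwartz_lin:
  assumes "f \<in> X" "g \<in> X" shows "(\<lambda>x. a * f x - g x) \<in> X"
  by (rule schwartzI)
    (use weighted_bound_diff[OF weighted_bound_scale weighted_bound_seminorm[OF assms(2)]]
      weighted_bound_seminorm[OF assms(1)] in blast)

lemma cheb_series_lin:
  assumes "rapid R c" "f \<in> X" "g \<in> X"
  shows "cheb_series c (\<lambda>x. a * f x - g x) = (\<lambda>x. a * cheb_series c f x - cheb_series c g x)"
proof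
  fix x
  have "((\<lambda>l. a * (c l * cheb_int l f x) + - (c l * cheb_int l g x)) has_sum
      a * cheb_series c f x + - cheb_series c g x) UNIV"
    by (intro has_sum_add has_sum_cmult_right has_sum_uminusI cheb_series_has_sum assms)
  then have "((\<lambda>l. c l * cheb_int l (\<lambda>x. a * f x - g x) x) has_sum
      a * cheb_series c f x - cheb_series c g x) UNIV"
    by (simp add: cheb_lin algebra_simps)
  then show "cheb_series c (\<lambda>x. a * f x - g x) x = a * cheb_series c f x - cheb_series c g x"
    unfolding cheb_series_def[of c "\<lambda>x. a * f x - g x"] by (rule infsumI)
qed

lemma cheb_series_compose:
  assumes "rapid R c" "rapid R a" "f \<in> X"
  shows "cheb_series c (cheb_series a f) x
    = (\<Sum>\<^sub>\<infinity>l. c l * (\<Sum>\<^sub>\<infinity>m. a m * (cheb_int (l + m) f x + cheb_int (l - m) f x)))"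
proof -
  have "cheb n (cheb_series a f) x = (\<Sum>\<^sub>\<infinity>m. a m * (cheb_int (m + int n) f x + cheb_int (m - int n) f x))" for n
  proof -
    have "((\<lambda>m. cheb n (\<lambda>x. a m * cheb_int m f x) x) has_sum cheb n (cheb_series a f) x) UNIV"
      by (rule cheb_has_sum[OF cheb_series_has_sum[OF assms(2,3)]])
    then show ?thesis unfolding cheb_lin(3) cheb_mult by (simp add: infsumI)
  qed
  moreover have "cheb (nat \<bar>m + int (nat \<bar>l\<bar>)\<bar>) f x + cheb (nat \<bar>m - int (nat \<bar>l\<bar>)\<bar>) f x
      = cheb_int (l + m) f x + cheb_int (l - m) f x" for l m
    by (cases "l \<ge> 0") (simp_all add: abs_minus_commute add.commute)
  ultimately show ?thesis unfolding cheb_series_def[of c] by simp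
qed

lemma cheb_series_commute:
  assumes "rapid R c" "rapid R a" "f \<in> X"
  shows "cheb_series c (cheb_series a f) = cheb_series a (cheb_series c f)"
proof
  fix x
  let ?v = "\<lambda>k. cheb_int k f x"
  show "cheb_series c (cheb_series a f) x = cheb_series a (cheb_series c f) x"
    unfolding cheb_series_compose[OF assms] cheb_series_compose[OF assms(2,1,3)]
    by (rule cheb_product_commute[OF assms(1,2) R_ge_1, of ?v]) (use moderate_cheb[OF assms(3)] in auto)
qed

text \<open>The symbol of the series with coefficients \<open>resolvent_coeff b w\<close> is \<open>1 / (w - h)\<close>.\<close>

lemma resolvent:
  assumes b: "nrapid R b" and av: "avoids R b \<epsilon> w" and f: "f \<in> X"
  shows "cheb_series (resolvent_coeff b w) (cheb_series (int_ext b) f)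
      = (\<lambda>x. w * cheb_series (resolvent_coeff b w) f x - f x)"
proof
  fix x
  let ?c = "resolvent_coeff b w" and ?v = "\<lambda>k. cheb_int k f x"
  note c = rapid_resolvent_coeff[OF R_gt_1 b av]
  have "cheb_series ?c (cheb_series (int_ext b) f) x
      = (\<Sum>\<^sub>\<infinity>k. (\<Sum>\<^sub>\<infinity>m. int_ext b m * (?c (k - m) + ?c (k + m))) * ?v k)"
    unfolding cheb_series_compose[OF c rapid_int_ext[OF b] f]
    by (rule cheb_product_collect[OF c rapid_int_ext[OF b] R_ge_1 moderate_cheb[OF f]])
  also have "\<dots> = (\<Sum>\<^sub>\<infinity>k. w * (?c k * ?v k) + - (if k = 0 then f x else 0))"
    unfolding resolvent_coeff_identity[OF R_gt_1 b av] by (intro infsum_cong) (auto simp: algebra_simps)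
  also have "\<dots> = w * cheb_series ?c f x + - f x"
  proof (rule infsumI, intro has_sum_add has_sum_cmult_right has_sum_uminusI cheb_series_has_sum c f)
    show "((\<lambda>k::int. if k = 0 then f x else 0) has_sum f x) UNIV"
      by (rule has_sum_finite_neutralI[of "{0}"]) auto
  qed
  finally show "cheb_series ?c (cheb_series (int_ext b) f) x = w * cheb_series ?c f x - f x" by simp
qed

lemma resolvent_seminorm:
  assumes b: "nrapid R b"
  shows "\<exists>C. \<forall>w \<epsilon> f. avoids R b \<epsilon> w \<longrightarrow> f \<in> X \<longrightarrow>
    seminorm m (cheb_series (resolvent_coeff b w) f) \<le> C / \<epsilon> ^ (m + 5) * seminorm m f"
proof -
  obtain C where C: "\<And>w \<epsilon> l. avoids R b \<epsilon> w \<Longrightarrow>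
    weight R (m + 4) l * cmod (resolvent_coeff b w l) \<le> C / \<epsilon> ^ (m + 4 + 1)"
    using resolvent_coeff_estimate[OF R_gt_1 b, of "m + 4"] by blast
  let ?D = "2 * (1 + real q) * (\<Sum>\<^sub>\<infinity>l::int. 1 / (1 + real_of_int \<bar>l\<bar>) ^ 2)"
  have "seminorm m (cheb_series (resolvent_coeff b w) f) \<le> (?D * C) / \<epsilon> ^ (m + 5) * seminorm m f"
    if av: "avoids R b \<epsilon> w" and f: "f \<in> X" for w \<epsilon> f
    using seminorm_le[OF cheb_series_bound[OF rapid_resolvent_coeff[OF R_gt_1 b av] C[OF av] f weighted_bound_seminorm[OF f]]]
    by (simp add: add.commute)
  then show ?thesis by blast
qed

text \<open>Applied to a fixed \<open>f\<close>, the distributions \<open>T n\<close> form a bounded scalar sequence. Its generating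
  function outside the unit disc is \<open>T 0\<close> applied to the resolvent \<open>V w f\<close>, because the orbit of a
  resolvent telescopes; so it continues holomorphically to wherever \<open>w\<close> stays away from the range of the
  symbol, that is to the closed unit disc without \<open>Z\<close>. Inside the disc the seminorm bound for the resolvent
  gives polynomial growth, and the theorem on bounded sequences applies.\<close>

theorem orbit_expansion:
  fixes T :: "nat \<Rightarrow> ('a \<Rightarrow> complex) \<Rightarrow> complex"
  assumes b: "nrapid R b"
    and outside: "\<And>u. 1 / R \<le> cmod u \<Longrightarrow> cmod u \<le> R \<Longrightarrow> 1 \<le> cmod (laurent_series b b u)"
    and Z: "Z = laurent_series b b ` (closed_annulus R) \<inter> {w. cmod w = 1}" "finite Z"
    and T_lin: "\<And>n a f g. f \<in> X \<Longrightarrow> g \<in> X \<Longrightarrow> T n (\<lambda>x. a * f x - g x) = a * T n f - T n g"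
    and T_step: "\<And>n f. f \<in> X \<Longrightarrow> T n (cheb_series (int_ext b) f) = T (Suc n) f"
    and T_bound: "\<And>n f. f \<in> X \<Longrightarrow> cmod (T n f) \<le> M * seminorm m f" and M: "0 < M"
    and f: "f \<in> X"
  shows "\<exists>c. \<forall>n. T n f = (\<Sum>\<alpha>\<in>Z. c \<alpha> * \<alpha> ^ n)"
proof -
  let ?h = "laurent_series b b" and ?A = "closed_annulus R"
  define V where "V w = cheb_series (resolvent_coeff b w)" for w
  define P where "P w g = T 0 (V w g)" for w g
  have V_X: "V w g \<in> X" if "avoids R b \<epsilon> w" "g \<in> X" for \<epsilon> w g
    unfolding V_def by (rule cheb_series_schwartz[OF rapid_resolvent_coeff[OF R_gt_1 b that(1)] that(2)])
  have V_U: "V w (cheb_series (int_ext b) g) = (\<lambda>x. w * V w g x - g x)"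
    and U_V: "cheb_series (int_ext b) (V w g) = (\<lambda>x. w * V w g x - g x)" if "avoids R b \<epsilon> w" "g \<in> X" for \<epsilon> w g
    using resolvent[OF b that] cheb_series_commute[OF rapid_int_ext[OF b] rapid_resolvent_coeff[OF R_gt_1 b that(1)] that(2)]
    by (simp_all add: V_def)
  obtain C where C: "\<And>w \<epsilon> g. avoids R b \<epsilon> w \<Longrightarrow> g \<in> X \<Longrightarrow> seminorm m (V w g) \<le> C / \<epsilon> ^ (m + 5) * seminorm m g"
    using resolvent_seminorm[OF b, of m] unfolding V_def by blast
  have P_bound: "cmod (P w g) \<le> M * (C / \<epsilon> ^ (m + 5) * seminorm m g)" if "avoids R b \<epsilon> w" "g \<in> X" for w \<epsilon> g
  proof -
    have "cmod (P w g) \<le> M * seminorm m (V w g)" unfolding P_def by (rule T_bound[OF V_X[OF that]])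
    also have "\<dots> \<le> M * (C / \<epsilon> ^ (m + 5) * seminorm m g)" using C[OF that] M by (intro mult_left_mono) auto
    finally show ?thesis .
  qed
  \<comment> \<open>The resolvent identity. Together with local boundedness it yields continuity and then
    differentiability of \<open>P\<close> in \<open>w\<close>, so that no derivative of an integral in \<open>w\<close> is ever needed.\<close>
  have identity: "P w g - P w0 g = (w0 - w) * P w (V w0 g)"
    if av: "avoids R b \<epsilon> w" "avoids R b \<epsilon>0 w0" and g: "g \<in> X" for w w0 \<epsilon> \<epsilon>0 g
  proof -
    have Vg: "V w0 g \<in> X" "V w g \<in> X" "V w (V w0 g) \<in> X" using V_X av g by auto
    have "V w (\<lambda>x. w0 * V w0 g x - g x) = (\<lambda>x. w * V w (V w0 g) x - V w0 g x)"
      using V_U[OF av(1) Vg(1)] U_V[OF av(2) g] by simp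
    then have "(\<lambda>x. w0 * V w (V w0 g) x - V w g x) = (\<lambda>x. w * V w (V w0 g) x - V w0 g x)"
      using cheb_series_lin[OF rapid_resolvent_coeff[OF R_gt_1 b av(1)] Vg(1) g] by (simp add: V_def)
    then have "T 0 (\<lambda>x. w0 * V w (V w0 g) x - V w g x) = T 0 (\<lambda>x. w * V w (V w0 g) x - V w0 g x)" by simp
    then have "w0 * P w (V w0 g) - P w g = w * P w (V w0 g) - P w0 g"
      by (simp only: T_lin[OF Vg(3,2)] T_lin[OF Vg(3,1)] P_def)
    then show ?thesis by (simp add: algebra_simps)
  qed
  have P_near: "\<exists>K. eventually (\<lambda>w. avoids R b (\<epsilon> / 2) w \<and> cmod (P w g) \<le> K) (nhds w0)"
    if av: "avoids R b \<epsilon> w0" and g: "g \<in> X" for w0 \<epsilon> g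
  proof -
    have "eventually (\<lambda>w. avoids R b (\<epsilon> / 2) w) (nhds w0)"
      using av avoids_near[OF av] by (auto simp: eventually_nhds_metric dist_commute avoids_def intro!: exI[of _ "\<epsilon> / 2"])
    then have "eventually (\<lambda>w. avoids R b (\<epsilon> / 2) w \<and> cmod (P w g) \<le> M * (C / (\<epsilon> / 2) ^ (m + 5) * seminorm m g)) (nhds w0)"
      by (rule eventually_mono) (use P_bound[OF _ g] in blast)
    then show ?thesis by blast
  qed
  have P_cont: "((\<lambda>w. P w g) \<longlongrightarrow> P w0 g) (at w0)" if av: "avoids R b \<epsilon> w0" and g: "g \<in> X" for w0 \<epsilon> g
  proof -
    obtain K where K: "eventually (\<lambda>w. avoids R b (\<epsilon> / 2) w \<and> cmod (P w (V w0 g)) \<le> K) (nhds w0)"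
      using P_near[OF av V_X[OF av g]] by blast
    have "((\<lambda>w. P w g - P w0 g) \<longlongrightarrow> 0) (at w0)"
    proof (rule Lim_null_comparison)
      show "eventually (\<lambda>w. norm (P w g - P w0 g) \<le> cmod (w0 - w) * K) (at w0)"
        using eventually_nhds_x_imp_x[OF K] K unfolding eventually_at_filter
        by (auto elim!: eventually_mono simp: identity[OF _ av g] norm_mult intro!: mult_left_mono)
      have "((\<lambda>w. cmod (w0 - w) * K) \<longlongrightarrow> cmod (w0 - w0) * K) (at w0)" by (intro tendsto_intros)
      then show "((\<lambda>w. cmod (w0 - w) * K) \<longlongrightarrow> 0) (at w0)" by simp
    qed
    then show ?thesis by (rule LIM_zero_cancel)
  qed
  have P_deriv: "((\<lambda>w. P w f) has_field_derivative - P w0 (V w0 f)) (at w0)" if av: "avoids R b \<epsilon> w0" for w0 \<epsilon>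
    unfolding has_field_derivative_iff
  proof (rule Lim_transform_eventually)
    show "((\<lambda>w. - P w (V w0 f)) \<longlongrightarrow> - P w0 (V w0 f)) (at w0)"
      by (intro tendsto_minus P_cont[OF av V_X[OF av f]])
    obtain K where K: "eventually (\<lambda>w. avoids R b (\<epsilon> / 2) w \<and> cmod (P w f) \<le> K) (nhds w0)"
      using P_near[OF av f] by blast
    show "eventually (\<lambda>w. - P w (V w0 f) = (P w f - P w0 f) / (w - w0)) (at w0)"
      using K unfolding eventually_at_filter
    proof (rule eventually_mono, safe)
      fix w assume "avoids R b (\<epsilon> / 2) w" "w \<noteq> w0"
      then have "P w f - P w0 f = - P w (V w0 f) * (w - w0)" "w - w0 \<noteq> 0"
        using identity[OF _ av f] by (simp_all add: algebra_simps)
      then show "- P w (V w0 f) = (P w f - P w0 f) / (w - w0)" by (metis nonzero_mult_div_cancel_right)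
    qed
  qed
  have sums_P: "(\<lambda>n. T n f / w ^ Suc n) sums P w f" if av: "avoids R b \<epsilon> w" and w: "1 < cmod w" for w \<epsilon>
  proof -
    let ?g = "V w f"
    have w0: "w \<noteq> 0" using w by auto
    have g: "?g \<in> X" by (rule V_X[OF av f])
    have "T (Suc n) ?g = w * T n ?g - T n f" for n
      using T_step[OF g, of n] U_V[OF av f] T_lin[OF g f, of n w] by simp
    then have term_eq: "T n f / w ^ Suc n = T n ?g / w ^ n - T (Suc n) ?g / w ^ Suc n" for n
      using w0 by (simp add: field_simps)
    have "(\<lambda>n. T n ?g / w ^ n) \<longlonglongrightarrow> 0"
    proof (rule Lim_null_comparison)
      show "eventually (\<lambda>n. norm (T n ?g / w ^ n) \<le> M * seminorm m ?g * (1 / cmod w) ^ n) sequentially"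
        using T_bound[OF g] by (intro always_eventually allI) (simp add: norm_divide norm_power power_divide divide_right_mono)
      have "(\<lambda>n. (1 / cmod w) ^ n) \<longlonglongrightarrow> 0" using w by (intro LIMSEQ_realpow_zero) (auto simp: divide_less_eq)
      then show "(\<lambda>n. M * seminorm m ?g * (1 / cmod w) ^ n) \<longlonglongrightarrow> 0" by (rule tendsto_mult_right_zero)
    qed
    from telescope_sums'[OF this] show ?thesis unfolding term_eq P_def by simp
  qed
  define G where "G w = (if 1 < cmod w then \<Sum>n. T n f / w ^ Suc n else P w f)" for w
  have T_bdd: "cmod (T n f) \<le> M * seminorm m f" for n by (rule T_bound[OF f])
  have G_sums: "(\<lambda>n. T n f / w ^ Suc n) sums G w" if w: "1 < cmod w" for w
  proof -
    have "summable (\<lambda>n. M * seminorm m f / cmod w * (1 / cmod w) ^ n)"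
      using w by (intro summable_mult summable_geometric) (simp add: norm_divide divide_less_eq)
    then have "summable (\<lambda>n. T n f / w ^ Suc n)"
    proof (rule summable_comparison_test'[where N = 0])
      fix n
      have "norm (T n f / w ^ Suc n) = cmod (T n f) / cmod w ^ Suc n" by (simp only: norm_divide norm_power)
      also have "\<dots> \<le> (M * seminorm m f) / cmod w ^ Suc n" using T_bdd by (intro divide_right_mono) auto
      finally show "norm (T n f / w ^ Suc n) \<le> M * seminorm m f / cmod w * (1 / cmod w) ^ n"
        by (simp add: power_divide)
    qed
    then show ?thesis using w by (simp add: G_def summable_sums)
  qed
  have G_P: "G w = P w f" if "avoids R b \<epsilon> w" for w \<epsilon>
    using sums_P[OF that] by (simp add: G_def sums_iff)
  have avoids_off: "\<exists>\<epsilon>. avoids R b \<epsilon> w" if "cmod w \<le> 1" "w \<notin> Z" for w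
  proof -
    have sub: "annulus R \<subseteq> ?A" by (auto simp: annulus_def)
    have cont: "continuous_on ?A ?h" by (rule continuous_on_laurent_series[OF R_gt_1 b b])
    have comp: "compact (?h ` ?A)" by (rule compact_continuous_image[OF cont closed_annulus_compact])
    have "w \<notin> ?h ` ?A"
      using that outside unfolding Z(1) by fastforce
    then obtain \<delta> where \<delta>: "0 < \<delta>" "\<And>y. y \<in> ?h ` ?A \<Longrightarrow> \<delta> \<le> dist w y"
      using separate_point_closed[OF compact_imp_closed[OF comp]] by blast
    then have "avoids R b (min \<delta> 1) w"
      unfolding avoids_def using sub by (force simp: dist_norm)
    then show ?thesis by blast
  qed
  have hol_out: "G field_differentiable at w" if w: "1 < cmod w" for w
  proof -
    define F where "F x = (\<Sum>n. T n f * x ^ n)" for x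
    have F_sums: "(\<lambda>n. T n f * x ^ n) sums F x" if "cmod x < 1" for x
    proof -
      have "(\<lambda>n. T n f / (1 / x) ^ Suc n) sums G (1 / x)" if "x \<noteq> 0"
        using G_sums[of "1 / x"] that \<open>cmod x < 1\<close> by (simp add: norm_divide)
      then have "summable (\<lambda>n. T n f * x ^ n)"
      proof (cases "x = 0")
        case False
        assume *: "x \<noteq> 0 \<Longrightarrow> (\<lambda>n. T n f / (1 / x) ^ Suc n) sums G (1 / x)"
        have "summable (\<lambda>n. (1 / x) * (T n f / (1 / x) ^ Suc n))"
          by (intro summable_mult sums_summable[OF *[OF False]])
        then show ?thesis using False by (simp add: power_divide field_simps)
      qed auto
      then show ?thesis unfolding F_def by (rule summable_sums)
    qed
    have F_hol: "F holomorphic_on ball 0 1"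
      by (rule power_series_holomorphic[where a = "\<lambda>n. T n f"]) (use F_sums in auto)
    have hol: "(\<lambda>w. F (1 / w) * (1 / w)) holomorphic_on {w. 1 < cmod w}"
      by (intro holomorphic_intros holomorphic_on_compose_gen[OF _ F_hol, unfolded o_def])
        (auto simp: norm_divide divide_less_eq)
    have "G w = F (1 / w) * (1 / w)" if "1 < cmod w" for w
    proof -
      have "(\<lambda>n. T n f * (1 / w) ^ n * (1 / w)) sums (F (1 / w) * (1 / w))"
        using F_sums[of "1 / w"] that by (intro sums_mult2) (simp add: norm_divide divide_less_eq)
      then show ?thesis using G_sums[OF that] sums_unique2 by (fastforce simp: power_divide mult.commute)
    qed
    then have "G holomorphic_on {w. 1 < cmod w}"
      using hol by (subst holomorphic_cong[OF refl]) auto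
    moreover have "open {w :: complex. 1 < cmod w}" by (intro open_Collect_less continuous_intros)
    ultimately show ?thesis using w by (auto intro: holomorphic_on_imp_differentiable_at)
  qed
  show ?thesis
  proof (rule bounded_sequence_finite_spectrum[OF Z(2) _ T_bdd _ G_sums])
    show "cmod \<alpha> = 1" if "\<alpha> \<in> Z" for \<alpha> using that Z(1) by auto
    show "G holomorphic_on - Z"
    proof (rule holomorphic_onI)
      fix w assume w: "w \<in> - Z"
      have "G field_differentiable at w"
      proof (cases "1 < cmod w")
        case False
        then obtain \<epsilon> where av: "avoids R b \<epsilon> w" using avoids_off[of w] w by auto
        obtain K where K: "eventually (\<lambda>w'. avoids R b (\<epsilon> / 2) w' \<and> cmod (P w' f) \<le> K) (nhds w)"
          using P_near[OF av f] by blast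
        then have ev: "eventually (\<lambda>w'. G w' = P w' f) (nhds w)"
          by (rule eventually_mono) (auto simp: G_P)
        have "(G has_field_derivative - P w (V w f)) (at w)"
          by (rule DERIV_cong_ev[OF refl ev refl, THEN iffD2, OF P_deriv[OF av]])
        then show ?thesis by (auto simp: field_differentiable_def)
      qed (rule hol_out)
      then show "G field_differentiable at w within - Z" by (rule field_differentiable_at_within)
    qed
    fix w :: complex assume w: "cmod w < 1"
    have av: "avoids R b (1 - cmod w) w"
      unfolding avoids_def
    proof (intro conjI ballI)
      fix u assume "u \<in> annulus R"
      then have "1 \<le> cmod (?h u)" by (intro outside) (auto simp: annulus_def)
      then show "1 - cmod w \<le> cmod (w - ?h u)" using norm_triangle_ineq2[of "?h u" w] by (simp add: norm_minus_commute)
    qed (use w in auto)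
    have "(1 - cmod w) ^ (m + 5) * cmod (G w) \<le> (1 - cmod w) ^ (m + 5) * (M * (C / (1 - cmod w) ^ (m + 5) * seminorm m f))"
      unfolding G_P[OF av] using w by (intro mult_left_mono P_bound[OF av f]) auto
    also have "\<dots> = M * C * seminorm m f" using w by simp
    finally show "(1 - cmod w) ^ (m + 5) * cmod (G w) \<le> M * C * seminorm m f" .
  qed
qed

end

section \<open>Eigendistributions\<close>

text \<open>A linear combination of finitely many terms isolates the component belonging to \<open>\<beta> i\<close>; since the
  combination does not depend on \<open>s\<close>, it defines the components and shows that they are unique.\<close>

lemma lagrange_extraction:
  fixes \<beta> :: "nat \<Rightarrow> complex" and s :: "nat \<Rightarrow> complex"
  assumes "inj_on \<beta> {1..j}" and lag: "\<forall>\<alpha>\<in>\<beta> ` {1..j}. \<forall>\<gamma>\<in>\<beta> ` {1..j}. poly (lag \<alpha>) \<gamma> = (if \<alpha> = \<gamma> then 1 else 0)"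
    and i: "i \<in> {1..j}" and t: "\<And>k. t k = (\<Sum>l=1..j. s l * \<beta> l ^ k)"
  shows "(\<Sum>k\<le>degree (lag (\<beta> i)). coeff (lag (\<beta> i)) k * t k) = s i"
proof -
  have "(\<Sum>k\<le>degree (lag (\<beta> i)). coeff (lag (\<beta> i)) k * t k)
      = (\<Sum>k\<le>degree (lag (\<beta> i)). \<Sum>l=1..j. s l * (coeff (lag (\<beta> i)) k * \<beta> l ^ k))"
    unfolding t sum_distrib_left by (simp add: mult_ac)
  also have "\<dots> = (\<Sum>l=1..j. s l * poly (lag (\<beta> i)) (\<beta> l))"
    by (subst sum.swap) (simp add: poly_altdef sum_distrib_left)
  also have "\<dots> = (\<Sum>l=1..j. if l = i then s i else 0)"
    by (rule sum.cong) (use assms(1) i lag in \<open>auto simp: inj_on_eq_iff\<close>)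
  also have "\<dots> = s i" using i by simp
  finally show ?thesis .
qed

context schwartz_tree begin

lemma schwartz_add_scale:
  assumes "f \<in> X" "g \<in> X" shows "(\<lambda>x. f x + g x) \<in> X" "(\<lambda>x. c * f x) \<in> X"
proof -
  show "(\<lambda>x. f x + g x) \<in> X"
    by (rule schwartzI, rule exI, rule weighted_bound_add[OF weighted_bound_seminorm[OF assms(1)] weighted_bound_seminorm[OF assms(2)]])
  show "(\<lambda>x. c * f x) \<in> X"
    by (rule schwartzI, rule exI, rule weighted_bound_scale[OF weighted_bound_seminorm[OF assms(1)]])
qed

lemma topspace_schwartz: "topspace (schwartz_topology q E r p) = X"
proof -
  have "X \<subseteq> topspace (schwartz_topology q E r p)"
  proof
    fix f assume f: "f \<in> X"
    have "seminorm 0 (\<lambda>x. f x - f x) < 1"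
      using seminorm_le[of 0 0 "\<lambda>_. 0"] by (simp add: weighted_bound_def)
    then have "f \<in> {g \<in> X. seminorm 0 (\<lambda>x. g x - f x) < 1}" using f by blast
    then show "f \<in> topspace (schwartz_topology q E r p)"
      unfolding schwartz_topology_def topology_generated_by_topspace
      by (rule UnionI[rotated]) (use f zero_less_one in blast)
  qed
  moreover have "topspace (schwartz_topology q E r p) \<subseteq> X"
    unfolding schwartz_topology_def topology_generated_by_topspace by auto
  ultimately show ?thesis by blast
qed

lemma tempered_distributionI:
  assumes add: "\<And>f g. f \<in> X \<Longrightarrow> g \<in> X \<Longrightarrow> S (\<lambda>x. f x + g x) = S f + S g"
    and scale: "\<And>c f. f \<in> X \<Longrightarrow> S (\<lambda>x. c * f x) = c * S f"
    and bound: "\<And>f. f \<in> X \<Longrightarrow> cmod (S f) \<le> B * seminorm m f"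
  shows "tempered_distribution q E r p S"
  unfolding tempered_distribution_def
proof (intro conjI ballI allI)
  show "continuous_map (schwartz_topology q E r p) euclidean S"
    unfolding continuous_map_def
  proof (intro conjI allI impI)
    fix U :: "complex set" assume "openin euclidean U"
    then have U: "open U" by simp
    show "openin (schwartz_topology q E r p) {f \<in> topspace (schwartz_topology q E r p). S f \<in> U}"
    proof (subst openin_subopen, intro ballI)
      fix f assume "f \<in> {f \<in> topspace (schwartz_topology q E r p). S f \<in> U}"
      then have f: "f \<in> X" "S f \<in> U" by (auto simp: topspace_schwartz)
      obtain e where e: "0 < e" "ball (S f) e \<subseteq> U" using U f(2) open_contains_ball by blast
      define \<delta> where "\<delta> = e / (\<bar>B\<bar> + 1)"
      have \<delta>: "0 < \<delta>" using e by (simp add: \<delta>_def)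
      let ?N = "{g \<in> X. seminorm m (\<lambda>x. g x - f x) < \<delta>}"
      have "openin (schwartz_topology q E r p) ?N"
        unfolding schwartz_topology_def by (rule topology_generated_by_Basis) (use f \<delta> in blast)
      moreover have "f \<in> ?N"
        using f seminorm_le[of m 0 "\<lambda>_. 0"] \<delta> by (simp add: weighted_bound_def)
      moreover have "S g \<in> U" if g: "g \<in> ?N" for g
      proof -
        have gX: "g \<in> X" and small: "seminorm m (\<lambda>x. g x - f x) < \<delta>" using g by auto
        have diff: "(\<lambda>x. g x - f x) \<in> X" using schwartz_lin[OF gX f(1), of 1] by simp
        have "S (\<lambda>x. (g x - f x) + f x) = S (\<lambda>x. g x - f x) + S f" by (rule add[OF diff f(1)])
        then have "cmod (S g - S f) = cmod (S (\<lambda>x. g x - f x))" by simp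
        also have "\<dots> \<le> B * seminorm m (\<lambda>x. g x - f x)" by (rule bound[OF diff])
        also have "\<dots> \<le> (\<bar>B\<bar> + 1) * seminorm m (\<lambda>x. g x - f x)"
          using weighted_bound_nonneg[OF weighted_bound_seminorm[OF diff], of m] by (intro mult_right_mono) auto
        also have "\<dots> < (\<bar>B\<bar> + 1) * \<delta>" using small by (intro mult_strict_left_mono) auto
        also have "\<dots> = e" by (simp add: \<delta>_def)
        finally show ?thesis using e(2) by (auto simp: dist_norm norm_minus_commute)
      qed
      ultimately show "\<exists>N. openin (schwartz_topology q E r p) N \<and> f \<in> N \<and>
          N \<subseteq> {f \<in> topspace (schwartz_topology q E r p). S f \<in> U}"
        by (intro exI[of _ ?N]) (auto simp: topspace_schwartz)
    qed
  qed auto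
qed (use add scale in auto)

text \<open>Convolving the indicator function of \<open>{r}\<close> with a radial kernel gives the kernel back, so the kernel
  of a multiplier is itself a Schwartz function.\<close>

lemma kernel_of_multiplier:
  assumes rad: "radial E r kk" and maps: "\<forall>f\<in>X. conv E r f kk \<in> X"
  defines "k \<equiv> radial_value E r kk"
  shows "kk x = k (d r x)" "nrapid Q k"
proof -
  show kk: "kk x = k (d r x)" for x
  proof -
    have "k (d r x) = kk x"
      unfolding k_def radial_value_def
    proof (rule the_equality)
      show "\<forall>y. d r y = d r x \<longrightarrow> kk y = kk x" using rad unfolding radial_def by blast
    qed blast
    then show ?thesis by simp
  qed
  define \<delta> where "\<delta> y = (if y = r then 1 else 0 :: complex)" for y
  have "\<delta> \<in> X"
    by (rule schwartzI) (auto simp: weighted_bound_def \<delta>_def intro!: exI[of _ 1])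
  then have "conv E r \<delta> kk \<in> X" using maps by blast
  moreover have "conv E r \<delta> kk = kk"
  proof
    fix x
    have "((\<lambda>y. \<delta> y * k (d x y)) has_sum k (d x r)) UNIV"
      by (rule has_sum_finite_neutralI[of "{r}"]) (auto simp: \<delta>_def)
    then show "conv E r \<delta> kk x = kk x"
      unfolding conv_def k_def[symmetric] by (simp add: infsumI kk gdist_commute)
  qed
  ultimately have kX: "kk \<in> X" by simp
  show "nrapid Q k"
    unfolding nrapid_def
  proof
    fix K
    have "nweight Q K n * cmod (k n) \<le> seminorm K kk" for n
    proof -
      obtain x where x: "d r x = n" using sphere_nonempty by blast
      show ?thesis using weighted_bound_seminorm[OF kX, of K] x kk[of x] unfolding weighted_bound_def by metis
    qed
    then show "\<exists>C. \<forall>n. nweight Q K n * cmod (k n) \<le> C" by blast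
  qed
qed

text \<open>The map \<open>z \<mapsto> q\<^sup>i\<^sup>z\<close> has modulus \<open>q\<^bsup>- Im z\<^esup>\<close> and takes every nonzero value.\<close>

lemma strip_annulus: "(\<lambda>z. exp (\<i> * z * of_real (ln q))) ` strip p = (closed_annulus R)"
proof -
  have lq: "0 < ln q" using q2 by simp
  have dp: "0 < 1 / p - 1 / 2" using p1 p2 by (simp add: field_simps)
  have R_exp: "R = exp ((1 / p - 1 / 2) * ln q)" using q2 by (simp add: R_def powr_def)
  have "1 / R \<le> exp y \<and> exp y \<le> R \<longleftrightarrow> \<bar>y\<bar> \<le> (1 / p - 1 / 2) * ln q" for y :: real
  proof -
    have "1 / R = exp (- ((1 / p - 1 / 2) * ln q))" by (simp add: R_exp exp_minus inverse_eq_divide)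
    then show ?thesis unfolding R_exp by (simp only: exp_le_cancel_iff) linarith
  qed
  then have key: "1 / R \<le> exp (y * ln q) \<and> exp (y * ln q) \<le> R \<longleftrightarrow> \<bar>y\<bar> \<le> 1 / p - 1 / 2" for y :: real
    using lq by (simp add: abs_mult)
  have norm_exp: "cmod (exp (\<i> * z * of_real (ln q))) = exp ((- Im z) * ln q)" for z
    by (simp add: norm_exp_eq_Re)
  show ?thesis
  proof (intro equalityI subsetI)
    fix u assume "u \<in> (\<lambda>z. exp (\<i> * z * of_real (ln q))) ` strip p"
    then obtain z where z: "z \<in> strip p" "u = exp (\<i> * z * of_real (ln q))" by blast
    have "\<bar>- Im z\<bar> \<le> 1 / p - 1 / 2" using z(1) dp by (simp add: strip_def)
    then show "u \<in> (closed_annulus R)"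
      unfolding z(2) mem_Collect_eq norm_exp using key[of "- Im z"] by blast
  next
    fix u assume u: "u \<in> (closed_annulus R)"
    have "0 < 1 / R" using R_pos by simp
    then have "u \<noteq> 0" using u by auto
    define z where "z = Ln u / (\<i> * of_real (ln q))"
    have e: "exp (\<i> * z * of_real (ln q)) = u"
      using lq \<open>u \<noteq> 0\<close> by (simp add: z_def)
    have "\<bar>- Im z\<bar> \<le> 1 / p - 1 / 2"
      using key[of "- Im z"] u norm_exp[of z] unfolding e by simp
    then have "z \<in> strip p" using dp by (simp add: strip_def)
    then show "u \<in> (\<lambda>z. exp (\<i> * z * of_real (ln q))) ` strip p" using e by blast
  qed
qed

end

theorem theorem4p4:
  fixes q :: nat and E :: "'v \<Rightarrow> 'v \<Rightarrow> bool" and r :: 'v and \<nu> :: "(nat \<Rightarrow> 'v) measure"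
    and p :: real and \<Lambda> :: "('v \<Rightarrow> complex) \<Rightarrow> 'v \<Rightarrow> complex" and \<kappa> :: "complex \<Rightarrow> complex"
    and T :: "nat \<Rightarrow> ('v \<Rightarrow> complex) \<Rightarrow> complex" and A :: complex and m :: nat and M :: real
  assumes "2 \<le> q" and "homogeneous_tree q E" and "boundary_measure q E r \<nu>"
    and "1 \<le> p" and "p < 2"
    and "is_multiplier q E r \<nu> p \<Lambda> \<kappa>"
    and "\<And>z. z \<in> strip p \<Longrightarrow> \<kappa> z \<noteq> 0"
    and "\<And>k. tempered_distribution q E r p (T k)"
    and "A \<noteq> 0"
    and "\<And>k \<phi>. \<phi> \<in> schwartz q E r p \<Longrightarrow> dist_action \<Lambda> (T k) \<phi> = A * T (k + 1) \<phi>"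
    and "0 < M"
    and "\<And>k \<phi>. \<phi> \<in> schwartz q E r p \<Longrightarrow> cmod (T k \<phi>) \<le> M * schwartz_seminorm q E r p m \<phi>"
  shows
    "(cmod A = (LEAST s. s \<in> (\<lambda>z. cmod (\<kappa> z)) ` strip p) \<longrightarrow>
        (\<forall>j a. bij_betw a {1..j} (\<kappa> ` strip p \<inter> {w. cmod w = cmod A}) \<longrightarrow>
          (\<exists>S. eigen_decomposition q E r p \<Lambda> j a (T 0) S \<and>
             (\<forall>S'. eigen_decomposition q E r p \<Lambda> j a (T 0) S' \<longrightarrow>
                (\<forall>i\<in>{1..j}. \<forall>\<phi>\<in>schwartz q E r p. S' i \<phi> = S i \<phi>))))) \<and>
     (cmod A < (LEAST s. s \<in> (\<lambda>z. cmod (\<kappa> z)) ` strip p) \<longrightarrow>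
        (\<forall>\<phi>\<in>schwartz q E r p. T 0 \<phi> = 0))"
proof -
  interpret schwartz_tree q E r p by unfold_locales (use assms in auto)
  obtain kk where kk: "radial E r kk" "\<forall>f\<in>X. conv E r f kk \<in> X" "\<forall>f\<in>X. \<Lambda> f = conv E r f kk"
    "\<forall>z\<in>strip p. \<kappa> z = spherical_transform q E r \<nu> kk z"
    using assms(6) unfolding is_multiplier_def by blast
  define k where "k = radial_value E r kk"
  have k: "nrapid Q k" and k_val: "kk x = k (d r x)" for x
    using kernel_of_multiplier[OF kk(1,2)] by (auto simp: k_def)
  define b where "b = (\<lambda>n. (1 / A) * abel k n)"
  note ak = abel_nrapid[OF k]
  have b: "nrapid R b" unfolding b_def by (rule nrapid_scale[OF ak])
  let ?A = "closed_annulus R" and ?h = "laurent_series b b"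
  let ?e = "\<lambda>z. exp (\<i> * z * of_real (ln q))"
  have h: "?h u = laurent_series (abel k) (abel k) u / A" if "u \<in> ?A" for u
  proof -
    have "0 < 1 / R" using R_pos by simp
    then have "0 < cmod u" using that by (auto intro: less_le_trans)
    then have "cmod (1 / u) \<le> R" using that R_pos by (simp add: norm_divide divide_le_eq mult.commute)
    then show ?thesis
      unfolding laurent_series_def b_def
      using that pow_series_scale[OF ak R_pos, of u "1 / A"] pow_series_scale[OF ak R_pos, of "1 / u" "1 / A"]
      by (simp add: add_divide_distrib)
  qed
  have \<kappa>_h: "\<kappa> z = A * ?h (?e z)" if "z \<in> strip p" for z
  proof -
    have e: "?e z \<in> ?A" using strip_annulus that by blast
    have "\<kappa> z = laurent_series (abel k) (abel k) (?e z)"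
      using kk(4) that transform_expansion[OF k k_val assms(3) _ _ refl, of z] e by simp
    then show ?thesis using h[OF e] assms(9) by simp
  qed
  have range_h: "\<kappa> ` strip p = (\<lambda>w. A * w) ` ?h ` ?A"
    unfolding strip_annulus[symmetric] image_image by (intro image_cong refl \<kappa>_h)
  have \<Lambda>_U: "\<Lambda> f = (\<lambda>x. A * cheb_series (int_ext b) f x)" if f: "f \<in> X" for f
  proof
    fix x
    have "((\<lambda>j. abel k j * cheb j f x) has_sum conv E r f kk x) UNIV"
      by (rule conv_expansion[OF k _ weighted_bound_seminorm[OF f]]) (simp add: k_def)
    then have "((\<lambda>j. (1 / A) * (abel k j * cheb j f x)) has_sum (1 / A) * conv E r f kk x) UNIV"
      by (rule has_sum_cmult_right)
    then have "((\<lambda>l. int_ext b l * cheb (nat \<bar>l\<bar>) f x) has_sum (1 / A) * conv E r f kk x) UNIV"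
      by (subst int_ext_has_sum) (simp add: b_def mult.assoc)
    then have "cheb_series (int_ext b) f x = (1 / A) * conv E r f kk x"
      unfolding cheb_series_def by (rule infsumI)
    then show "\<Lambda> f x = A * cheb_series (int_ext b) f x"
      using kk(3) f assms(9) by simp
  qed
  have \<Lambda>_X: "\<Lambda> f \<in> X" if "f \<in> X" for f using that kk(2,3) by simp
  have T_add: "T n (\<lambda>x. f x + g x) = T n f + T n g" and T_scale: "T n (\<lambda>x. c * f x) = c * T n f"
    if "f \<in> X" "g \<in> X" for n c f g
    using assms(8)[of n] that unfolding tempered_distribution_def by auto
  have T_lin: "T n (\<lambda>x. c * f x - g x) = c * T n f - T n g" if "f \<in> X" "g \<in> X" for n c f g
  proof -
    have "T n (\<lambda>x. c * f x + (-1) * g x) = T n (\<lambda>x. c * f x) + T n (\<lambda>x. (-1) * g x)"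
      by (rule T_add[OF schwartz_add_scale(2)[OF that(1,1)] schwartz_add_scale(2)[OF that(2,2)]])
    then show ?thesis using T_scale[OF that(1,1), of n c] T_scale[OF that(2,2), of n "-1"] by simp
  qed
  have T_\<Lambda>: "T n (\<Lambda> f) = A * T (Suc n) f" if "f \<in> X" for n f
    using assms(10)[OF that, of n] by (simp add: dist_action_def)
  have T_step: "T n (cheb_series (int_ext b) f) = T (Suc n) f" if f: "f \<in> X" for n f
  proof -
    have "A * T n (cheb_series (int_ext b) f) = A * T (Suc n) f"
      using T_\<Lambda>[OF f, of n] T_scale[OF cheb_series_schwartz[OF rapid_int_ext[OF b] f] f, of n A] \<Lambda>_U[OF f] by simp
    then show ?thesis using assms(9) by simp
  qed
  \<comment> \<open>The range of the symbol is the continuous image of a compact annulus, so the least modulus is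
    attained; without this, \<open>LEAST\<close> on the reals would be unspecified.\<close>
  define m0 where "m0 = (LEAST s. s \<in> (\<lambda>z. cmod (\<kappa> z)) ` strip p)"
  have m0: "m0 \<le> cmod (\<kappa> z)" if z: "z \<in> strip p" for z
  proof -
    have comp: "compact (cmod ` ?h ` ?A)"
      by (intro compact_continuous_image continuous_on_laurent_series[OF R_gt_1 b b] closed_annulus_compact
          continuous_on_norm_id)
    have ne: "cmod ` ?h ` ?A \<noteq> {}" using strip_annulus z by blast
    obtain s where s: "s \<in> cmod ` ?h ` ?A" "\<And>t. t \<in> cmod ` ?h ` ?A \<Longrightarrow> s \<le> t"
      using compact_attains_inf[OF comp ne] by blast
    have img: "(\<lambda>z. cmod (\<kappa> z)) ` strip p = (\<lambda>s. cmod A * s) ` cmod ` ?h ` ?A"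
      using arg_cong[OF range_h, of "image cmod"] by (simp add: image_image norm_mult)
    have "m0 = cmod A * s"
      unfolding m0_def img by (rule Least_equality) (use s in \<open>auto intro!: mult_left_mono\<close>)
    moreover have "cmod (\<kappa> z) \<in> (\<lambda>s. cmod A * s) ` cmod ` ?h ` ?A" using z img by blast
    ultimately show ?thesis using s(2) by (auto intro!: mult_left_mono)
  qed
  have expansion: "\<exists>c. \<forall>n. T n f = (\<Sum>\<alpha>\<in>Z. c \<alpha> * \<alpha> ^ n)"
    if le: "cmod A \<le> m0" and fin: "finite (\<kappa> ` strip p \<inter> {w. cmod w = cmod A})"
      and Z: "Z = (\<lambda>w. w / A) ` (\<kappa> ` strip p \<inter> {w. cmod w = cmod A})" and f: "f \<in> X" for Z f
  proof (rule orbit_expansion[where T = T and b = b and m = m, OF b _ _ _ T_lin T_step assms(12) assms(11) f])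
    fix u assume "1 / R \<le> cmod u" "cmod u \<le> R"
    then obtain z where z: "z \<in> strip p" "u = ?e z" using strip_annulus by blast
    have "cmod A * 1 \<le> cmod A * cmod (?h u)"
      using m0[OF z(1)] le \<kappa>_h[OF z(1)] z(2) by (simp add: norm_mult)
    then show "1 \<le> cmod (?h u)" using assms(9) mult_le_cancel_left_pos[of "cmod A" 1 "cmod (?h u)"] by simp
  next
    show "Z = ?h ` ?A \<inter> {w. cmod w = 1}"
    proof (intro equalityI subsetI)
      fix w assume "w \<in> Z"
      then obtain y where "y \<in> ?h ` ?A" "cmod (A * y) = cmod A" "w = (A * y) / A"
        unfolding Z range_h by blast
      then show "w \<in> ?h ` ?A \<inter> {w. cmod w = 1}" using assms(9) by (simp add: norm_mult)
    next
      fix w assume w: "w \<in> ?h ` ?A \<inter> {w. cmod w = 1}"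
      then have "A * w \<in> (\<lambda>w. A * w) ` ?h ` ?A \<inter> {w. cmod w = cmod A}" by (auto simp: norm_mult)
      moreover have "w = (A * w) / A" using assms(9) by simp
      ultimately show "w \<in> Z" unfolding Z range_h by blast
    qed
    show "finite Z" unfolding Z using fin by simp
  qed
  show ?thesis
    unfolding m0_def[symmetric]
  proof (intro conjI impI allI ballI)
    fix f assume less: "cmod A < m0" and f: "f \<in> X"
    then have empty: "\<kappa> ` strip p \<inter> {w. cmod w = cmod A} = {}" using m0 by fastforce
    have "\<exists>c. \<forall>n. T n f = (\<Sum>\<alpha>\<in>{}. c \<alpha> * \<alpha> ^ n)"
      by (rule expansion[OF less_imp_le[OF less] _ _ f]) (simp_all add: empty)
    then show "T 0 f = 0" by simp
  next
    fix j :: nat and a :: "nat \<Rightarrow> complex"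
    assume eq: "cmod A = m0" and a: "bij_betw a {1..j} (\<kappa> ` strip p \<inter> {w. cmod w = cmod A})"
    \<comment> \<open>The points where the normalised symbol meets the unit circle.\<close>
    define \<beta> where "\<beta> i = a i / A" for i
    have inj: "inj_on \<beta> {1..j}" 
    proof (rule inj_onI)
      fix x y assume xy: "x \<in> {1..j}" "y \<in> {1..j}" "\<beta> x = \<beta> y"
      then have "a x = a y" using assms(9) by (simp add: \<beta>_def)
      then show "x = y" using inj_onD[OF bij_betw_imp_inj_on[OF a]] xy by blast
    qed
    have Z: "\<beta> ` {1..j} = (\<lambda>w. w / A) ` (\<kappa> ` strip p \<inter> {w. cmod w = cmod A})"
      unfolding bij_betw_imp_surj_on[OF a, symmetric] image_image \<beta>_def ..
    have fin: "finite (\<kappa> ` strip p \<inter> {w. cmod w = cmod A})"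
      using bij_betw_finite[OF a] by simp
    have "\<exists>s. \<forall>n. T n f = (\<Sum>i=1..j. s i * \<beta> i ^ n)" if f: "f \<in> X" for f
    proof -
      obtain c where c: "\<And>n. T n f = (\<Sum>\<alpha>\<in>\<beta> ` {1..j}. c \<alpha> * \<alpha> ^ n)"
        using expansion[OF _ fin Z f] eq by auto
      have "T n f = (\<Sum>i=1..j. c (\<beta> i) * \<beta> i ^ n)" for n
        unfolding c by (rule sum.reindex_cong[OF inj refl refl])
      then show ?thesis by (intro exI[of _ "\<lambda>i. c (\<beta> i)"]) simp
    qed
    then obtain s where s: "\<And>f n. f \<in> X \<Longrightarrow> T n f = (\<Sum>i=1..j. s f i * \<beta> i ^ n)" by metis
    obtain lag where lag: "\<forall>\<alpha>\<in>\<beta> ` {1..j}. \<forall>\<gamma>\<in>\<beta> ` {1..j}. poly (lag \<alpha>) \<gamma> = (if \<alpha> = \<gamma> then 1 else 0)"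
      using lagrange_polynomials[of "\<beta> ` {1..j}"] by auto
    define S where "S i f = (\<Sum>k\<le>degree (lag (\<beta> i)). coeff (lag (\<beta> i)) k * T k f)" for i f
    have S_s: "S i f = s f i" if "i \<in> {1..j}" "f \<in> X" for i f
      unfolding S_def by (rule lagrange_extraction[OF inj lag that(1) s[OF that(2)]])
    have "eigen_decomposition q E r p \<Lambda> j a (T 0) S"
      unfolding eigen_decomposition_def dist_action_def
    proof (intro conjI ballI)
      fix i assume i: "i \<in> {1..j}"
      show "tempered_distribution q E r p (S i)"
      proof (rule tempered_distributionI)
        fix f assume f: "f \<in> X"
        show "S i (\<lambda>x. c * f x) = c * S i f" for c
          unfolding S_def T_scale[OF f f] sum_distrib_left by (simp add: mult.left_commute)
        show "S i (\<lambda>x. f x + g x) = S i f + S i g" if "g \<in> X" for g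
          unfolding S_def T_add[OF f that] by (simp add: distrib_left sum.distrib)
        have "cmod (S i f) \<le> (\<Sum>k\<le>degree (lag (\<beta> i)). cmod (coeff (lag (\<beta> i)) k) * (M * seminorm m f))"
          unfolding S_def by (rule sum_norm_le) (use assms(12)[OF f] in \<open>auto simp: norm_mult intro!: mult_left_mono\<close>)
        also have "\<dots> = ((\<Sum>k\<le>degree (lag (\<beta> i)). cmod (coeff (lag (\<beta> i)) k)) * M) * seminorm m f"
          by (simp add: sum_distrib_right mult.assoc)
        finally show "cmod (S i f) \<le> ((\<Sum>k\<le>degree (lag (\<beta> i)). cmod (coeff (lag (\<beta> i)) k)) * M) * seminorm m f" .
      qed
      fix f assume f: "f \<in> X"
      have "T n (\<Lambda> f) = (\<Sum>l=1..j. (a l * s f l) * \<beta> l ^ n)" for n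
        unfolding T_\<Lambda>[OF f] s[OF f] sum_distrib_left
        by (rule sum.cong[OF refl]) (use assms(9) in \<open>simp add: \<beta>_def\<close>)
      then have "S i (\<Lambda> f) = a i * s f i"
        unfolding S_def by (rule lagrange_extraction[OF inj lag i])
      then show "S i (\<Lambda> f) = a i * S i f" using S_s[OF i f] by simp
    next
      fix f assume f: "f \<in> X"
      show "T 0 f = (\<Sum>i=1..j. S i f)" using s[OF f, of 0] S_s[OF _ f] by simp
    qed
    moreover have "S' i f = S i f"
      if S': "eigen_decomposition q E r p \<Lambda> j a (T 0) S'" and i: "i \<in> {1..j}" and f: "f \<in> X" for S' i f
    proof -
      have "T n f = (\<Sum>l=1..j. S' l f * \<beta> l ^ n)" if "f \<in> X" for n f
        using that
      proof (induction n arbitrary: f)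
        case 0
        then show ?case using S' by (simp add: eigen_decomposition_def)
      next
        case (Suc n)
        have "S' l (\<Lambda> f) = A * \<beta> l * S' l f" if "l \<in> {1..j}" for l
          using S' that Suc.prems assms(9) by (auto simp: eigen_decomposition_def dist_action_def \<beta>_def)
        then have "A * T (Suc n) f = (\<Sum>l=1..j. A * \<beta> l * S' l f * \<beta> l ^ n)"
          using T_\<Lambda>[OF Suc.prems, of n] Suc.IH[OF \<Lambda>_X[OF Suc.prems]] by simp
        also have "\<dots> = A * (\<Sum>l=1..j. S' l f * \<beta> l ^ Suc n)"
          unfolding sum_distrib_left by (rule sum.cong) (auto simp: mult_ac)
        finally show ?case using assms(9) by simp
      qed
      from lagrange_extraction[OF inj lag i this[OF f]] show ?thesis by (simp add: S_def)
    qed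
    ultimately show "\<exists>S. eigen_decomposition q E r p \<Lambda> j a (T 0) S \<and>
       (\<forall>S'. eigen_decomposition q E r p \<Lambda> j a (T 0) S' \<longrightarrow>
          (\<forall>i\<in>{1..j}. \<forall>\<phi>\<in>X. S' i \<phi> = S i \<phi>))" by blast
  qed
qed

end
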